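(* For integers $n,k,g\ge 1$, the following identities of symmetric functions hold: $$\frac{1}{n!}\sum_{u_1,\dots,u_k\in S_n} p_{\rho(u_1^2u_2^2\cdots u_k^2)} = \sum_{\lambda\vdash n} H_\lambda^{k-1}s_\lambda$$ and $$\frac{1}{n!}\sum_{u_1,v_1,\dots,u_g,v_g\in S_n} p_{\rho([u_1,v_1]\cdots[u_g,v_g])} = \sum_{\lambda\vdash n} H_\lambda^{2g-1}s_\lambda .$$
   Context: $S_n$ is the symmetric group on an $n$-element set. For a partition $\lambda\vdash n$, $p_\lambda$ and $s_\lambda$ are the power sum and Schur symmetric functions, and $H_\lambda$ is the product of the hook lengths of the Young diagram of $\lambda$. For $w\in S_n$, $\rho(w)$ is the partition of $n$ given by the cycle type of $w$. The commutator is $[u,v]=uvu^{-1}v^{-1}$. *)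

theory Defs
  imports
    Complex_Main
    "HOL-Library.Multiset"
    "HOL-Library.FuncSet"
    "HOL-Combinatorics.Combinatorics"
begin

section \<open>Formal power series in countably many variables\<close>

text \<open>
  The ring of symmetric functions sits inside the ring of formal power series in
  the variables \<open>x\<^sub>0, x\<^sub>1, x\<^sub>2, \<dots>\<close>, and identities between symmetric functions are
  identities in that ring. A monomial is encoded as the multiset of (the indices of) its
  variables, so that \<open>x\<^sub>0 x\<^sub>3 x\<^sub>3\<close> is \<open>{#0, 3, 3#}\<close> and the product of monomials is
  addition of multisets. A series is its family of coefficients; no
  finiteness or degree bound is imposed.
\<close>

typedef 'a mfps = "UNIV :: (nat multiset \<Rightarrow> 'a) set"
  morphisms mcoeff Abs_mfps
  by simp

lemma mcoeff_Abs_mfps [simp]: "mcoeff (Abs_mfps f) = f"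
  by (simp add: Abs_mfps_inverse)

lemma mfps_eqI: "(\<And>m. mcoeff f m = mcoeff g m) \<Longrightarrow> f = g"
  by (metis ext mcoeff_inject)

text \<open>The factorizations of a monomial into two monomials.\<close>

definition splits :: "nat multiset \<Rightarrow> (nat multiset \<times> nat multiset) set" where
  "splits m = {(a, b). a + b = m}"

lemma finite_submultisets: "finite {a. a \<subseteq># (m :: 'b multiset)}"
proof -
  have "{a. a \<subseteq># m} \<subseteq> mset ` {xs. set xs \<subseteq> set_mset m \<and> length xs \<le> size m}"
  proof
    fix a assume "a \<in> {a. a \<subseteq># m}"
    then have a: "a \<subseteq># m" by simp
    obtain xs where xs: "mset xs = a" using ex_mset by blast
    have "set xs \<subseteq> set_mset m" using a xs by (metis set_mset_mono set_mset_mset)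
    moreover have "length xs \<le> size m" using a xs by (metis size_mset size_mset_mono)
    ultimately show "a \<in> mset ` {xs. set xs \<subseteq> set_mset m \<and> length xs \<le> size m}"
      using xs by blast
  qed
  then show ?thesis
    by (rule finite_subset) (intro finite_imageI finite_lists_length_le finite_set_mset)
qed

lemma finite_splits [simp]: "finite (splits m)"
proof (rule finite_subset)
  show "splits m \<subseteq> {a. a \<subseteq># m} \<times> {a. a \<subseteq># m}"
    by (auto simp: splits_def)
qed (simp add: finite_submultisets)

lemma splits_empty [simp]: "splits {#} = {({#}, {#})}"
  by (auto simp: splits_def)

instantiation mfps :: (comm_ring_1) comm_ring_1
begin

definition "0 = Abs_mfps (\<lambda>m. 0)"
definition "1 = Abs_mfps (\<lambda>m. if m = {#} then 1 else 0)"
definition "f + g = Abs_mfps (\<lambda>m. mcoeff f m + mcoeff g m)"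
definition "f - g = Abs_mfps (\<lambda>m. mcoeff f m - mcoeff g m)"
definition "- f = Abs_mfps (\<lambda>m. - mcoeff f m)"
definition "f * g = Abs_mfps (\<lambda>m. \<Sum>(a, b)\<in>splits m. mcoeff f a * mcoeff g b)"

instance
proof
  fix f g h :: "'a mfps"
  show "f * g * h = f * (g * h)"
  proof (rule mfps_eqI)
    fix m
    have "mcoeff (f * g * h) m =
        (\<Sum>(x, c)\<in>splits m. \<Sum>(a, b)\<in>splits x. mcoeff f a * mcoeff g b * mcoeff h c)"
      by (simp add: times_mfps_def sum_distrib_right case_prod_unfold)
    also have "\<dots> = (\<Sum>((x, c), (a, b))\<in>(SIGMA p:splits m. splits (fst p)).
        mcoeff f a * mcoeff g b * mcoeff h c)"
      by (subst sum.Sigma [symmetric]) (auto simp: case_prod_unfold)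
    also have "\<dots> = (\<Sum>((a, y), (b, c))\<in>(SIGMA p:splits m. splits (snd p)).
        mcoeff f a * (mcoeff g b * mcoeff h c))"
      by (rule sum.reindex_bij_witness
          [where i = "\<lambda>((a, y), (b, c)). ((a + b, c), (a, b))"
             and j = "\<lambda>((x, c), (a, b)). ((a, b + c), (b, c))"])
        (auto simp: splits_def add_ac mult_ac)
    also have "\<dots> =
        (\<Sum>(a, y)\<in>splits m. \<Sum>(b, c)\<in>splits y. mcoeff f a * (mcoeff g b * mcoeff h c))"
      by (subst sum.Sigma [symmetric]) (auto simp: case_prod_unfold)
    also have "\<dots> = mcoeff (f * (g * h)) m"
      by (simp add: times_mfps_def sum_distrib_left case_prod_unfold)
    finally show "mcoeff (f * g * h) m = mcoeff (f * (g * h)) m" .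
  qed
  show "f * g = g * f"
  proof (rule mfps_eqI)
    fix m
    have "(\<Sum>(a, b)\<in>splits m. mcoeff f a * mcoeff g b) =
        (\<Sum>(a, b)\<in>splits m. mcoeff g a * mcoeff f b)"
      by (rule sum.reindex_bij_witness [where i = prod.swap and j = prod.swap])
        (auto simp: splits_def add_ac mult_ac)
    then show "mcoeff (f * g) m = mcoeff (g * f) m"
      by (simp add: times_mfps_def)
  qed
  show "1 * f = f"
  proof (rule mfps_eqI)
    fix m
    have "mcoeff (1 * f) m =
        (\<Sum>(a, b)\<in>splits m. if (a, b) = ({#}, m) then mcoeff f b else 0)"
      unfolding times_mfps_def mcoeff_Abs_mfps
      by (rule sum.cong) (auto simp: one_mfps_def splits_def)
    also have "\<dots> = (\<Sum>p\<in>splits m. if p = ({#}, m) then mcoeff f (snd p) else 0)"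
      by (simp add: case_prod_unfold prod_eq_iff)
    also have "\<dots> = mcoeff f m"
      by (subst sum.delta, rule finite_splits, simp add: splits_def)
    finally show "mcoeff (1 * f) m = mcoeff f m" .
  qed
  show "(f + g) * h = f * h + g * h"
    by (rule mfps_eqI)
      (simp add: times_mfps_def plus_mfps_def sum.distrib case_prod_unfold distrib_right)
  show "(0 :: 'a mfps) \<noteq> 1"
  proof
    assume "(0 :: 'a mfps) = 1"
    then have "mcoeff (0 :: 'a mfps) {#} = mcoeff 1 {#}" by simp
    then show False by (simp add: zero_mfps_def one_mfps_def)
  qed
qed (auto intro!: mfps_eqI
      simp: zero_mfps_def plus_mfps_def minus_mfps_def uminus_mfps_def add_ac)

end

definition mscale :: "'a :: comm_ring_1 \<Rightarrow> 'a mfps \<Rightarrow> 'a mfps" where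
  "mscale c f = Abs_mfps (\<lambda>m. c * mcoeff f m)"


section \<open>Partitions, Young diagrams and hook lengths\<close>

definition partitions :: "nat \<Rightarrow> nat list set" where
  "partitions n = {la. sorted_wrt (\<ge>) la \<and> 0 \<notin> set la \<and> sum_list la = n}"

lemma finite_partitions: "finite (partitions n)"
proof (rule finite_subset)
  have "length xs \<le> sum_list xs" if "0 \<notin> set xs" for xs :: "nat list"
    using that by (induction xs) auto
  then show "partitions n \<subseteq> {xs. set xs \<subseteq> {..n} \<and> length xs \<le> n}"
    by (auto simp: partitions_def intro: member_le_sum_list)
qed (simp add: finite_lists_length_le)

text \<open>Rows and columns are numbered from 0.\<close>

definition young_diagram :: "nat list \<Rightarrow> (nat \<times> nat) set" where
  "young_diagram la = {(i, j). i < length la \<and> j < la ! i}"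

lemma finite_young_diagram: "finite (young_diagram la)"
proof -
  have "young_diagram la = (SIGMA i:{..<length la}. {..<la ! i})"
    by (auto simp: young_diagram_def)
  then show ?thesis by simp
qed

text \<open>The hook of a cell consists of the cell and of the cells to its right and below it.\<close>

definition hook_length :: "nat list \<Rightarrow> nat \<times> nat \<Rightarrow> nat" where
  "hook_length la = (\<lambda>(i, j). card {(i', j') \<in> young_diagram la.
     (i' = i \<and> j \<le> j') \<or> (j' = j \<and> i \<le> i')})"

definition hook_product :: "nat list \<Rightarrow> nat" where
  "hook_product la = (\<Prod>c\<in>young_diagram la. hook_length la c)"


section \<open>Power sum and Schur symmetric functions\<close>

text \<open>\<open>p\<^sub>k\<close> is the sum of all \<open>x\<^sub>i\<^sup>k\<close>; it is only meaningful for \<open>k \<ge> 1\<close>.\<close>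

definition power_sum :: "nat \<Rightarrow> rat mfps" where
  "power_sum k = Abs_mfps (\<lambda>m. if \<exists>i. m = replicate_mset k i then 1 else 0)"

definition power_sum_sym :: "nat list \<Rightarrow> rat mfps" where
  "power_sum_sym la = prod_list (map power_sum la)"

text \<open>
  Semistandard tableaux are functions on the cells, restricted to be \<open>undefined\<close> off the
  diagram so that each tableau is represented exactly once. Entries are variable
  indices, and hence start at 0.
\<close>

definition ssyt :: "nat list \<Rightarrow> (nat \<times> nat \<Rightarrow> nat) set" where
  "ssyt la = {T \<in> extensional (young_diagram la).
     (\<forall>i j j'. j < j' \<longrightarrow> (i, j') \<in> young_diagram la \<longrightarrow> T (i, j) \<le> T (i, j')) \<and>
     (\<forall>i i' j. i < i' \<longrightarrow> (i', j) \<in> young_diagram la \<longrightarrow>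
        (i, j) \<in> young_diagram la \<longrightarrow> T (i, j) < T (i', j))}"

definition tableau_monomial :: "nat list \<Rightarrow> (nat \<times> nat \<Rightarrow> nat) \<Rightarrow> nat multiset" where
  "tableau_monomial la T = image_mset T (mset_set (young_diagram la))"

lemma finite_ssyt_monomial: "finite {T \<in> ssyt la. tableau_monomial la T = m}"
proof (rule finite_subset)
  show "{T \<in> ssyt la. tableau_monomial la T = m} \<subseteq> (\<Pi>\<^sub>E c\<in>young_diagram la. set_mset m)"
    by (auto simp: ssyt_def tableau_monomial_def PiE_def finite_young_diagram)
qed (simp add: finite_PiE finite_young_diagram)

definition schur :: "nat list \<Rightarrow> rat mfps" where
  "schur la = Abs_mfps (\<lambda>m. of_nat (card {T \<in> ssyt la. tableau_monomial la T = m}))"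


section \<open>Permutations\<close>

definition perms :: "nat \<Rightarrow> (nat \<Rightarrow> nat) set" where
  "perms n = {w. w permutes {1..n}}"

definition tuples :: "nat \<Rightarrow> 'b set \<Rightarrow> 'b list set" where
  "tuples k A = {xs. length xs = k \<and> set xs \<subseteq> A}"

lemma finite_perms: "finite (perms n)"
  by (simp add: perms_def finite_permutations)

lemma finite_tuples: "finite A \<Longrightarrow> finite (tuples k A)"
  using finite_lists_length_eq [of A k] by (simp add: tuples_def conj_commute)

text \<open>Fixed points are orbits of size 1 and contribute parts equal to 1.\<close>

definition cycle_type :: "nat \<Rightarrow> (nat \<Rightarrow> nat) \<Rightarrow> nat list" where
  "cycle_type n w = rev (sorted_list_of_multiset
     (image_mset card (mset_set (orbit w ` {1..n}))))"

lemma cycle_type_in_partitions: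
  assumes "w \<in> perms n"
  shows "cycle_type n w \<in> partitions n"
proof -
  have w: "w permutes {1..n}" using assms by (simp add: perms_def)
  then have perm: "permutation w" by (auto simp: permutation_permutes)
  have self: "x \<in> orbit w x" for x
    using perm by (rule permutation_self_in_orbit)
  have sub: "orbit w x \<subseteq> {1..n}" if "x \<in> {1..n}" for x
    using permutes_orbit_subset [OF w that] .
  let ?O = "orbit w ` {1..n}"
  have un: "\<Union>?O = {1..n}" using self sub by blast
  have fin: "finite A" if "A \<in> ?O" for A
    using that sub finite_subset [OF _ finite_atLeastAtMost] by blast
  have disj: "A \<inter> B = {}" if "A \<in> ?O" "B \<in> ?O" "A \<noteq> B" for A B
  proof (rule ccontr)
    assume "A \<inter> B \<noteq> {}"
    then obtain z where z: "z \<in> A" "z \<in> B" by blast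
    from that obtain x y where xy: "A = orbit w x" "B = orbit w y" by blast
    have "orbit w z = orbit w x" "orbit w z = orbit w y"
      using z xy self by (metis orbit_swap orbit_trans subsetI subset_antisym)+
    then show False using xy that by simp
  qed
  have "sum card ?O = card (\<Union>?O)"
    by (rule card_Union_disjoint [symmetric])
      (use fin disj in \<open>auto simp: pairwise_def disjnt_def\<close>)
  then have sum: "sum card ?O = n" using un by simp
  have "sum_list (cycle_type n w) = sum_mset (image_mset card (mset_set ?O))"
    by (simp add: cycle_type_def flip: sum_mset_sum_list)
  also have "\<dots> = n" using sum by (simp add: sum_unfold_sum_mset)
  finally have 1: "sum_list (cycle_type n w) = n" .
  have "sorted (sorted_list_of_multiset M)" for M :: "nat multiset"
    by (rule sorted_sorted_list_of_multiset)
  then have 2: "sorted_wrt (\<ge>) (cycle_type n w)"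
    by (simp add: cycle_type_def sorted_wrt_rev)
  have 3: "0 \<notin> set (cycle_type n w)"
    using fin self by (fastforce simp: cycle_type_def)
  from 1 2 3 show ?thesis by (simp add: partitions_def)
qed

definition commutator :: "(nat \<Rightarrow> nat) \<Rightarrow> (nat \<Rightarrow> nat) \<Rightarrow> nat \<Rightarrow> nat" where
  "commutator u v = u \<circ> v \<circ> inv u \<circ> inv v"

definition perm_prod :: "(nat \<Rightarrow> nat) list \<Rightarrow> nat \<Rightarrow> nat" where
  "perm_prod ws = foldr (\<circ>) ws id"

end

theory Submission
  imports Defs
begin

text \<open>
  Everything rests on one bijection between horizontal strips. It yields the RSK identity
  \<open>\<Sum>\<^sub>\<nu> K\<^sub>\<nu>\<^sub>\<lambda> K\<^sub>\<nu>\<^sub>\<mu> = #{matrices with margins \<lambda>, \<mu>}\<close>, whose right-hand side is also the inner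
  product of the permutation characters of the Young subgroups; so the class functions
  defined by inverting Young's rule are orthonormal and have the Schur functions as
  Frobenius images. They span all class functions, as there are no more cycle types than
  partitions, and their convolution products are \<open>\<chi>\<^sup>\<lambda> * \<chi>\<^sup>\<mu> = \<delta> H\<^sub>\<lambda> \<chi>\<^sup>\<lambda>\<close>: by a sign-reversing
  involution the permutation characters annihilate the signed ones unless the shapes are
  comparable in dominance order, and the hook length formula gives the constant. No
  representation is ever constructed. It remains to expand the numbers of square roots and
  of commutator pairs of a permutation as \<open>\<Sum> \<chi>\<^sup>\<lambda>\<close> and \<open>\<Sum> H\<^sub>\<lambda> \<chi>\<^sup>\<lambda>\<close>.
\<close>

section \<open>Shapes and horizontal strips\<close>

text \<open>With no modules at hand, Schur's lemma needs a substitute. It is a triangularity in two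
  opposite directions: the permutation character of \<open>f\<close> involves only characters of
  shapes above \<open>f\<close> in dominance order, the signed one of \<open>g\<close> only those of
  shapes below \<open>g\<close>, and the diagonal coefficients do not vanish. This forces distinct
  characters to convolve to 0; associativity then makes each \<open>chi\<close> an idempotent up to
  a scalar, which the value at the identity determines.

  The local bijection has a second use: its case of one added and one removed cell shows that the
  numbers of standard tableaux sum up to the number of involutions, which settles the
  Frobenius-Schur signs.

  The passage to symmetric functions is a comparison of coefficients at arbitrary monomials: a
  monomial of the power sum product of \<open>w\<close> colours the cycles of \<open>w\<close>, so
  its coefficient is the value of a permutation character. The exponents of the hook products count
  convolutions: \<open>k\<close> factors need \<open>k - 1\<close> of them, and each commutator
  contributes one further factor by itself.\<close>

lemma card_eq_by_inverse:
  assumes "\<And>x. x \<in> A \<Longrightarrow> f x \<in> B \<and> g (f x) = x" "\<And>y. y \<in> B \<Longrightarrow> g y \<in> A \<and> f (g y) = y"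
  shows "card A = card B"
  by (rule bij_betw_same_card, rule bij_betw_byWitness [where f = f and f' = g]) (use assms in auto)

lemma initial_segment:
  fixes P :: "nat \<Rightarrow> bool"
  assumes "\<And>i j. P j \<Longrightarrow> i < j \<Longrightarrow> P i" "\<not> P n"
  shows "P j \<longleftrightarrow> j < card {j. P j}"
proof -
  define k where "k = (LEAST j. \<not> P j)"
  have k: "\<not> P k" unfolding k_def by (rule LeastI [of _ n]) (rule assms)
  have less: "P j \<longleftrightarrow> j < k" for j
  proof
    assume P: "P j"
    then have "\<not> k < j" "k \<noteq> j" using assms(1) [OF P, of k] k by auto
    then show "j < k" by simp
  next
    assume "j < k"
    then show "P j" unfolding k_def using not_less_Least by blast
  qed
  show ?thesis unfolding less by simp
qed

definition diagram :: "(nat \<Rightarrow> nat) \<Rightarrow> (nat \<times> nat) set" where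
  "diagram f = {(i, j). j < f i}"

text \<open>Partitions padded with zeros: rows \<open>i\<close> and \<open>i + 1\<close> of two
  shapes can be compared without bounds on their numbers of rows. A partition of \<open>n\<close>
  has at most \<open>n\<close> rows, so \<open>n\<close> also bounds the support.\<close>

definition shapes :: "nat \<Rightarrow> (nat \<Rightarrow> nat) set" where
  "shapes n = {f. antimono f \<and> (\<forall>i\<ge>n. f i = 0) \<and> (\<Sum>i<n. f i) = n}"

text \<open>Interlacing of rows: no two cells of \<open>g\<close> outside \<open>f\<close> share a
  column. The sizes are left open, so a strip may be empty; the condition alone makes both functions
  weakly decreasing.\<close>

definition hstrip :: "(nat \<Rightarrow> nat) \<Rightarrow> (nat \<Rightarrow> nat) \<Rightarrow> bool" where
  "hstrip f g \<longleftrightarrow> (\<forall>i. f i \<le> g i \<and> g (Suc i) \<le> f i)"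

lemma sum_support_nat:
  fixes f :: "nat \<Rightarrow> nat"
  assumes "\<And>i. i \<ge> n \<Longrightarrow> f i = 0" "n \<le> N"
  shows "(\<Sum>i<N. f i) = (\<Sum>i<n. f i)"
  by (rule sum.mono_neutral_right) (use assms in auto)

lemma shapesD:
  assumes "f \<in> shapes n"
  shows "antimono f" "i \<ge> n \<Longrightarrow> f i = 0" "N \<ge> n \<Longrightarrow> (\<Sum>i<N. f i) = n"
  using assms sum_support_nat [of n f N] by (auto simp: shapes_def)

text \<open>Any bound on the number of rows suffices: a nonzero row \<open>i\<close> has
  \<open>i\<close> further nonzero rows above it, so \<open>i < n\<close>.\<close>

lemma shapesI:
  assumes "antimono f" "\<And>i. i \<ge> N \<Longrightarrow> f i = 0" "(\<Sum>i<N. f i) = n"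
  shows "f \<in> shapes n"
proof -
  have z: "f i = 0" if "i \<ge> n" for i
  proof (rule ccontr)
    assume i: "f i \<noteq> 0"
    then have "i < N" using assms(2) not_less by blast
    have "f k \<ge> 1" if "k \<le> i" for k
      using antimonoD [OF assms(1) that] i by linarith
    then have "(\<Sum>k\<le>i. 1) \<le> (\<Sum>k\<le>i. f k)" by (intro sum_mono) auto
    also have "\<dots> \<le> (\<Sum>k<N. f k)" using \<open>i < N\<close> by (intro sum_mono2) auto
    finally show False using assms(3) \<open>i \<ge> n\<close> by simp
  qed
  have "(\<Sum>i<n. f i) = n"
  proof (cases "n \<le> N")
    case True
    then show ?thesis using sum_support_nat [of n f N] z assms(3) by simp
  next
    case False
    then show ?thesis using sum_support_nat [of N f n] assms(2,3) by simp
  qed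
  then show ?thesis using assms(1) z by (simp add: shapes_def)
qed

lemma hstrip_antimono:
  assumes "hstrip f g"
  shows "antimono f" "antimono g"
  using assms by (auto simp: hstrip_def antimono_iff_le_Suc intro: le_trans)

lemma diagram_eq_Sigma: "f \<in> shapes n \<Longrightarrow> N \<ge> n \<Longrightarrow> diagram f = (SIGMA i:{..<N}. {..<f i})"
  using shapesD(2) [of f n] by (fastforce simp: diagram_def not_le [symmetric])

lemma finite_diagram: "f \<in> shapes n \<Longrightarrow> finite (diagram f)"
  by (simp add: diagram_eq_Sigma [OF _ order.refl])

lemma card_diagram: "f \<in> shapes n \<Longrightarrow> card (diagram f) = n"
  using shapesD(3) [of f n n] by (simp add: diagram_eq_Sigma [OF _ order.refl])

lemma diagram_inject: "diagram f = diagram g \<longleftrightarrow> f = g"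
proof
  assume "diagram f = diagram g"
  then have "j < f i \<longleftrightarrow> j < g i" for i j by (auto simp: diagram_def set_eq_iff)
  then show "f = g" by (metis ext linorder_neqE_nat less_irrefl)
qed simp

lemma shapes_le:
  assumes "f \<in> shapes n"
  shows "f i \<le> n"
proof (cases "i < n")
  case True
  then have "f i \<le> (\<Sum>i<n. f i)" by (intro member_le_sum) auto
  then show ?thesis using shapesD(3) [OF assms order.refl] by simp
qed (use shapesD(2) [OF assms] in auto)

lemma finite_shapes: "finite (shapes n)"
proof (rule finite_subset)
  show "shapes n \<subseteq> (\<lambda>g i. if i < n then g i else 0) ` ({..<n} \<rightarrow>\<^sub>E {..n})"
  proof
    fix f assume f: "f \<in> shapes n"
    have "f = (\<lambda>g i. if i < n then g i else 0) (restrict f {..<n})"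
      using shapesD(2) [OF f] by auto
    moreover have "restrict f {..<n} \<in> {..<n} \<rightarrow>\<^sub>E {..n}"
      using shapes_le [OF f] by auto
    ultimately show "f \<in> (\<lambda>g i. if i < n then g i else 0) ` ({..<n} \<rightarrow>\<^sub>E {..n})" by blast
  qed
qed (simp add: finite_PiE)

lemma shapes_0: "shapes 0 = {\<lambda>_. 0}"
  by (auto simp: shapes_def antimono_def)

lemma hstrip_same_size:
  assumes "f \<in> shapes n" "g \<in> shapes n"
  shows "hstrip f g \<longleftrightarrow> f = g"
proof
  assume h: "hstrip f g"
  then have "diagram f \<subseteq> diagram g" by (auto simp: diagram_def hstrip_def intro: less_le_trans)
  then have "diagram f = diagram g"
    using assms by (metis card_diagram card_subset_eq finite_diagram)
  then show "f = g" by (simp add: diagram_inject)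
next
  assume "f = g"
  then show "hstrip f g"
    using shapesD(1) [OF assms(1)] by (auto simp: hstrip_def antimono_iff_le_Suc)
qed

text \<open>
  Given \<open>f\<close> and \<open>g\<close>, row \<open>i + 1\<close> of a common upper shape and row \<open>i\<close> of a common lower
  shape range over the same interval, with ends \<open>max (f (i+1)) (g (i+1))\<close> and
  \<open>min (f i) (g i)\<close>. Reflecting this interval turns upper shapes into lower ones; row 0
  of the upper shape has no counterpart and its excess is the summation index.
\<close>

lemma hstrip_local_rule:
  assumes f: "f \<in> shapes p" and g: "g \<in> shapes q" and pq: "p + a = q + b"
  shows "card {h \<in> shapes (p + a). hstrip f h \<and> hstrip g h} =
    (\<Sum>j\<in>{j. j \<le> a \<and> j \<le> q \<and> a \<le> b + j}. card {k \<in> shapes (q - j). hstrip k f \<and> hstrip k g})"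
proof -
  define M where "M i = max (f i) (g i)" for i
  define L where "L i = min (f i) (g i)" for i
  define r where "r = p + a"
  \<comment> \<open>\<open>j\<close> is \<open>a\<close> minus the excess of row 0 of the upper
    shape over \<open>M 0\<close>. The excess lies between 0 and \<open>min a b\<close>, and the
    lower shape has \<open>q - j\<close> cells.\<close>
  define J where "J = {j. j \<le> a \<and> j \<le> q \<and> a \<le> b + j}"
  define N where "N = p + q + r"
  have f0: "f i = 0" "g i = 0" if "i \<ge> N" for i
    using shapesD(2) f g that by (auto simp: N_def)
  have msum: "M i + L i = f i + g i" for i by (simp add: M_def L_def)
  have sumfg: "(\<Sum>i<N. M i) + (\<Sum>i<N. L i) = p + q"
    using shapesD(3) [OF f, of N] shapesD(3) [OF g, of N]
    unfolding sum.distrib [symmetric] msum by (simp add: N_def sum.distrib)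
  have shift: "(\<Sum>i<N. x i) + x N = x 0 + (\<Sum>i<N. x (Suc i))" for x :: "nat \<Rightarrow> nat"
    by (metis sum.lessThan_Suc sum.lessThan_Suc_shift)
  have hi: "hstrip f h \<and> hstrip g h \<longleftrightarrow> M 0 \<le> h 0 \<and> (\<forall>i. M (Suc i) \<le> h (Suc i) \<and> h (Suc i) \<le> L i)" for h
    unfolding hstrip_def M_def L_def by (metis max.bounded_iff min.bounded_iff not0_implies_Suc)
  have lo: "hstrip k f \<and> hstrip k g \<longleftrightarrow> (\<forall>i. M (Suc i) \<le> k i \<and> k i \<le> L i)" for k
    unfolding hstrip_def M_def L_def by auto
  define A where "A = {h \<in> shapes r. hstrip f h \<and> hstrip g h}"
  define B where "B = (SIGMA j:J. {k \<in> shapes (q - j). hstrip k f \<and> hstrip k g})"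
  define \<phi> where "\<phi> h = (\<lambda>i. M (Suc i) + L i - h (Suc i))" for h
  define \<psi> where "\<psi> jk = (\<lambda>i. case i of 0 \<Rightarrow> M 0 + (a - fst jk) | Suc i \<Rightarrow> M (Suc i) + L i - snd jk i)"
    for jk :: "nat \<times> (nat \<Rightarrow> nat)"
  have cond: "M (Suc i) \<le> M (Suc i) + L i - x" "M (Suc i) + L i - x \<le> L i"
    "M (Suc i) + L i - (M (Suc i) + L i - x) = x"
    if "M (Suc i) \<le> x" "x \<le> L i" for i x
    using that by auto
  have MN: "M N = 0" "L N = 0" "M (Suc N) = 0" using f0 by (auto simp: M_def L_def)
  have sumM: "(\<Sum>i<N. M (Suc i)) + M 0 = (\<Sum>i<N. M i)" using shift [of M] MN by simp
  have *: "(h 0 - M 0) \<le> a \<and> (h 0 - M 0) \<le> b \<and> a \<le> q + (h 0 - M 0) \<and>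
      \<phi> h \<in> shapes (q - (a - (h 0 - M 0)))"
    if "h \<in> A" for h
  proof -
    have h: "h \<in> shapes r" "hstrip f h" "hstrip g h" using that by (auto simp: A_def)
    have u: "M 0 \<le> h 0" "\<And>i. M (Suc i) \<le> h (Suc i)" "\<And>i. h (Suc i) \<le> L i"
      using h hi by auto
    have "hstrip (\<phi> h) f" using cond u lo [of "\<phi> h"] by (simp add: \<phi>_def)
    then have am: "antimono (\<phi> h)" by (rule hstrip_antimono)
    have hN: "(\<Sum>i<N. h i) = r" "h N = 0"
      using shapesD [OF h(1)] by (auto simp: N_def)
    have "(\<Sum>i<N. \<phi> h i) + (\<Sum>i<N. h (Suc i)) = (\<Sum>i<N. M (Suc i) + L i)"
      unfolding \<phi>_def sum.distrib [symmetric] using u by (intro sum.cong) (auto intro: le_add_diff_inverse2 trans_le_add2)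
    then have s: "(\<Sum>i<N. \<phi> h i) + r + M 0 = p + q + h 0"
      using sumfg sumM shift [of h] hN by (simp add: sum.distrib)
    have z: "\<phi> h i = 0" if "i \<ge> N" for i using f0 that by (simp add: \<phi>_def M_def L_def)
    \<comment> \<open>Row 0 cannot gain more cells than the whole strip has, which is
      \<open>a\<close> over \<open>f\<close> and \<open>b\<close> over \<open>g\<close>; hence the
      excess over \<open>M 0\<close> is at most either number.\<close>
    have "h 0 \<le> f 0 + a" "h 0 \<le> g 0 + b"
    proof -
      have "(\<Sum>i<N. f (Suc i)) \<le> (\<Sum>i<N. h (Suc i))" "(\<Sum>i<N. g (Suc i)) \<le> (\<Sum>i<N. h (Suc i))"
        using h by (auto simp: hstrip_def intro!: sum_mono)
      then show "h 0 \<le> f 0 + a" "h 0 \<le> g 0 + b"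
        using shift [of f] shift [of g] shift [of h] hN f0 [of N] shapesD(3) [OF f, of N]
          shapesD(3) [OF g, of N] pq r_def by (auto simp: N_def)
    qed
    then have ab: "h 0 - M 0 \<le> a" "h 0 - M 0 \<le> b" by (auto simp: M_def)
    have "(\<Sum>i<N. \<phi> h i) = q - (a - (h 0 - M 0))" "a \<le> q + (h 0 - M 0)"
      using s u ab unfolding r_def by linarith+
    then show ?thesis using ab am z shapesI by blast
  qed
  have **: "\<psi> (j, k) \<in> A" if "(j, k) \<in> B" for j k
  proof -
    have k: "k \<in> shapes (q - j)" "hstrip k f" "hstrip k g" and j: "j \<in> J" using that by (auto simp: B_def)
    have d: "M (Suc i) \<le> k i" "k i \<le> L i" for i using lo k by auto
    have "hstrip f (\<psi> (j, k)) \<and> hstrip g (\<psi> (j, k))"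
      unfolding hi using d cond by (auto simp: \<psi>_def)
    moreover have "\<psi> (j, k) \<in> shapes r"
    proof (rule shapesI [where N = "Suc N"])
      show "antimono (\<psi> (j, k))" using calculation hstrip_antimono(2) by blast
      show "\<psi> (j, k) i = 0" if "Suc N \<le> i" for i
        using that f0 by (cases i) (auto simp: \<psi>_def M_def L_def)
      have "(\<Sum>i<N. \<psi> (j, k) (Suc i)) + (\<Sum>i<N. k i) = (\<Sum>i<N. M (Suc i) + L i)"
        unfolding \<psi>_def sum.distrib [symmetric] using d
        by (intro sum.cong) (auto intro: le_add_diff_inverse2 trans_le_add2)
      moreover have "(\<Sum>i<N. k i) = q - j" using shapesD(3) [OF k(1), of N] by (simp add: N_def)
      moreover have "\<psi> (j, k) 0 = M 0 + (a - j)" by (simp add: \<psi>_def)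
      ultimately show "(\<Sum>i<Suc N. \<psi> (j, k) i) = r"
        using sumfg sumM j unfolding sum.lessThan_Suc_shift by (auto simp: J_def r_def sum.distrib)
    qed
    ultimately show ?thesis by (simp add: A_def)
  qed
  have "card A = card B"
  proof (rule card_eq_by_inverse [where f = "\<lambda>h. (a - (h 0 - M 0), \<phi> h)" and g = \<psi>])
    fix h assume h: "h \<in> A"
    then have u: "M 0 \<le> h 0" "\<And>i. M (Suc i) \<le> h (Suc i)" "\<And>i. h (Suc i) \<le> L i"
      using hi by (auto simp: A_def)
    have "hstrip (\<phi> h) f \<and> hstrip (\<phi> h) g"
      using cond u unfolding lo by (auto simp: \<phi>_def)
    then have "(a - (h 0 - M 0), \<phi> h) \<in> B" using * [OF h] by (auto simp: B_def J_def)
    moreover have "\<psi> (a - (h 0 - M 0), \<phi> h) = h"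
    proof
      fix i
      show "\<psi> (a - (h 0 - M 0), \<phi> h) i = h i"
        using u cond(3) [OF u(2,3)] * [OF h] by (cases i) (auto simp: \<psi>_def \<phi>_def)
    qed
    ultimately show "(a - (h 0 - M 0), \<phi> h) \<in> B \<and> \<psi> (a - (h 0 - M 0), \<phi> h) = h" ..
  next
    fix jk assume jk: "jk \<in> B"
    obtain j k where e: "jk = (j, k)" by force
    have d: "M (Suc i) \<le> k i" "k i \<le> L i" for i using lo jk e by (auto simp: B_def)
    have "j \<le> a" using jk e by (auto simp: B_def J_def)
    then show "\<psi> jk \<in> A \<and> (a - (\<psi> jk 0 - M 0), \<phi> (\<psi> jk)) = jk"
      using ** [of j k] jk cond(3) [OF d] by (auto simp: e \<psi>_def \<phi>_def)
  qed
  moreover have "finite J" unfolding J_def by (rule finite_subset [of _ "{..a}"]) auto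
  ultimately show ?thesis
    by (simp add: A_def B_def r_def J_def finite_shapes)
qed

section \<open>Kostka numbers\<close>

definition tableaux :: "(nat \<Rightarrow> nat) \<Rightarrow> nat multiset \<Rightarrow> (nat \<times> nat \<Rightarrow> nat) set" where
  "tableaux f m = {T \<in> extensional (diagram f).
     (\<forall>i j j'. j < j' \<longrightarrow> (i, j') \<in> diagram f \<longrightarrow> T (i, j) \<le> T (i, j')) \<and>
     (\<forall>i i' j. i < i' \<longrightarrow> (i', j) \<in> diagram f \<longrightarrow> (i, j) \<in> diagram f \<longrightarrow> T (i, j) < T (i', j)) \<and>
     image_mset T (mset_set (diagram f)) = m}"

text \<open>\<open>m\<close> is an arbitrary multiset of letters, so this is the coefficient of the
  monomial \<open>m\<close> in the Schur function (\<open>mcoeff_schur\<close>), with no ordering of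
  the exponents.\<close>

definition kostka :: "(nat \<Rightarrow> nat) \<Rightarrow> nat multiset \<Rightarrow> nat" where
  "kostka f m = card (tableaux f m)"

lemma finite_tableaux:
  assumes "f \<in> shapes n"
  shows "finite (tableaux f m)"
proof (rule finite_subset)
  show "tableaux f m \<subseteq> (\<Pi>\<^sub>E c\<in>diagram f. set_mset m)"
    using finite_diagram [OF assms] by (auto simp: tableaux_def PiE_def)
qed (simp add: finite_PiE finite_diagram [OF assms])

lemma tableaux_size:
  assumes "f \<in> shapes n" "T \<in> tableaux f m"
  shows "size m = n"
  using assms card_diagram [OF assms(1)] by (auto simp: tableaux_def)

lemma tableaux_mem:
  assumes "f \<in> shapes n" "T \<in> tableaux f m" "c \<in> diagram f"
  shows "T c \<in># m"
  using assms finite_diagram [OF assms(1)] by (auto simp: tableaux_def)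

text \<open>The cells with the largest entry form a horizontal strip.\<close>

lemma kostka_rec:
  assumes f: "f \<in> shapes (size m + a)" and x: "\<And>y. y \<in># m \<Longrightarrow> y < x"
  shows "kostka f (m + replicate_mset a x) =
    (\<Sum>g | g \<in> shapes (size m) \<and> hstrip g f. kostka g m)"
proof -
  let ?m = "m + replicate_mset a x"
  let ?G = "{g \<in> shapes (size m). hstrip g f}"
  let ?B = "SIGMA g:?G. tableaux g m"
  define sh where "sh T = (\<lambda>i. card {j. j < f i \<and> T (i, j) < x})" for T :: "nat \<times> nat \<Rightarrow> nat"
  define ext where "ext gT = (\<lambda>c. if c \<in> diagram (fst gT) then snd gT c
      else if c \<in> diagram f then x else undefined)" for gT :: "(nat \<Rightarrow> nat) \<times> (nat \<times> nat \<Rightarrow> nat)"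
  note finf = finite_diagram [OF f]
  have filt: "filter_mset (\<lambda>y. y < x) ?m = m"
    unfolding filter_mset_eq_conv using x by auto
  have fwd: "sh T \<in> shapes (size m) \<and> hstrip (sh T) f \<and> diagram (sh T) = {c \<in> diagram f. T c < x}
      \<and> restrict T (diagram (sh T)) \<in> tableaux (sh T) m"
    if T: "T \<in> tableaux f ?m" for T
  proof -
    have row: "j < j' \<Longrightarrow> (i, j') \<in> diagram f \<Longrightarrow> T (i, j) \<le> T (i, j')" for i j j'
      using T by (simp add: tableaux_def)
    have col: "i < i' \<Longrightarrow> (i', j) \<in> diagram f \<Longrightarrow> (i, j) \<in> diagram f \<Longrightarrow> T (i, j) < T (i', j)" for i i' j
      using T by (simp add: tableaux_def)
    have Tx: "T c \<le> x" if "c \<in> diagram f" for c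
      using tableaux_mem [OF f T that] x [of "T c"] by (cases "T c \<in># m") (auto split: if_splits)
    have init: "j < f i \<and> T (i, j) < x \<longleftrightarrow> j < sh T i" for i j
      unfolding sh_def
    proof (rule initial_segment [where n = "f i"])
      fix j j' assume "j' < f i \<and> T (i, j') < x" "j < j'"
      then show "j < f i \<and> T (i, j) < x" using row [of j j' i] by (auto simp: diagram_def)
    qed simp
    have D: "diagram (sh T) = {c \<in> diagram f. T c < x}"
      using init by (auto simp: diagram_def)
    have le: "sh T i \<le> f i" for i
      using init [of "f i" i] by simp
    \<comment> \<open>A cell with another cell of \<open>f\<close> below it has an entry smaller
      than some entry \<le> \<open>x\<close>, so it already belongs to the inner shape.\<close>
    have ge: "f (Suc i) \<le> sh T i" for i
    proof -
      have "j < sh T i" if j: "j < f (Suc i)" for j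
      proof -
        have ji: "j < f i"
          using j antimonoD [OF shapesD(1) [OF f], of i "Suc i"] by linarith
        have "T (i, j) < T (Suc i, j)" using col [of i "Suc i" j] j ji by (simp add: diagram_def)
        also have "\<dots> \<le> x" using Tx j by (simp add: diagram_def)
        finally show ?thesis using init ji by blast
      qed
      then show ?thesis using not_le by blast
    qed
    have hs: "hstrip (sh T) f" using le ge by (simp add: hstrip_def)
    have cont: "image_mset T (mset_set {c \<in> diagram f. T c < x}) = m"
    proof -
      have "image_mset T (filter_mset (\<lambda>c. T c < x) (mset_set (diagram f))) =
          filter_mset (\<lambda>y. y < x) (image_mset T (mset_set (diagram f)))"
        by (simp add: filter_mset_image_mset)
      also have "\<dots> = m" using T filt by (simp add: tableaux_def)
      finally show ?thesis using finf by (simp add: filter_mset_mset_set)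
    qed
    have sz: "card (diagram (sh T)) = size m"
      using arg_cong [OF cont, of size] D by simp
    have S: "sh T \<in> shapes (size m)"
    proof (rule shapesI [where N = "size m + a"])
      show "antimono (sh T)" using hs by (rule hstrip_antimono)
      show z: "sh T i = 0" if "i \<ge> size m + a" for i using le [of i] shapesD(2) [OF f that] by simp
      have "diagram (sh T) = (SIGMA i:{..<size m + a}. {..<sh T i})"
        using z by (force simp: diagram_def not_le [symmetric])
      then show "(\<Sum>i<size m + a. sh T i) = size m" using sz by simp
    qed
    moreover have "restrict T (diagram (sh T)) \<in> tableaux (sh T) m"
    proof -
      have sub: "diagram (sh T) \<subseteq> diagram f" using D by auto
      have left: "(i, j) \<in> diagram (sh T)" if "(i, j') \<in> diagram (sh T)" "j < j'" for i j j'
        using that by (auto simp: diagram_def)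
      have "image_mset (restrict T (diagram (sh T))) (mset_set (diagram (sh T))) =
          image_mset T (mset_set (diagram (sh T)))"
        by (rule image_mset_cong) (use finite_diagram [OF S] in simp)
      also have "\<dots> = m" using cont D by simp
      finally show ?thesis
        using row col sub left by (auto simp: tableaux_def subset_iff)
    qed
    ultimately show ?thesis using hs D by blast
  qed
  have bwd: "ext (g, T) \<in> tableaux f ?m \<and> sh (ext (g, T)) = g \<and> restrict (ext (g, T)) (diagram g) = T"
    if g: "g \<in> shapes (size m)" "hstrip g f" and T: "T \<in> tableaux g m" for g T
  proof -
    let ?T = "ext (g, T)"
    have row: "j < j' \<Longrightarrow> (i, j') \<in> diagram g \<Longrightarrow> T (i, j) \<le> T (i, j')" for i j j'
      using T by (simp add: tableaux_def)
    have col: "i < i' \<Longrightarrow> (i', j) \<in> diagram g \<Longrightarrow> (i, j) \<in> diagram g \<Longrightarrow> T (i, j) < T (i', j)" for i i' j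
      using T by (simp add: tableaux_def)
    have Tx: "T c < x" if "c \<in> diagram g" for c using tableaux_mem [OF g(1) T that] x by blast
    have sub: "diagram g \<subseteq> diagram f"
      using g(2) by (auto simp: diagram_def hstrip_def intro: less_le_trans)
    have left: "(i, j) \<in> diagram g" if "(i, j') \<in> diagram g" "j < j'" for i j j'
      using that by (auto simp: diagram_def)
    have left': "(i, j) \<in> diagram f" if "(i, j') \<in> diagram f" "j < j'" for i j j'
      using that by (auto simp: diagram_def)
    have above: "(i, j) \<in> diagram g" if "(i', j) \<in> diagram f" "i < i'" for i i' j
    proof -
      have "f i' \<le> f (Suc i)" using antimonoD [OF shapesD(1) [OF f]] that(2) by simp
      also have "\<dots> \<le> g i" using g(2) by (simp add: hstrip_def)
      finally show ?thesis using that(1) by (simp add: diagram_def)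
    qed
    have "image_mset ?T (mset_set (diagram f)) = ?m"
    proof -
      have fg: "finite (diagram g)" using finite_diagram [OF g(1)] .
      have "mset_set (diagram f) = mset_set (diagram g) + mset_set (diagram f - diagram g)"
        using sub fg finf by (metis Diff_disjoint Un_Diff_cancel finite_Diff mset_set_Union subset_Un_eq)
      moreover have "image_mset ?T (mset_set (diagram g)) = image_mset T (mset_set (diagram g))"
        by (rule image_mset_cong) (use fg in \<open>simp add: ext_def\<close>)
      moreover have "image_mset ?T (mset_set (diagram f - diagram g)) =
          image_mset (\<lambda>_. x) (mset_set (diagram f - diagram g))"
        by (rule image_mset_cong) (use finf in \<open>auto simp: ext_def\<close>)
      moreover have "card (diagram f - diagram g) = a"
        using card_diagram [OF f] card_diagram [OF g(1)] card_Diff_subset [OF fg sub] by simp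
      ultimately show ?thesis using T by (simp add: tableaux_def image_mset_const_eq)
    qed
    moreover have "?T (i, j) \<le> ?T (i, j')" if "j < j'" "(i, j') \<in> diagram f" for i j j'
      using that left [of i j' j] left' [of i j' j] row [of j j' i] Tx [of "(i, j)"] by (auto simp: ext_def)
    moreover have "?T (i, j) < ?T (i', j)" if "i < i'" "(i', j) \<in> diagram f" for i i' j
      using that above [of i' j i] col [of i i' j] Tx [of "(i, j)"] by (auto simp: ext_def)
    ultimately have 1: "?T \<in> tableaux f ?m"
      using sub by (auto simp: tableaux_def ext_def extensional_def)
    have "diagram (sh ?T) = diagram g"
      using fwd [OF 1] Tx sub by (auto simp: ext_def split: if_splits)
    then have 2: "sh ?T = g" by (simp add: diagram_inject)
    have "restrict ?T (diagram g) = T"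
      using T by (auto simp: ext_def tableaux_def extensional_def restrict_def fun_eq_iff)
    then show ?thesis using 1 2 by blast
  qed
  have "card (tableaux f ?m) = card ?B"
  proof (rule card_eq_by_inverse [where f = "\<lambda>T. (sh T, restrict T (diagram (sh T)))" and g = ext])
    fix T assume T: "T \<in> tableaux f ?m"
    have "T c = x" if "c \<in> diagram f" "\<not> T c < x" for c
      using tableaux_mem [OF f T that(1)] x [of "T c"] that(2) by (auto split: if_splits)
    moreover have "T c = undefined" if "c \<notin> diagram f" for c
      using T that extensional_arb [of T "diagram f" c] by (simp add: tableaux_def)
    ultimately have "ext (sh T, restrict T (diagram (sh T))) = T"
      using fwd [OF T] by (auto simp: ext_def fun_eq_iff)
    then show "(sh T, restrict T (diagram (sh T))) \<in> ?B \<and> ext (sh T, restrict T (diagram (sh T))) = T"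
      using fwd [OF T] by blast
  next
    fix gT assume "gT \<in> ?B"
    then show "ext gT \<in> tableaux f ?m \<and> (sh (ext gT), restrict (ext gT) (diagram (sh (ext gT)))) = gT"
      using bwd by auto
  qed
  also have "\<dots> = (\<Sum>g\<in>?G. card (tableaux g m))"
    by (rule card_SigmaI) (auto simp: finite_shapes finite_tableaux)
  finally show ?thesis by (simp add: kostka_def)
qed

section \<open>Pieri's rule by induction on the largest letter\<close>

lemma kostka_empty [simp]: "kostka (\<lambda>_. 0) {#} = 1"
proof -
  have "tableaux (\<lambda>_. 0) {#} = {\<lambda>_. undefined}"
    by (auto simp: tableaux_def diagram_def)
  then show ?thesis by (simp add: kostka_def)
qed

text \<open>The largest letter is removed with its full multiplicity, as \<open>kostka_rec\<close>
  demands.\<close>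

lemma multiset_max_induct [case_names empty add]:
  fixes m :: "nat multiset"
  assumes "P {#}"
    and "\<And>m a x. (\<And>y. y \<in># m \<Longrightarrow> y < x) \<Longrightarrow> P m \<Longrightarrow> P (m + replicate_mset a x)"
  shows "P m"
proof (induction m rule: measure_induct_rule [of size])
  case (less m)
  show ?case
  proof (cases "m = {#}")
    case False
    define x where "x = Max (set_mset m)"
    have x: "x \<in># m" "\<And>y. y \<in># m \<Longrightarrow> y \<le> x" using False by (auto simp: x_def)
    let ?m = "filter_mset (\<lambda>y. y \<noteq> x) m"
    have m: "m = ?m + replicate_mset (count m x) x"
      by (rule multiset_eqI) auto
    have "count m x > 0" using x(1) by simp
    then have "size ?m < size m" using arg_cong [OF m, of size] by simp
    then have "P ?m" by (rule less.IH)
    moreover have "y < x" if "y \<in># ?m" for y using that x(2) by (auto simp: order_less_le)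
    ultimately show ?thesis using assms(2) m by metis
  qed (use assms(1) in simp)
qed

text \<open>A submultiset of size \<open>a\<close> takes \<open>j\<close> letters from
  \<open>m\<close> and \<open>a - j\<close> copies of \<open>x\<close>, which leaves
  \<open>b + j - a\<close> copies. The range of \<open>j\<close> is the index set of
  \<open>hstrip_local_rule\<close> with \<open>q = size m\<close>; this is what makes the two
  recursions agree.\<close>

lemma sum_submsets_add:
  fixes F :: "'a multiset \<Rightarrow> nat"
  assumes "x \<notin># m"
  shows "(\<Sum>c | c \<subseteq># m + replicate_mset b x \<and> size c = a. F (m + replicate_mset b x - c)) =
    (\<Sum>j | j \<le> a \<and> j \<le> size m \<and> a \<le> b + j. \<Sum>c | c \<subseteq># m \<and> size c = j.
      F (m - c + replicate_mset (b + j - a) x))"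
proof -
  let ?J = "{j. j \<le> a \<and> j \<le> size m \<and> a \<le> b + j}"
  have fin: "finite ?J" by (rule finite_subset [of _ "{..a}"]) auto
  have fin': "finite {c. c \<subseteq># m \<and> size c = j}" for j
    using finite_submultisets [of m] by (rule rev_finite_subset) auto
  have cnt: "count m x = 0" using assms by (simp add: not_in_iff)
  have "(\<Sum>j\<in>?J. \<Sum>c | c \<subseteq># m \<and> size c = j. F (m - c + replicate_mset (b + j - a) x)) =
      (\<Sum>(j, c)\<in>(SIGMA j:?J. {c. c \<subseteq># m \<and> size c = j}). F (m - c + replicate_mset (b + j - a) x))"
    by (rule sum.Sigma) (use fin fin' in auto)
  also have "\<dots> = (\<Sum>c | c \<subseteq># m + replicate_mset b x \<and> size c = a. F (m + replicate_mset b x - c))"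
  proof (rule sum.reindex_bij_witness [where
        i = "\<lambda>c. (size (filter_mset (\<lambda>y. y \<noteq> x) c), filter_mset (\<lambda>y. y \<noteq> x) c)" and
        j = "\<lambda>(j, c). c + replicate_mset (a - j) x"])
    fix jc assume jc: "jc \<in> (SIGMA j:?J. {c. c \<subseteq># m \<and> size c = j})"
    obtain j c where e: "jc = (j, c)" by force
    have c: "c \<subseteq># m" "size c = j" "j \<le> a" "a \<le> b + j" using jc e by auto
    have "count c x = 0" using mset_subset_eq_count [OF c(1), of x] cnt by simp
    then have flt: "filter_mset (\<lambda>y. y \<noteq> x) (c + replicate_mset (a - j) x) = c"
      by (intro multiset_eqI) auto
    show "(\<lambda>c. (size (filter_mset (\<lambda>y. y \<noteq> x) c), filter_mset (\<lambda>y. y \<noteq> x) c))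
        ((\<lambda>(j, c). c + replicate_mset (a - j) x) jc) = jc"
      using flt c by (simp add: e)
    have "c + replicate_mset (a - j) x \<subseteq># m + replicate_mset b x"
      using c by (intro subset_mset.add_mono) (auto simp: subseteq_mset_def)
    then show "(\<lambda>(j, c). c + replicate_mset (a - j) x) jc \<in>
        {c. c \<subseteq># m + replicate_mset b x \<and> size c = a}"
      using c by (simp add: e)
    have "m + replicate_mset b x - (c + replicate_mset (a - j) x) = m - c + replicate_mset (b + j - a) x"
      using c mset_subset_eq_count [OF c(1)] by (intro multiset_eqI) auto
    then show "F (m + replicate_mset b x - (\<lambda>(j, c). c + replicate_mset (a - j) x) jc) =
        (case jc of (j, c) \<Rightarrow> F (m - c + replicate_mset (b + j - a) x))"
      by (simp add: e)
  next
    fix c assume "c \<in> {c. c \<subseteq># m + replicate_mset b x \<and> size c = a}"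
    then have c: "c \<subseteq># m + replicate_mset b x" "size c = a" by auto
    let ?c = "filter_mset (\<lambda>y. y \<noteq> x) c"
    have dec: "c = ?c + replicate_mset (count c x) x" by (rule multiset_eqI) auto
    have sz: "a = size ?c + count c x" using arg_cong [OF dec, of size] c(2) by simp
    have sub: "?c \<subseteq># m"
    proof (rule mset_subset_eqI)
      fix y show "count ?c y \<le> count m y"
        using mset_subset_eq_count [OF c(1), of y] by auto
    qed
    have "count c x \<le> b" using mset_subset_eq_count [OF c(1), of x] cnt by simp
    then show "(\<lambda>c. (size (filter_mset (\<lambda>y. y \<noteq> x) c), filter_mset (\<lambda>y. y \<noteq> x) c)) c
        \<in> (SIGMA j:?J. {c. c \<subseteq># m \<and> size c = j})"
      using sub sz size_mset_mono [OF sub] by auto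
    show "(\<lambda>(j, c). c + replicate_mset (a - j) x)
        ((\<lambda>c. (size (filter_mset (\<lambda>y. y \<noteq> x) c), filter_mset (\<lambda>y. y \<noteq> x) c)) c) = c"
      using sz dec by simp
  qed
  finally show ?thesis by simp
qed

text \<open>The local rule as a commutation relation: adding a strip of \<open>a\<close> cells and
  removing one of \<open>b\<close> cells amounts to removing \<open>b + j - a\<close> cells and
  adding \<open>j\<close>, summed over \<open>j\<close>. In terms of symmetric functions,
  multiplication by a complete homogeneous function is moved past the adjoint of another.\<close>

lemma sum_hstrip_local_rule:
  assumes g: "g \<in> shapes p" and pq: "p + a = q + b"
  shows "(\<Sum>f | f \<in> shapes (p + a) \<and> hstrip g f. \<Sum>k | k \<in> shapes q \<and> hstrip k f. F k) =
    (\<Sum>j | j \<le> a \<and> j \<le> q \<and> a \<le> b + j. \<Sum>h | h \<in> shapes (q - j) \<and> hstrip h g.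
      \<Sum>k | k \<in> shapes q \<and> hstrip h k. F k :: nat)"
proof -
  let ?J = "{j. j \<le> a \<and> j \<le> q \<and> a \<le> b + j}"
  have fin: "finite ?J" by (rule finite_subset [of _ "{..a}"]) auto
  have "(\<Sum>f | f \<in> shapes (p + a) \<and> hstrip g f. \<Sum>k | k \<in> shapes q \<and> hstrip k f. F k) =
      (\<Sum>k\<in>shapes q. \<Sum>f | f \<in> {f. f \<in> shapes (p + a) \<and> hstrip g f} \<and> hstrip k f. F k)"
    by (rule sum.swap_restrict) (simp_all add: finite_shapes)
  also have "\<dots> = (\<Sum>k\<in>shapes q. card {f \<in> shapes (p + a). hstrip g f \<and> hstrip k f} * F k)"
    by (simp add: conj_ac)
  also have "\<dots> = (\<Sum>k\<in>shapes q. \<Sum>j\<in>?J. card {h \<in> shapes (q - j). hstrip h g \<and> hstrip h k} * F k)"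
    by (intro sum.cong refl) (simp only: hstrip_local_rule [OF g _ pq] sum_distrib_right)
  also have "\<dots> = (\<Sum>j\<in>?J. \<Sum>k\<in>shapes q. card {h \<in> shapes (q - j). hstrip h g \<and> hstrip h k} * F k)"
    by (rule sum.swap)
  also have "\<dots> = (\<Sum>j\<in>?J. \<Sum>k\<in>shapes q. \<Sum>h | h \<in> {h. h \<in> shapes (q - j) \<and> hstrip h g} \<and> hstrip h k. F k)"
    by (simp add: conj_ac)
  also have "\<dots> = (\<Sum>j\<in>?J. \<Sum>h | h \<in> shapes (q - j) \<and> hstrip h g. \<Sum>k | k \<in> shapes q \<and> hstrip h k. F k)"
    by (intro sum.cong refl sum.swap_restrict [symmetric]) (simp_all add: finite_shapes)
  finally show ?thesis .
qed

text \<open>Pieri's rule read off at the monomial \<open>m\<close>: the right-hand side is its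
  coefficient in the product of the Schur function of \<open>g\<close> with the complete homogeneous
  function of degree \<open>a\<close>, \<open>c\<close> being the monomial taken from the latter.
  Removing the largest letter of \<open>m\<close> from a tableau of shape \<open>f\<close> replaces
  \<open>f\<close> by some \<open>k\<close>, and the commutation relation reduces the sum to shapes
  inside \<open>g\<close>, where the induction hypothesis applies.\<close>

lemma kostka_up:
  assumes "g \<in> shapes p" "size m = p + a"
  shows "(\<Sum>f | f \<in> shapes (p + a) \<and> hstrip g f. kostka f m) =
    (\<Sum>c | c \<subseteq># m \<and> size c = a. kostka g (m - c))"
  using assms
proof (induction m arbitrary: g p a rule: multiset_max_induct)
  case empty
  have "{f. f = g \<and> hstrip g f} = {g}"
    using empty hstrip_same_size [of g p g] by auto
  moreover have "{c. c \<subseteq># {#} \<and> size c = 0} = {{#} :: nat multiset}" by auto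
  ultimately show ?case using empty by (simp add: shapes_0 cong: conj_cong)
next
  case (add m b x g p a)
  let ?q = "size m"
  let ?J = "{j. j \<le> a \<and> j \<le> ?q \<and> a \<le> b + j}"
  have pq: "p + a = ?q + b" using add.prems by simp
  have x: "x \<notin># m" using add.hyps by blast
  have "(\<Sum>f | f \<in> shapes (p + a) \<and> hstrip g f. kostka f (m + replicate_mset b x)) =
      (\<Sum>f | f \<in> shapes (p + a) \<and> hstrip g f. \<Sum>k | k \<in> shapes ?q \<and> hstrip k f. kostka k m)"
    using add.hyps by (intro sum.cong refl kostka_rec) (auto simp: pq)
  also have "\<dots> = (\<Sum>j\<in>?J. \<Sum>h | h \<in> shapes (?q - j) \<and> hstrip h g. \<Sum>k | k \<in> shapes ?q \<and> hstrip h k. kostka k m)"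
    by (rule sum_hstrip_local_rule [OF add.prems(1) pq])
  also have "\<dots> = (\<Sum>j\<in>?J. \<Sum>h | h \<in> shapes (?q - j) \<and> hstrip h g. \<Sum>c | c \<subseteq># m \<and> size c = j. kostka h (m - c))"
  proof (intro sum.cong refl)
    fix j h assume "j \<in> ?J" "h \<in> {h. h \<in> shapes (?q - j) \<and> hstrip h g}"
    then show "(\<Sum>k | k \<in> shapes ?q \<and> hstrip h k. kostka k m) =
        (\<Sum>c | c \<subseteq># m \<and> size c = j. kostka h (m - c))"
      using add.IH [of h "?q - j" j] by simp
  qed
  also have "\<dots> = (\<Sum>j\<in>?J. \<Sum>c | c \<subseteq># m \<and> size c = j. \<Sum>h | h \<in> shapes (?q - j) \<and> hstrip h g. kostka h (m - c))"
    by (intro sum.cong refl sum.swap)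
  also have "\<dots> = (\<Sum>j\<in>?J. \<Sum>c | c \<subseteq># m \<and> size c = j. kostka g (m - c + replicate_mset (b + j - a) x))"
  proof (intro sum.cong refl)
    fix j c assume j: "j \<in> ?J" and "c \<in> {c. c \<subseteq># m \<and> size c = j}"
    then have c: "size (m - c) = ?q - j" by (simp add: size_Diff_submset)
    moreover have "size (m - c) + (b + j - a) = p" using pq j c by auto
    ultimately have "kostka g (m - c + replicate_mset (b + j - a) x) =
        (\<Sum>h | h \<in> shapes (size (m - c)) \<and> hstrip h g. kostka h (m - c))"
      using add.prems(1) add.hyps by (intro kostka_rec) (auto dest: in_diffD)
    then show "(\<Sum>h | h \<in> shapes (?q - j) \<and> hstrip h g. kostka h (m - c)) =
        kostka g (m - c + replicate_mset (b + j - a) x)"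
      using c by simp
  qed
  also have "\<dots> = (\<Sum>c | c \<subseteq># m + replicate_mset b x \<and> size c = a. kostka g (m + replicate_mset b x - c))"
    by (rule sum_submsets_add [OF x, symmetric])
  finally show ?case .
qed

text \<open>
  A matrix of natural numbers with finitely many nonzero entries is encoded as the
  multiset of its positions; its row and column sums are the two projections.
\<close>

definition matrices :: "'a multiset \<Rightarrow> 'b multiset \<Rightarrow> ('a \<times> 'b) multiset set" where
  "matrices m m' = {Q. image_mset fst Q = m \<and> image_mset snd Q = m'}"

lemma finite_matrices: "finite (matrices m m')"
proof (rule finite_subset)
  show "matrices m m' \<subseteq> mset ` {xs. set xs \<subseteq> set_mset m \<times> set_mset m' \<and> length xs = size m}"
  proof
    fix Q assume Q: "Q \<in> matrices m m'"
    obtain xs where xs: "mset xs = Q" using ex_mset by blast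
    have "set xs \<subseteq> set_mset m \<times> set_mset m'"
    proof
      fix p assume "p \<in> set xs"
      then have "p \<in># Q" using xs by auto
      then have "fst p \<in># image_mset fst Q" "snd p \<in># image_mset snd Q" by auto
      moreover have "image_mset fst Q = m" "image_mset snd Q = m'" using Q by (auto simp: matrices_def)
      ultimately show "p \<in> set_mset m \<times> set_mset m'" by (simp only: mem_Times_iff)
    qed
    moreover have "length xs = size m" using Q xs by (auto simp: matrices_def)
    ultimately show "Q \<in> mset ` {xs. set xs \<subseteq> set_mset m \<times> set_mset m' \<and> length xs = size m}"
      using xs by blast
  qed
qed (intro finite_imageI finite_lists_length_eq finite_cartesian_product finite_set_mset)

text \<open>The entries of row \<open>x\<close> form a multiset \<open>c\<close> of columns, and the
  remaining rows have column sums \<open>m' - c\<close>. As \<open>x\<close> is a new letter, its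
  row can be recovered by filtering.\<close>

lemma card_matrices_add:
  assumes x: "x \<notin># m"
  shows "card (matrices (m + replicate_mset a x) m') =
    (\<Sum>c | c \<subseteq># m' \<and> size c = a. card (matrices m (m' - c)))"
proof -
  let ?S = "SIGMA c:{c. c \<subseteq># m' \<and> size c = a}. matrices m (m' - c)"
  let ?\<phi> = "\<lambda>Q. (image_mset snd (filter_mset (\<lambda>p. fst p = x) Q), filter_mset (\<lambda>p. fst p \<noteq> x) Q)"
  let ?\<psi> = "\<lambda>(c, Q). Q + image_mset (Pair x) c"
  have fin: "finite {c. c \<subseteq># m' \<and> size c = a}"
    using finite_submultisets [of m'] by (rule rev_finite_subset) auto
  have part: "filter_mset (\<lambda>p. fst p \<noteq> x) Q + filter_mset (\<lambda>p. fst p = x) Q = Q" for Q :: "('a \<times> 'b) multiset"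
    by (rule multiset_eqI) auto
  have pair: "image_mset (Pair x) (image_mset snd (filter_mset (\<lambda>p. fst p = x) Q)) =
      filter_mset (\<lambda>p. fst p = x) Q" for Q :: "('a \<times> 'b) multiset"
    by (induction Q) auto
  have "card (matrices (m + replicate_mset a x) m') = card ?S"
  proof (rule card_eq_by_inverse [where f = ?\<phi> and g = ?\<psi>])
    fix Q assume Q: "Q \<in> matrices (m + replicate_mset a x) m'"
    let ?Q0 = "filter_mset (\<lambda>p. fst p = x) Q" and ?Q1 = "filter_mset (\<lambda>p. fst p \<noteq> x) Q"
    have f: "image_mset fst Q = m + replicate_mset a x" and s: "image_mset snd Q = m'"
      using Q by (auto simp: matrices_def)
    have m0: "filter_mset (\<lambda>y. y = x) m = {#}" "filter_mset (\<lambda>y. y \<noteq> x) m = m"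
      using x by (auto simp: filter_mset_eq_conv)
    have r0: "filter_mset (\<lambda>y. y = x) (replicate_mset a x) = replicate_mset a x"
      "filter_mset (\<lambda>y. y \<noteq> x) (replicate_mset a x) = {#}"
      by (induction a) auto
    have 1: "image_mset fst ?Q0 = replicate_mset a x" "image_mset fst ?Q1 = m"
      using arg_cong [OF f, of "filter_mset (\<lambda>y. y = x)"] arg_cong [OF f, of "filter_mset (\<lambda>y. y \<noteq> x)"]
        m0 r0 by (simp_all add: filter_mset_image_mset)
    have 2: "m' = image_mset snd ?Q1 + image_mset snd ?Q0"
      using s part [of Q] by (metis image_mset_union)
    have "size ?Q0 = a" using arg_cong [OF 1(1), of size] by simp
    then have "?\<phi> Q \<in> ?S" using 1(2) by (simp add: matrices_def 2)
    then show "?\<phi> Q \<in> ?S \<and> ?\<psi> (?\<phi> Q) = Q" using part pair by simp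
  next
    fix cQ assume cQ: "cQ \<in> ?S"
    obtain c Q where e: "cQ = (c, Q)" by force
    then have Q: "Q \<in> matrices m (m' - c)" and c: "c \<subseteq># m'" "size c = a" using cQ by auto
    have "fst p \<noteq> x" if "p \<in># Q" for p using that Q x by (auto simp: matrices_def)
    then have "filter_mset (\<lambda>p. fst p = x) Q = {#}" "filter_mset (\<lambda>p. fst p \<noteq> x) Q = Q"
      by (auto simp: filter_mset_eq_conv)
    moreover have "filter_mset (\<lambda>p. fst p = x) (image_mset (Pair x) c) = image_mset (Pair x) c"
      "filter_mset (\<lambda>p. fst p \<noteq> x) (image_mset (Pair x) c) = {#}"
      by (induction c) auto
    ultimately have "?\<phi> (?\<psi> cQ) = cQ" by (simp add: e image_mset.compositionality o_def)
    moreover have "image_mset fst (image_mset (Pair x) c) = replicate_mset (size c) x"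
      "image_mset snd (image_mset (Pair x) c) = c"
      by (induction c) auto
    then have "?\<psi> cQ \<in> matrices (m + replicate_mset a x) m'"
      using Q c by (simp add: e matrices_def del: multiset.map_comp)
    ultimately show "?\<psi> cQ \<in> matrices (m + replicate_mset a x) m' \<and> ?\<phi> (?\<psi> cQ) = cQ" by blast
  qed
  also have "\<dots> = (\<Sum>c | c \<subseteq># m' \<and> size c = a. card (matrices m (m' - c)))"
    by (rule card_SigmaI) (use fin finite_matrices in auto)
  finally show ?thesis .
qed

text \<open>The Cauchy identity at a pair of monomials. Splitting off the largest letter of
  \<open>m\<close> leaves, for every inner shape \<open>g\<close>, a sum over the shapes
  \<open>f\<close> around \<open>g\<close> of Kostka numbers for \<open>m'\<close>; Pieri's rule
  turns it into a choice of \<open>c\<close>, which is the row of the matrix belonging to that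
  letter.\<close>

lemma sum_kostka_kostka:
  assumes "size m = n" "size m' = n"
  shows "(\<Sum>f\<in>shapes n. kostka f m * kostka f m') = card (matrices m m')"
  using assms
proof (induction m arbitrary: n m' rule: multiset_max_induct)
  case empty
  have "matrices {#} {#} = {{#} :: (nat \<times> nat) multiset}" by (auto simp: matrices_def)
  then show ?case using empty by (simp add: shapes_0)
next
  case (add m a x n m')
  let ?q = "size m"
  have n: "n = ?q + a" using add.prems by simp
  have x: "x \<notin># m" using add.hyps by blast
  have "(\<Sum>f\<in>shapes n. kostka f (m + replicate_mset a x) * kostka f m') =
      (\<Sum>f\<in>shapes n. \<Sum>g | g \<in> shapes ?q \<and> hstrip g f. kostka g m * kostka f m')"
    using add.hyps by (intro sum.cong refl) (simp add: kostka_rec n sum_distrib_right)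
  also have "\<dots> = (\<Sum>g\<in>shapes ?q. \<Sum>f | f \<in> shapes n \<and> hstrip g f. kostka g m * kostka f m')"
    by (rule sum.swap_restrict) (simp_all add: finite_shapes)
  also have "\<dots> = (\<Sum>g\<in>shapes ?q. \<Sum>c | c \<subseteq># m' \<and> size c = a. kostka g m * kostka g (m' - c))"
    using add.prems n by (intro sum.cong refl) (simp add: kostka_up flip: sum_distrib_left)
  also have "\<dots> = (\<Sum>c | c \<subseteq># m' \<and> size c = a. \<Sum>g\<in>shapes ?q. kostka g m * kostka g (m' - c))"
    by (rule sum.swap)
  also have "\<dots> = (\<Sum>c | c \<subseteq># m' \<and> size c = a. card (matrices m (m' - c)))"
    using add.prems n by (intro sum.cong refl add.IH) (auto simp: size_Diff_submset)
  also have "\<dots> = card (matrices (m + replicate_mset a x) m')"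
    using x by (rule card_matrices_add [symmetric])
  finally show ?case .
qed

section \<open>Dominance order\<close>

definition row_content :: "(nat \<Rightarrow> nat) \<Rightarrow> nat multiset" where
  "row_content f = image_mset fst (mset_set (diagram f))"

text \<open>This is the conjugate partition, written as a content.\<close>

definition col_content :: "(nat \<Rightarrow> nat) \<Rightarrow> nat multiset" where
  "col_content f = image_mset snd (mset_set (diagram f))"

definition dominated :: "(nat \<Rightarrow> nat) \<Rightarrow> (nat \<Rightarrow> nat) \<Rightarrow> bool" where
  "dominated f g \<longleftrightarrow> (\<forall>k. (\<Sum>i<k. f i) \<le> (\<Sum>i<k. g i))"

lemma dominated_refl: "dominated f f"
  by (simp add: dominated_def)

lemma dominated_trans: "dominated f g \<Longrightarrow> dominated g h \<Longrightarrow> dominated f h"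
  unfolding dominated_def by (meson le_trans)

lemma dominated_antisym:
  assumes "dominated f g" "dominated g f"
  shows "f = g"
proof
  fix i
  have "(\<Sum>i<k. f i) = (\<Sum>i<k. g i)" for k
    using assms by (simp add: dominated_def le_antisym)
  from this [of i] this [of "Suc i"] show "f i = g i" by simp
qed

lemma size_row_content: "f \<in> shapes n \<Longrightarrow> size (row_content f) = n"
  by (simp add: row_content_def card_diagram)

lemma card_diagram_rows:
  assumes "f \<in> shapes n"
  shows "card {c \<in> diagram f. fst c < k} = (\<Sum>i<k. f i)"
proof -
  have "{c \<in> diagram f. fst c < k} = (SIGMA i:{..<k}. {..<f i})"
    by (auto simp: diagram_def)
  then show ?thesis by simp
qed

lemma size_row_content_less:
  assumes "f \<in> shapes n"
  shows "size (filter_mset (\<lambda>y. y < k) (row_content f)) = (\<Sum>i<k. f i)"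
  using card_diagram_rows [OF assms] finite_diagram [OF assms]
  by (simp add: row_content_def filter_mset_image_mset filter_mset_mset_set)

lemma tableaux_row_le:
  assumes f: "f \<in> shapes n" and T: "T \<in> tableaux f m" and "(i, j) \<in> diagram f"
  shows "i \<le> T (i, j)"
  using assms(3)
proof (induction i)
  case (Suc i)
  have "(i, j) \<in> diagram f"
    using Suc.prems antimonoD [OF shapesD(1) [OF f], of i "Suc i"] by (auto simp: diagram_def)
  then have "i \<le> T (i, j)" "T (i, j) < T (Suc i, j)"
    using Suc T by (auto simp: tableaux_def)
  then show ?case by simp
qed simp

text \<open>Strict columns confine the entries below \<open>k\<close> to the first \<open>k\<close>
  rows, and the number of these entries is a partial sum of \<open>f\<close>.\<close>

lemma kostka_dominated:
  assumes f: "f \<in> shapes n" and g: "g \<in> shapes n" and nz: "kostka g (row_content f) \<noteq> 0"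
  shows "dominated f g"
  unfolding dominated_def
proof
  fix k
  obtain T where T: "T \<in> tableaux g (row_content f)"
    using nz by (metis card.empty ex_in_conv kostka_def)
  note fin = finite_diagram [OF g]
  have "(\<Sum>i<k. f i) = size (filter_mset (\<lambda>y. y < k) (image_mset T (mset_set (diagram g))))"
    using T size_row_content_less [OF f] by (simp add: tableaux_def)
  also have "\<dots> = card {c \<in> diagram g. T c < k}"
    using fin by (simp add: filter_mset_image_mset filter_mset_mset_set)
  also have "\<dots> \<le> card {c \<in> diagram g. fst c < k}"
  proof (rule card_mono)
    have "fst c < k" if "c \<in> diagram g" "T c < k" for c
      using tableaux_row_le [OF g T, of "fst c" "snd c"] that by simp
    then show "{c \<in> diagram g. T c < k} \<subseteq> {c \<in> diagram g. fst c < k}" by blast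
  qed (use fin in simp)
  also have "\<dots> = (\<Sum>i<k. g i)" by (rule card_diagram_rows [OF g])
  finally show "(\<Sum>i<k. f i) \<le> (\<Sum>i<k. g i)" .
qed

text \<open>Every entry is at least its row index and the totals agree, so equality holds in every
  cell.\<close>

lemma kostka_row_content:
  assumes f: "f \<in> shapes n"
  shows "kostka f (row_content f) = 1"
proof -
  note fin = finite_diagram [OF f]
  have "tableaux f (row_content f) = {restrict fst (diagram f)}"
  proof (intro equalityI subsetI)
    fix T assume T: "T \<in> tableaux f (row_content f)"
    have le: "fst c \<le> T c" if "c \<in> diagram f" for c
      using tableaux_row_le [OF f T, of "fst c" "snd c"] that by simp
    have "(\<Sum>c\<in>diagram f. T c) = sum_mset (row_content f)"
      using T by (simp add: tableaux_def sum_unfold_sum_mset)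
    also have "\<dots> = (\<Sum>c\<in>diagram f. fst c)"
      by (simp add: row_content_def sum_unfold_sum_mset)
    finally have sum: "(\<Sum>c\<in>diagram f. fst c) = (\<Sum>c\<in>diagram f. T c)" by simp
    have "T c = fst c" if "c \<in> diagram f" for c
    proof (rule ccontr)
      assume "T c \<noteq> fst c"
      then have "fst c < T c" using le [OF that] by simp
      then have "(\<Sum>c\<in>diagram f. fst c) < (\<Sum>c\<in>diagram f. T c)"
        using le that fin by (intro sum_strict_mono_ex1) auto
      then show False using sum by simp
    qed
    moreover have "T \<in> extensional (diagram f)" using T by (simp add: tableaux_def)
    ultimately have "T = restrict fst (diagram f)"
      by (intro extensionalityI [of _ "diagram f"]) auto
    then show "T \<in> {restrict fst (diagram f)}" by simp
  next
    fix T assume "T \<in> {restrict fst (diagram f)}"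
    then have T: "T = restrict fst (diagram f)" by simp
    have "image_mset (restrict fst (diagram f)) (mset_set (diagram f)) =
        image_mset fst (mset_set (diagram f))"
      by (rule image_mset_cong) (use fin in simp)
    then show "T \<in> tableaux f (row_content f)"
      by (auto simp: T tableaux_def row_content_def diagram_def)
  qed
  then show ?thesis by (simp add: kostka_def)
qed

text \<open>
  An injective filling of \<open>A\<close> by matrix positions is a 0-1 matrix, so this is the easy
  half of the Gale-Ryser theorem.
\<close>

lemma injective_pairs_dominated:
  assumes f: "f \<in> shapes n" and g: "g \<in> shapes n" and A: "finite A"
    and c: "image_mset c (mset_set A) = row_content f"
    and d: "image_mset d (mset_set A) = col_content g"
    and inj: "inj_on (\<lambda>x. (c x, d x)) A"
  shows "dominated f g"
  unfolding dominated_def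
proof
  fix k
  note fin = finite_diagram [OF g]
  define J where "J = snd ` diagram g"
  have finJ: "finite J" using fin by (simp add: J_def)
  have dJ: "d x \<in> J" if "x \<in> A" for x
  proof -
    have "d x \<in># image_mset d (mset_set A)" using that A by simp
    then show ?thesis unfolding d col_content_def using fin by (auto simp: J_def)
  qed
  \<comment> \<open>Within the first \<open>k\<close> rows, a column of a 0-1 matrix contains at
    most \<open>k\<close> ones and at most its column sum; the diagram of \<open>g\<close> attains
    the smaller bound.\<close>
  have cols: "card {x \<in> A. c x < k \<and> d x = j} \<le> card {p \<in> diagram g. fst p < k \<and> snd p = j}" for j
  proof -
    have 1: "card {x \<in> A. c x < k \<and> d x = j} \<le> k"
    proof -
      have "inj_on c {x \<in> A. c x < k \<and> d x = j}"
        using inj by (auto simp: inj_on_def)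
      then have "card {x \<in> A. c x < k \<and> d x = j} = card (c ` {x \<in> A. c x < k \<and> d x = j})"
        by (simp add: card_image)
      also have "\<dots> \<le> card {..<k}" by (intro card_mono) auto
      finally show ?thesis by simp
    qed
    have "card {x \<in> A. d x = j} = size (filter_mset (\<lambda>y. y = j) (image_mset d (mset_set A)))"
      using A by (simp add: filter_mset_image_mset filter_mset_mset_set)
    also have "\<dots> = card {p \<in> diagram g. snd p = j}"
      unfolding d using fin by (simp add: col_content_def filter_mset_image_mset filter_mset_mset_set)
    finally have "card {x \<in> A. d x = j} = card {p \<in> diagram g. snd p = j}" .
    moreover have "card {x \<in> A. c x < k \<and> d x = j} \<le> card {x \<in> A. d x = j}"
      using A by (intro card_mono) auto
    ultimately have 2: "card {x \<in> A. c x < k \<and> d x = j} \<le> card {p \<in> diagram g. snd p = j}" by simp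
    show ?thesis
    proof (cases "\<forall>p\<in>diagram g. snd p = j \<longrightarrow> fst p < k")
      case True
      then have "{p \<in> diagram g. fst p < k \<and> snd p = j} = {p \<in> diagram g. snd p = j}" by auto
      then show ?thesis using 2 by simp
    next
      case False
      then obtain i where i: "(i, j) \<in> diagram g" "k \<le> i" by auto
      have "(\<lambda>i. (i, j)) ` {..<k} \<subseteq> {p \<in> diagram g. fst p < k \<and> snd p = j}"
      proof safe
        fix i' assume "i' < k"
        then have "g i \<le> g i'" using i antimonoD [OF shapesD(1) [OF g]] by simp
        then show "(i', j) \<in> diagram g" using i by (simp add: diagram_def)
      qed auto
      then have "card ((\<lambda>i. (i, j)) ` {..<k}) \<le> card {p \<in> diagram g. fst p < k \<and> snd p = j}"
        using fin by (intro card_mono) auto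
      moreover have "card ((\<lambda>i. (i, j)) ` {..<k}) = k" by (subst card_image) (auto simp: inj_on_def)
      ultimately show ?thesis using 1 by simp
    qed
  qed
  have "(\<Sum>i<k. f i) = size (filter_mset (\<lambda>y. y < k) (image_mset c (mset_set A)))"
    unfolding c by (simp add: size_row_content_less [OF f])
  also have "\<dots> = card {x \<in> A. c x < k}"
    using A by (simp add: filter_mset_image_mset filter_mset_mset_set)
  also have "\<dots> = (\<Sum>j\<in>J. card {x \<in> A. c x < k \<and> d x = j})"
  proof -
    have "{x \<in> A. c x < k} = (\<Union>j\<in>J. {x \<in> A. c x < k \<and> d x = j})" using dJ by auto
    then show ?thesis using A finJ by (simp only:) (rule card_UN_disjoint, auto)
  qed
  also have "\<dots> \<le> (\<Sum>j\<in>J. card {p \<in> diagram g. fst p < k \<and> snd p = j})"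
    using cols by (rule sum_mono)
  also have "\<dots> = card {p \<in> diagram g. fst p < k}"
  proof -
    have "{p \<in> diagram g. fst p < k} = (\<Union>j\<in>J. {p \<in> diagram g. fst p < k \<and> snd p = j})"
      by (auto simp: J_def)
    then show ?thesis using fin finJ by (simp only:) (rule card_UN_disjoint [symmetric], auto)
  qed
  also have "\<dots> = (\<Sum>i<k. g i)" by (rule card_diagram_rows [OF g])
  finally show "(\<Sum>i<k. f i) \<le> (\<Sum>i<k. g i)" .
qed

section \<open>Standard tableaux and involutions\<close>

definition involutions :: "'a set \<Rightarrow> ('a \<Rightarrow> 'a) set" where
  "involutions A = {u. u permutes A \<and> u \<circ> u = id}"

lemma finite_involutions: "finite A \<Longrightarrow> finite (involutions A)"
  by (rule finite_subset [of _ "{u. u permutes A}"]) (auto simp: involutions_def finite_permutations)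

lemma involution_apply: "u \<in> involutions A \<Longrightarrow> u (u x) = x"
  by (auto simp: involutions_def fun_eq_iff)

text \<open>Involutions are sorted by the image of \<open>x\<close>. If it is some \<open>y\<close>
  in \<open>A\<close>, composition with the transposition of \<open>x\<close> and \<open>y\<close>
  makes both fixed points and is undone by the same composition.\<close>

lemma card_involutions_insert:
  assumes fin: "finite A" and x: "x \<notin> A"
  shows "card (involutions (insert x A)) = card (involutions A) + (\<Sum>y\<in>A. card (involutions (A - {y})))"
proof -
  let ?I = "\<lambda>y. {u \<in> involutions (insert x A). u x = y}"
  have "involutions (insert x A) = (\<Union>y\<in>insert x A. ?I y)"
    by (auto simp: involutions_def permutes_in_image dest: permutes_in_image [of _ _ x])
  then have "card (involutions (insert x A)) = card (\<Union>y\<in>insert x A. ?I y)" by simp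
  also have "\<dots> = (\<Sum>y\<in>insert x A. card (?I y))"
    by (rule card_UN_disjoint) (use fin in \<open>auto simp: finite_involutions\<close>)
  also have "\<dots> = card (?I x) + (\<Sum>y\<in>A. card (?I y))" using fin x by simp
  also have "?I x = involutions A"
  proof (intro equalityI subsetI)
    fix u assume "u \<in> ?I x"
    then show "u \<in> involutions A" by (auto simp: involutions_def elim: permutes_superset)
  next
    fix u assume "u \<in> involutions A"
    then show "u \<in> ?I x"
      using x by (auto simp: involutions_def permutes_not_in intro: permutes_subset)
  qed
  also have "(\<Sum>y\<in>A. card (?I y)) = (\<Sum>y\<in>A. card (involutions (A - {y})))"
  proof (rule sum.cong [OF refl])
    fix y assume y: "y \<in> A"
    then have xy: "x \<noteq> y" using x by auto
    let ?t = "transpose x y"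
    have tt: "?t \<circ> (?t \<circ> u) = u" for u :: "'a \<Rightarrow> 'a" by (simp add: fun_eq_iff)
    have t: "?t permutes insert x A" using y by (intro permutes_swap_id) auto
    have inv: "(?t \<circ> u) \<circ> (?t \<circ> u) = id"
      if uu: "\<And>z. u (u z) = z" and xy: "u x = y \<and> u y = x \<or> u x = x \<and> u y = y" for u
    proof
      fix z show "((?t \<circ> u) \<circ> (?t \<circ> u)) z = id z"
      proof (cases "z = x \<or> z = y")
        case False
        then have "u z \<noteq> x" "u z \<noteq> y" using uu [of z] xy by auto
        then show ?thesis using uu False by (simp add: transpose_def)
      qed (use xy in auto)
    qed
    show "card (?I y) = card (involutions (A - {y}))"
    proof (rule card_eq_by_inverse [where f = "\<lambda>u. ?t \<circ> u" and g = "\<lambda>u. ?t \<circ> u"])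
      fix u assume u: "u \<in> ?I y"
      then have ux: "u x = y" and uu: "u (u z) = z" for z by (auto intro: involution_apply)
      have uy: "u y = x" using uu [of x] ux by simp
      have "?t \<circ> u permutes insert x A"
        using u t by (auto simp: involutions_def intro: permutes_compose)
      then have "?t \<circ> u permutes A - {y}" using ux uy by (elim permutes_superset) auto
      then show "?t \<circ> u \<in> involutions (A - {y}) \<and> ?t \<circ> (?t \<circ> u) = u"
        using inv [of u] uu ux uy tt by (simp add: involutions_def)
    next
      fix v assume v: "v \<in> involutions (A - {y})"
      then have p: "v permutes A - {y}" by (simp add: involutions_def)
      have vx: "v x = x" "v y = y" using x p by (auto intro: permutes_not_in)
      have "v permutes insert x A" using p by (rule permutes_subset) auto
      then have "?t \<circ> v permutes insert x A" using t by (rule permutes_compose)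
      then show "?t \<circ> v \<in> ?I y \<and> ?t \<circ> (?t \<circ> v) = v"
        using inv [of v] involution_apply [OF v] vx tt by (simp add: involutions_def)
    qed
  qed
  finally show ?thesis .
qed

text \<open>The case \<open>a = b = 1\<close> and \<open>f = g\<close> of the local rule: every
  shape has one more upper than lower neighbour, the summand \<open>j = 0\<close> being the shape
  itself. The outcome is the recursion of \<open>card_involutions_insert\<close>.\<close>

lemma sum_kostka_add_max:
  assumes x: "\<And>y. y \<in># m \<Longrightarrow> y < x"
  shows "(\<Sum>f\<in>shapes (Suc (size m)). kostka f (add_mset x m)) =
    (\<Sum>f\<in>shapes (size m). kostka f m) +
    (\<Sum>c | c \<subseteq># m \<and> size c = 1. \<Sum>f\<in>shapes (size (m - c)). kostka f (m - c))"
proof -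
  let ?q = "size m"
  let ?D = "\<lambda>j. \<Sum>h\<in>shapes (?q - j). \<Sum>c | c \<subseteq># m \<and> size c = j. kostka h (m - c)"
  let ?J = "{j. j \<le> 1 \<and> j \<le> ?q \<and> 1 \<le> 1 + j}"
  have "(\<Sum>f\<in>shapes (Suc ?q). kostka f (add_mset x m)) =
      (\<Sum>f\<in>shapes (?q + 1). \<Sum>k | k \<in> shapes ?q \<and> hstrip k f. kostka k m)"
    using kostka_rec [of _ m 1 x] x by (intro sum.cong) auto
  also have "\<dots> = (\<Sum>k\<in>shapes ?q. \<Sum>f | f \<in> shapes (?q + 1) \<and> hstrip k f. kostka k m)"
    by (rule sum.swap_restrict) (simp_all add: finite_shapes)
  also have "\<dots> = (\<Sum>k\<in>shapes ?q. \<Sum>j\<in>?J. card {h \<in> shapes (?q - j). hstrip h k \<and> hstrip h k} * kostka k m)"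
  proof (rule sum.cong [OF refl])
    fix k assume k: "k \<in> shapes ?q"
    show "(\<Sum>f | f \<in> shapes (?q + 1) \<and> hstrip k f. kostka k m) =
        (\<Sum>j\<in>?J. card {h \<in> shapes (?q - j). hstrip h k \<and> hstrip h k} * kostka k m)"
      using hstrip_local_rule [OF k k refl, of 1] by (simp add: sum_distrib_right)
  qed
  also have "\<dots> = (\<Sum>k\<in>shapes ?q. \<Sum>j\<in>?J. \<Sum>h | h \<in> shapes (?q - j) \<and> hstrip h k. kostka k m)"
    by simp
  also have "\<dots> = (\<Sum>j\<in>?J. \<Sum>k\<in>shapes ?q. \<Sum>h | h \<in> shapes (?q - j) \<and> hstrip h k. kostka k m)"
    by (rule sum.swap)
  also have "\<dots> = (\<Sum>j\<in>?J. \<Sum>h\<in>shapes (?q - j). \<Sum>k | k \<in> shapes ?q \<and> hstrip h k. kostka k m)"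
    by (intro sum.cong refl sum.swap_restrict) (simp_all add: finite_shapes)
  also have "\<dots> = (\<Sum>j\<in>?J. ?D j)"
  proof (intro sum.cong refl)
    fix j h assume "j \<in> ?J" "h \<in> shapes (?q - j)"
    then show "(\<Sum>k | k \<in> shapes ?q \<and> hstrip h k. kostka k m) =
        (\<Sum>c | c \<subseteq># m \<and> size c = j. kostka h (m - c))"
      using kostka_up [of h "?q - j" m j] by simp
  qed
  \<comment> \<open>For empty \<open>m\<close> the index 1 is excluded by \<open>j \<le> ?q\<close>.
    Truncated subtraction then leaves one shape in \<open>?D 1\<close>, but its inner sum is
    empty.\<close>
  also have "\<dots> = ?D 0 + ?D 1"
  proof (cases "?q = 0")
    case True
    then have J: "?J = {0}" and "{c. c \<subseteq># m \<and> size c = 1} = {}" by auto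
    then have "?D 1 = 0" by (simp only: sum.empty sum.neutral_const)
    then show ?thesis unfolding J by simp
  next
    case False
    then have "1 \<le> ?q" by linarith
    then have "?J = {0, 1}" by auto
    then show ?thesis by simp
  qed
  also have "?D 0 = (\<Sum>f\<in>shapes ?q. kostka f m)"
  proof -
    have "{c. c \<subseteq># m \<and> size c = 0} = {{#}}" by auto
    then show ?thesis by simp
  qed
  also have "?D 1 = (\<Sum>c | c \<subseteq># m \<and> size c = 1. \<Sum>f\<in>shapes (size (m - c)). kostka f (m - c))"
    by (subst sum.swap) (auto simp: size_Diff_submset intro!: sum.cong)
  finally show ?thesis .
qed

text \<open>\<open>A\<close> is an arbitrary set of letters because the recursion also deletes
  letters below the largest one. With \<open>A = {1..n}\<close> the left-hand side is the sum of the
  degrees of the characters.\<close>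

lemma sum_kostka_standard:
  assumes "finite (A :: nat set)"
  shows "(\<Sum>f\<in>shapes (card A). kostka f (mset_set A)) = card (involutions A)"
  using assms
proof (induction "card A" arbitrary: A rule: less_induct)
  case less
  show ?case
  proof (cases "A = {}")
    case True
    have "involutions ({} :: nat set) = {id}" by (auto simp: involutions_def)
    then show ?thesis using True by (simp add: shapes_0)
  next
    case False
    define x where "x = Max A"
    define B where "B = A - {x}"
    have xA: "x \<in> A" using False less.prems by (simp add: x_def)
    have B: "finite B" "x \<notin> B" "A = insert x B" using xA less.prems by (auto simp: B_def)
    have lt: "y < x" if "y \<in> B" for y
      using that less.prems by (auto simp: B_def x_def order_less_le)
    have c: "{c. c \<subseteq># mset_set B \<and> size c = 1} = (\<lambda>y. {#y#}) ` B"
    proof (intro equalityI subsetI)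
      fix c assume "c \<in> {c. c \<subseteq># mset_set B \<and> size c = 1}"
      then obtain y where "c = {#y#}" "{#y#} \<subseteq># mset_set B"
        by (auto simp: size_1_singleton_mset dest!: size_1_singleton_mset [simplified])
      then show "c \<in> (\<lambda>y. {#y#}) ` B" using B(1) by auto
    qed (use B(1) in auto)
    have "(\<Sum>f\<in>shapes (card A). kostka f (mset_set A)) =
        (\<Sum>f\<in>shapes (Suc (size (mset_set B))). kostka f (add_mset x (mset_set B)))"
      using B by simp
    also have "\<dots> = (\<Sum>f\<in>shapes (card B). kostka f (mset_set B)) +
        (\<Sum>y\<in>B. \<Sum>f\<in>shapes (card (B - {y})). kostka f (mset_set (B - {y})))"
    proof (subst sum_kostka_add_max)
      show "(\<Sum>f\<in>shapes (size (mset_set B)). kostka f (mset_set B)) +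
          (\<Sum>c | c \<subseteq># mset_set B \<and> size c = 1.
            \<Sum>f\<in>shapes (size (mset_set B - c)). kostka f (mset_set B - c)) =
          (\<Sum>f\<in>shapes (card B). kostka f (mset_set B)) +
          (\<Sum>y\<in>B. \<Sum>f\<in>shapes (card (B - {y})). kostka f (mset_set (B - {y})))"
        unfolding c using B(1)
        by (subst sum.reindex) (simp_all add: inj_on_def mset_set_Diff size_Diff_submset)
    qed (use lt B(1) in auto)
    also have "\<dots> = card (involutions B) + (\<Sum>y\<in>B. card (involutions (B - {y})))"
    proof -
      have "(\<Sum>f\<in>shapes (card B). kostka f (mset_set B)) = card (involutions B)"
        using B by (intro less.hyps) auto
      moreover have "(\<Sum>f\<in>shapes (card (B - {y})). kostka f (mset_set (B - {y}))) =
          card (involutions (B - {y}))" if "y \<in> B" for y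
        using B that by (intro less.hyps) (auto simp: card_Diff_singleton)
      ultimately show ?thesis by simp
    qed
    also have "\<dots> = card (involutions A)" using card_involutions_insert [OF B(1,2)] B(3) by simp
    finally show ?thesis .
  qed
qed

section \<open>Class functions on the symmetric group\<close>

lemma permsD: "w \<in> perms n \<Longrightarrow> w permutes {1..n}"
  by (simp add: perms_def)

lemma perms_comp: "u \<in> perms n \<Longrightarrow> v \<in> perms n \<Longrightarrow> u \<circ> v \<in> perms n"
  by (simp add: perms_def permutes_compose)

lemma perms_inv: "u \<in> perms n \<Longrightarrow> inv u \<in> perms n"
  by (simp add: perms_def permutes_inv)

lemma perms_id: "id \<in> perms n"
  by (simp add: perms_def permutes_id)

lemma perms_inv_comp [simp]:
  assumes "u \<in> perms n"
  shows "inv u \<circ> u = id" "u \<circ> inv u = id" "inv (inv u) = u" "inv u (u x) = x" "u (inv u x) = x"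
    "inv u \<circ> (u \<circ> f) = f" "u \<circ> (inv u \<circ> f) = f"
proof -
  note u = permsD [OF assms]
  show "inv u \<circ> u = id" "u \<circ> inv u = id" "inv (inv u) = u" "inv u (u x) = x" "u (inv u x) = x"
    using u by (simp_all add: permutes_inv_o permutes_inv_inv permutes_inverses)
  show "inv u \<circ> (u \<circ> f) = f" "u \<circ> (inv u \<circ> f) = f"
    using u by (simp_all add: fun_eq_iff permutes_inverses)
qed

lemma perms_inv_distrib: "u \<in> perms n \<Longrightarrow> v \<in> perms n \<Longrightarrow> inv (u \<circ> v) = inv v \<circ> inv u"
  by (metis o_inv_distrib permsD permutes_bij)

lemma perms_inv_inv_comp: "u \<in> perms n \<Longrightarrow> v \<in> perms n \<Longrightarrow> inv (inv u \<circ> v) = inv v \<circ> u"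
  using perms_inv_distrib [of "inv u" n v] by (simp add: perms_inv)

lemma perms_inv_comp_inv: "u \<in> perms n \<Longrightarrow> v \<in> perms n \<Longrightarrow> inv (u \<circ> inv v) = v \<circ> inv u"
  using perms_inv_distrib [of u n "inv v"] by (simp add: perms_inv)

lemma sum_perms_left:
  assumes "v \<in> perms n"
  shows "(\<Sum>u\<in>perms n. F (v \<circ> u)) = (\<Sum>u\<in>perms n. F u)"
  by (rule sum.reindex_bij_witness [where i = "\<lambda>u. inv v \<circ> u" and j = "\<lambda>u. v \<circ> u"])
    (use assms in \<open>auto simp: perms_inv perms_comp\<close>)

lemma sum_perms_right:
  assumes "v \<in> perms n"
  shows "(\<Sum>u\<in>perms n. F (u \<circ> v)) = (\<Sum>u\<in>perms n. F u)"
  by (rule sum.reindex_bij_witness [where i = "\<lambda>u. u \<circ> inv v" and j = "\<lambda>u. u \<circ> v"])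
    (use assms in \<open>auto simp: perms_inv perms_comp comp_assoc\<close>)

lemma card_perms_left:
  "v \<in> perms n \<Longrightarrow> card {u \<in> perms n. P (v \<circ> u)} = card {u \<in> perms n. P u}"
  using sum_perms_left [of v n "\<lambda>u. of_bool (P u) :: nat"] by (simp add: finite_perms Int_def)

lemma card_perms_right:
  "v \<in> perms n \<Longrightarrow> card {u \<in> perms n. P (u \<circ> v)} = card {u \<in> perms n. P u}"
  using sum_perms_right [of v n "\<lambda>u. of_bool (P u) :: nat"] by (simp add: finite_perms Int_def)

lemma comp_cancel_left:
  assumes "u \<in> perms n"
  shows "u \<circ> v = w \<longleftrightarrow> v = inv u \<circ> w"
  using perms_inv_comp(6) [OF assms, of v] perms_inv_comp(7) [OF assms, of w] by auto

lemma comp_cancel_right: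
  assumes "u \<in> perms n"
  shows "v \<circ> inv u = w \<longleftrightarrow> v = w \<circ> u"
  using assms by (auto simp: comp_assoc)

definition conj_perm :: "(nat \<Rightarrow> nat) \<Rightarrow> (nat \<Rightarrow> nat) \<Rightarrow> nat \<Rightarrow> nat" where
  "conj_perm s w = s \<circ> w \<circ> inv s"

lemma conj_perm_in: "s \<in> perms n \<Longrightarrow> w \<in> perms n \<Longrightarrow> conj_perm s w \<in> perms n"
  by (simp add: conj_perm_def perms_comp perms_inv)

lemma sum_perms_conj:
  assumes "s \<in> perms n"
  shows "(\<Sum>w\<in>perms n. F (conj_perm s w)) = (\<Sum>w\<in>perms n. F w)"
  unfolding conj_perm_def
  using sum_perms_right [OF perms_inv [OF assms], of F]
    sum_perms_left [OF assms, of "\<lambda>w. F (w \<circ> inv s)"] by simp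

lemma conj_perm_comp:
  "s \<in> perms n \<Longrightarrow> t \<in> perms n \<Longrightarrow> conj_perm (s \<circ> t) w = conj_perm s (conj_perm t w)"
  using perms_inv_distrib [of s n t] by (simp add: conj_perm_def comp_assoc)

lemma conj_perm_eq_iff:
  assumes "s \<in> perms n"
  shows "conj_perm s v = w \<longleftrightarrow> s \<circ> v = w \<circ> s" "conj_perm s v = conj_perm s w \<longleftrightarrow> v = w"
proof -
  show "conj_perm s v = w \<longleftrightarrow> s \<circ> v = w \<circ> s" for w
    unfolding conj_perm_def by (rule comp_cancel_right [OF assms])
  from this [of "conj_perm s w"] show "conj_perm s v = conj_perm s w \<longleftrightarrow> v = w"
    using comp_cancel_left [OF assms, of v "s \<circ> w"] assms by (simp add: conj_perm_def comp_assoc)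
qed

definition class_fun :: "nat \<Rightarrow> ((nat \<Rightarrow> nat) \<Rightarrow> rat) \<Rightarrow> bool" where
  "class_fun n f \<longleftrightarrow> (\<forall>s\<in>perms n. \<forall>w\<in>perms n. f (conj_perm s w) = f w)"

lemma class_funD: "class_fun n f \<Longrightarrow> s \<in> perms n \<Longrightarrow> w \<in> perms n \<Longrightarrow> f (conj_perm s w) = f w"
  by (simp add: class_fun_def)

lemma class_fun_comm:
  assumes f: "class_fun n f" and u: "u \<in> perms n" and v: "v \<in> perms n"
  shows "f (u \<circ> v) = f (v \<circ> u)"
proof -
  have "conj_perm v (u \<circ> v) = v \<circ> u"
    using u v by (simp add: conj_perm_def comp_assoc)
  then show ?thesis using class_funD [OF f v perms_comp [OF u v]] by simp
qed

lemma class_fun_diff: "class_fun n f \<Longrightarrow> class_fun n g \<Longrightarrow> class_fun n (\<lambda>w. f w - g w)"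
  by (simp add: class_fun_def)

lemma class_fun_scale: "class_fun n f \<Longrightarrow> class_fun n (\<lambda>w. c * f w)"
  by (simp add: class_fun_def)

lemma class_fun_sum: "(\<And>i. i \<in> I \<Longrightarrow> class_fun n (F i)) \<Longrightarrow> class_fun n (\<lambda>w. \<Sum>i\<in>I. F i w)"
  by (auto simp: class_fun_def intro!: sum.cong)

text \<open>There is neither conjugation nor inversion in the second argument: the values are
  rational, and the characters are invariant under inversion (\<open>chi_inv\<close>), which links
  this product to \<open>conv\<close> at the identity.\<close>

definition inner_prod :: "nat \<Rightarrow> ((nat \<Rightarrow> nat) \<Rightarrow> rat) \<Rightarrow> ((nat \<Rightarrow> nat) \<Rightarrow> rat) \<Rightarrow> rat" where
  "inner_prod n f g = (\<Sum>w\<in>perms n. f w * g w) / fact n"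

definition conv :: "nat \<Rightarrow> ((nat \<Rightarrow> nat) \<Rightarrow> rat) \<Rightarrow> ((nat \<Rightarrow> nat) \<Rightarrow> rat) \<Rightarrow> (nat \<Rightarrow> nat) \<Rightarrow> rat" where
  "conv n f g w = (\<Sum>u\<in>perms n. f u * g (inv u \<circ> w))"

lemma inner_prod_commute: "inner_prod n f g = inner_prod n g f"
  by (simp add: inner_prod_def mult.commute)

lemma inner_prod_sum_right:
  "inner_prod n f (\<lambda>w. \<Sum>i\<in>I. c i * F i w) = (\<Sum>i\<in>I. c i * inner_prod n f (F i))"
proof -
  have "(\<Sum>w\<in>perms n. f w * (\<Sum>i\<in>I. c i * F i w)) = (\<Sum>i\<in>I. c i * (\<Sum>w\<in>perms n. f w * F i w))"
    unfolding sum_distrib_left by (subst sum.swap) (simp add: ac_simps)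
  then show ?thesis
    by (simp only: inner_prod_def times_divide_eq_right sum_divide_distrib [symmetric])
qed

lemma inner_prod_diff_right:
  "inner_prod n f (\<lambda>w. g w - h w) = inner_prod n f g - inner_prod n f h"
  by (simp add: inner_prod_def right_diff_distrib sum_subtractf diff_divide_distrib)

lemma inner_prod_cong:
  assumes "\<And>w. w \<in> perms n \<Longrightarrow> f w = f' w" "\<And>w. w \<in> perms n \<Longrightarrow> g w = g' w"
  shows "inner_prod n f g = inner_prod n f' g'"
  using assms by (auto simp: inner_prod_def intro!: sum.cong arg_cong2 [where f = "(/)"])

lemma conv_cong:
  assumes "\<And>w. w \<in> perms n \<Longrightarrow> f w = f' w" "\<And>w. w \<in> perms n \<Longrightarrow> g w = g' w" "w \<in> perms n"
  shows "conv n f g w = conv n f' g' w"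
  using assms by (auto simp: conv_def perms_comp perms_inv intro!: sum.cong)

lemma conv_sum_right:
  "conv n f (\<lambda>w. \<Sum>i\<in>I. c i * F i w) w = (\<Sum>i\<in>I. c i * conv n f (F i) w)"
  unfolding conv_def sum_distrib_left by (subst sum.swap) (simp add: ac_simps)

lemma conv_sum_left:
  "conv n (\<lambda>w. \<Sum>i\<in>I. c i * F i w) g w = (\<Sum>i\<in>I. c i * conv n (F i) g w)"
  unfolding conv_def sum_distrib_left sum_distrib_right by (subst sum.swap) (simp add: ac_simps)

lemma conv_diff_left: "conv n (\<lambda>w. g w - h w) f w = conv n g f w - conv n h f w"
  by (simp add: conv_def left_diff_distrib sum_subtractf)

lemma conv_commute:
  assumes f: "class_fun n f" and w: "w \<in> perms n"
  shows "conv n f g w = conv n g f w"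
proof -
  have "conv n f g w = (\<Sum>u\<in>perms n. f (w \<circ> inv u) * g u)"
    unfolding conv_def
    by (rule sum.reindex_bij_witness [where i = "\<lambda>u. w \<circ> inv u" and j = "\<lambda>u. inv u \<circ> w"])
      (use w in \<open>auto simp: perms_inv perms_comp perms_inv_inv_comp perms_inv_comp_inv comp_assoc\<close>)
  also have "\<dots> = conv n g f w"
    unfolding conv_def using class_fun_comm [OF f w] by (intro sum.cong) (auto simp: perms_inv mult.commute)
  finally show ?thesis .
qed

lemma conv_assoc:
  assumes w: "w \<in> perms n"
  shows "conv n (conv n f g) h w = conv n f (conv n g h) w"
proof -
  have "conv n (conv n f g) h w = (\<Sum>u\<in>perms n. \<Sum>v\<in>perms n. f v * g (inv v \<circ> u) * h (inv u \<circ> w))"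
    by (simp add: conv_def sum_distrib_right)
  also have "\<dots> = (\<Sum>v\<in>perms n. \<Sum>u\<in>perms n. f v * g (inv v \<circ> u) * h (inv u \<circ> w))"
    by (rule sum.swap)
  also have "\<dots> = (\<Sum>v\<in>perms n. \<Sum>u\<in>perms n. f v * g u * h (inv u \<circ> (inv v \<circ> w)))"
  proof (rule sum.cong [OF refl])
    fix v assume v: "v \<in> perms n"
    show "(\<Sum>u\<in>perms n. f v * g (inv v \<circ> u) * h (inv u \<circ> w)) =
        (\<Sum>u\<in>perms n. f v * g u * h (inv u \<circ> (inv v \<circ> w)))"
      using v by (subst sum_perms_left [OF v, symmetric])
        (auto simp: perms_inv_distrib comp_assoc intro!: sum.cong)
  qed
  also have "\<dots> = conv n f (conv n g h) w"
    by (simp add: conv_def sum_distrib_left mult.assoc)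
  finally show ?thesis .
qed

lemma class_fun_conv:
  assumes f: "class_fun n f" and g: "class_fun n g"
  shows "class_fun n (conv n f g)"
  unfolding class_fun_def
proof (intro ballI)
  fix s w assume s: "s \<in> perms n" and w: "w \<in> perms n"
  have "conv n f g (conj_perm s w) = (\<Sum>u\<in>perms n. f (conj_perm s u) * g (inv (conj_perm s u) \<circ> conj_perm s w))"
    unfolding conv_def by (rule sum_perms_conj [OF s, symmetric])
  also have "\<dots> = (\<Sum>u\<in>perms n. f u * g (inv u \<circ> w))"
  proof (rule sum.cong [OF refl])
    fix u assume u: "u \<in> perms n"
    have "inv (conj_perm s u) \<circ> conj_perm s w = conj_perm s (inv u \<circ> w)"
      using s u w by (simp add: conj_perm_def perms_inv_distrib perms_comp perms_inv comp_assoc)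
    then show "f (conj_perm s u) * g (inv (conj_perm s u) \<circ> conj_perm s w) = f u * g (inv u \<circ> w)"
      using f g s u w by (simp add: class_fun_def perms_comp perms_inv)
  qed
  finally show "conv n f g (conj_perm s w) = conv n f g w" by (simp add: conv_def)
qed

section \<open>Permutation characters of Young subgroups\<close>

text \<open>As a set with an action of the symmetric group, these are the cosets of the Young
  subgroup whose block sizes are the multiplicities in \<open>m\<close>. The type of letters is left
  open so that a pair of words is again a word.\<close>

definition words :: "nat \<Rightarrow> 'a multiset \<Rightarrow> (nat \<Rightarrow> 'a) set" where
  "words n m = {c \<in> extensional {1..n}. image_mset c (mset_set {1..n}) = m}"

definition invariant :: "nat \<Rightarrow> (nat \<Rightarrow> nat) \<Rightarrow> (nat \<Rightarrow> 'a) \<Rightarrow> bool" where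
  "invariant n w c \<longleftrightarrow> (\<forall>x\<in>{1..n}. c (w x) = c x)"

text \<open>The character of the permutation representation on the words with letters \<open>m\<close>.\<close>

definition perm_char :: "nat \<Rightarrow> 'a multiset \<Rightarrow> (nat \<Rightarrow> nat) \<Rightarrow> rat" where
  "perm_char n m w = of_nat (card {c \<in> words n m. invariant n w c})"

lemma finite_words [simp]: "finite (words n m)"
proof (rule finite_subset)
  show "words n m \<subseteq> (\<Pi>\<^sub>E x\<in>{1..n}. set_mset m)"
    by (auto simp: words_def PiE_def simp del: atLeastAtMost_iff)
qed (simp add: finite_PiE)

lemma restrict_in_words: "image_mset h (mset_set {1..n}) = m \<Longrightarrow> restrict h {1..n} \<in> words n m"
  unfolding words_def using image_mset_cong [of "mset_set {1..n}" "restrict h {1..n}" h]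
  by (simp del: atLeastAtMost_iff restrict_apply) (simp cong: image_mset_cong)

lemma words_content: "c \<in> words n m \<Longrightarrow> image_mset c (mset_set {1..n}) = m"
  by (simp add: words_def)

lemma restrict_words: "c \<in> words n m \<Longrightarrow> restrict (h \<circ> c) {1..n} \<in> words n (image_mset h m)"
  by (rule restrict_in_words) (simp only: multiset.map_comp [symmetric] words_content)

lemma perms_mem: "s \<in> perms n \<Longrightarrow> s x \<in> {1..n} \<longleftrightarrow> x \<in> {1..n}"
  by (simp add: perms_def permutes_in_image del: atLeastAtMost_iff)

lemma invariant_restrict: "w \<in> perms n \<Longrightarrow> invariant n w (restrict c {1..n}) \<longleftrightarrow> invariant n w c"
  using perms_mem [of w n] by (auto simp: invariant_def simp del: atLeastAtMost_iff)

definition relabel :: "nat \<Rightarrow> (nat \<Rightarrow> nat) \<Rightarrow> (nat \<Rightarrow> 'a) \<Rightarrow> nat \<Rightarrow> 'a" where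
  "relabel n s c = restrict (c \<circ> s) {1..n}"

lemma relabel_words:
  assumes s: "s \<in> perms n" and c: "c \<in> words n m"
  shows "relabel n s c \<in> words n m"
proof -
  have "image_mset s (mset_set {1..n}) = mset_set {1..n}"
    using permsD [OF s] by (simp add: image_mset_mset_set permutes_inj_on permutes_image)
  then have "image_mset (c \<circ> s) (mset_set {1..n}) = m"
    using words_content [OF c] by (simp flip: multiset.map_comp)
  then show ?thesis unfolding relabel_def by (rule restrict_in_words)
qed

lemma relabel_relabel:
  assumes "s \<in> perms n"
  shows "relabel n s (relabel n t c) = relabel n (t \<circ> s) c"
  using perms_mem [OF assms] by (auto simp: relabel_def fun_eq_iff restrict_def)

lemma relabel_id: "c \<in> words n m \<Longrightarrow> relabel n id c = c"
  by (auto simp: relabel_def words_def extensional_restrict)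

lemma relabel_invariant:
  assumes "c \<in> words n m"
  shows "invariant n w c \<longleftrightarrow> relabel n w c = c"
  using assms by (auto simp: relabel_def invariant_def words_def fun_eq_iff restrict_def extensional_def)

lemma invariant_id: "invariant n id c"
  by (simp add: invariant_def)

lemma invariant_comp:
  assumes "v \<in> perms n" "invariant n u c" "invariant n v c"
  shows "invariant n (u \<circ> v) c"
  using assms perms_mem [OF assms(1)] by (simp add: invariant_def del: atLeastAtMost_iff)

lemma invariant_inv:
  assumes "u \<in> perms n"
  shows "invariant n (inv u) c \<longleftrightarrow> invariant n u c"
proof -
  have *: "invariant n (inv v) c" if v: "v \<in> perms n" and c: "invariant n v c" for v
    unfolding invariant_def
  proof
    fix x assume "x \<in> {1..n}"
    then have "inv v x \<in> {1..n}" using perms_mem [OF perms_inv [OF v]] by blast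
    then show "c (inv v x) = c x" using c v unfolding invariant_def by (metis perms_inv_comp(5))
  qed
  show ?thesis using * [OF assms] * [OF perms_inv [OF assms]] assms by auto
qed

lemma invariant_conj:
  assumes s: "s \<in> perms n" and w: "w \<in> perms n"
  shows "invariant n w (relabel n s c) \<longleftrightarrow> invariant n (conj_perm s w) c"
proof
  assume i: "invariant n w (relabel n s c)"
  show "invariant n (conj_perm s w) c"
    unfolding invariant_def
  proof
    fix x assume "x \<in> {1..n}"
    then have "inv s x \<in> {1..n}" using perms_mem [OF perms_inv [OF s]] by blast
    moreover from this have "w (inv s x) \<in> {1..n}" using perms_mem [OF w] by blast
    ultimately show "c (conj_perm s w x) = c x"
      using bspec [OF i [unfolded invariant_def], of "inv s x"] s by (simp add: relabel_def conj_perm_def)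
  qed
next
  assume i: "invariant n (conj_perm s w) c"
  show "invariant n w (relabel n s c)"
    unfolding invariant_def
  proof
    fix x assume x: "x \<in> {1..n}"
    then have "s x \<in> {1..n}" "w x \<in> {1..n}" using perms_mem s w by blast+
    then show "relabel n s c (w x) = relabel n s c x"
      using bspec [OF i [unfolded invariant_def], of "s x"] s x by (simp add: relabel_def conj_perm_def)
  qed
qed

lemma class_fun_perm_char: "class_fun n (perm_char n m)"
  unfolding class_fun_def
proof (intro ballI)
  fix s w assume s: "s \<in> perms n" and w: "w \<in> perms n"
  have e: "conj_perm (inv s) (conj_perm s w) = w" using s by (simp add: conj_perm_def comp_assoc)
  have "card {c \<in> words n m. invariant n (conj_perm s w) c} = card {c \<in> words n m. invariant n w c}"
    by (rule card_eq_by_inverse [where f = "relabel n s" and g = "relabel n (inv s)"])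
      (use s w e perms_inv [OF s] in \<open>auto simp: relabel_words relabel_relabel relabel_id invariant_conj conj_perm_in\<close>)
  then show "perm_char n m (conj_perm s w) = perm_char n m w" by (simp add: perm_char_def)
qed

lemma perm_char_inv: "w \<in> perms n \<Longrightarrow> perm_char n m (inv w) = perm_char n m w"
  by (simp add: perm_char_def invariant_inv)

lemma words_nonempty:
  assumes "size m = n"
  shows "words n m \<noteq> {}"
proof -
  obtain xs where xs: "mset xs = m" using ex_mset by blast
  then have len: "length xs = n" using assms by auto
  have "image_mset (\<lambda>i. xs ! (i - 1)) (mset_set {1..n}) =
      image_mset (\<lambda>i. xs ! (i - 1)) (image_mset Suc (mset_set {..<n}))"
    by (simp add: image_mset_mset_set image_Suc_lessThan)
  also have "\<dots> = mset (map ((!) xs) [0..<n])"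
    by (simp add: multiset.map_comp o_def atLeast0LessThan [symmetric] flip: mset_upt)
  also have "\<dots> = m" using len xs map_nth [of xs] by simp
  finally show ?thesis using restrict_in_words by blast
qed

lemma words_transitive:
  assumes "c \<in> words n m" "d \<in> words n m"
  shows "\<exists>s\<in>perms n. relabel n s c = d"
proof -
  have "image_mset d (mset_set {1..n}) = image_mset c (mset_set {1..n})"
    using assms by (simp add: words_def)
  from image_mset_eq_implies_permutes [OF finite_atLeastAtMost this]
  obtain s where s: "s permutes {1..n}" "\<forall>x\<in>{1..n}. d x = c (s x)" .
  then have "relabel n s c = d"
    using assms(2) by (auto simp: relabel_def words_def fun_eq_iff restrict_def extensional_def)
  then show ?thesis using s(1) by (auto simp: perms_def)
qed

text \<open>
  The words with letters \<open>m\<close> form one orbit of the symmetric group, so by Burnside's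
  lemma the average number of fixed words is 1.
\<close>

lemma sum_perm_char:
  assumes "size m = n"
  shows "(\<Sum>w\<in>perms n. perm_char n m w) = fact n"
proof -
  obtain c0 where c0: "c0 \<in> words n m" using words_nonempty [OF assms] by blast
  \<comment> \<open>The stabilizer of \<open>c\<close> is a left translate of the set of
    \<open>s\<close> that carry \<open>c0\<close> to \<open>c\<close>, and these sets partition the
    group.\<close>
  have stab: "card {w \<in> perms n. invariant n w c} = card {s \<in> perms n. relabel n s c0 = c}"
    if c: "c \<in> words n m" for c
  proof -
    obtain t where t: "t \<in> perms n" "relabel n t c0 = c" using words_transitive [OF c0 c] by blast
    have "{w \<in> perms n. invariant n w c} = {w \<in> perms n. relabel n (t \<circ> w) c0 = c}"
      using relabel_relabel [of _ n t c0] t(2) c by (auto simp: relabel_invariant)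
    then show ?thesis using card_perms_left [OF t(1)] by simp
  qed
  have fin: "finite (perms n)" by (rule finite_perms)
  have "(\<Sum>w\<in>perms n. card {c \<in> words n m. invariant n w c}) =
      (\<Sum>w\<in>perms n. \<Sum>c | c \<in> words n m \<and> invariant n w c. 1)"
    by simp
  also have "\<dots> = (\<Sum>c\<in>words n m. \<Sum>w | w \<in> perms n \<and> invariant n w c. 1)"
    by (rule sum.swap_restrict) (simp_all add: fin)
  also have "\<dots> = (\<Sum>c\<in>words n m. card {s \<in> perms n. relabel n s c0 = c})"
    using stab by simp
  also have "\<dots> = card (\<Union>c\<in>words n m. {s \<in> perms n. relabel n s c0 = c})"
    by (rule card_UN_disjoint [symmetric]) (auto simp: fin)
  also have "(\<Union>c\<in>words n m. {s \<in> perms n. relabel n s c0 = c}) = perms n"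
    using relabel_words [OF _ c0] by auto
  also have "card (perms n) = fact n" by (simp add: perms_def card_permutations)
  finally have "(\<Sum>w\<in>perms n. card {c \<in> words n m. invariant n w c}) = fact n" .
  then show ?thesis unfolding perm_char_def of_nat_sum [symmetric] by simp
qed

text \<open>A pair of words is a word in pairs of letters, whose content is a matrix with margins
  \<open>m\<close> and \<open>m'\<close>. The product of the two characters is therefore a sum of
  permutation characters over all such matrices, each of which has average 1.\<close>

lemma inner_prod_perm_char:
  assumes "size m = n"
  shows "inner_prod n (perm_char n m) (perm_char n m') = of_nat (card (matrices m m'))"
proof -
  let ?pair = "\<lambda>cd. restrict (\<lambda>x. (fst cd x, snd cd x)) {1..n}"
  let ?unpair = "\<lambda>e. (restrict (fst \<circ> e) {1..n}, restrict (snd \<circ> e) {1..n})"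
  have "card ({c \<in> words n m. invariant n w c} \<times> {d \<in> words n m'. invariant n w d}) =
      card (\<Union>Q\<in>matrices m m'. {e \<in> words n Q. invariant n w e})" (is "card ?A = card ?B")
    if w: "w \<in> perms n" for w
  proof (rule card_eq_by_inverse [where f = ?pair and g = ?unpair])
    fix cd assume cd: "cd \<in> ?A"
    then have "image_mset (\<lambda>x. (fst cd x, snd cd x)) (mset_set {1..n}) \<in> matrices m m'"
      using words_content [of "fst cd" n m] words_content [of "snd cd" n m']
      by (auto simp: matrices_def multiset.map_comp o_def)
    moreover have "invariant n w (?pair cd)"
      unfolding invariant_restrict [OF w] using cd by (auto simp: invariant_def)
    moreover have "?unpair (?pair cd) = cd"
      using cd by (auto simp: words_def extensional_def fun_eq_iff restrict_def)
    ultimately show "?pair cd \<in> ?B \<and> ?unpair (?pair cd) = cd"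
      using restrict_in_words [OF refl] by blast
  next
    fix e assume "e \<in> ?B"
    then obtain Q where Q: "image_mset fst Q = m" "image_mset snd Q = m'" and e: "e \<in> words n Q" "invariant n w e"
      by (auto simp: matrices_def)
    have "invariant n w (fst \<circ> e)" "invariant n w (snd \<circ> e)" using e(2) by (simp_all add: invariant_def)
    then have "?unpair e \<in> ?A"
      using restrict_words [OF e(1), of fst] restrict_words [OF e(1), of snd]
        invariant_restrict [OF w, of "fst \<circ> e"] invariant_restrict [OF w, of "snd \<circ> e"]
      unfolding Q by blast
    moreover have "?pair (?unpair e) = e"
      using e(1) by (auto simp: words_def extensional_def fun_eq_iff restrict_def)
    ultimately show "?unpair e \<in> ?A \<and> ?pair (?unpair e) = e" ..
  qed
  moreover have "card (\<Union>Q\<in>matrices m m'. {e \<in> words n Q. invariant n w e}) =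
      (\<Sum>Q\<in>matrices m m'. card {e \<in> words n Q. invariant n w e})" for w
  proof (rule card_UN_disjoint)
    show "\<forall>i\<in>matrices m m'. \<forall>j\<in>matrices m m'. i \<noteq> j \<longrightarrow>
        {e \<in> words n i. invariant n w e} \<inter> {e \<in> words n j. invariant n w e} = {}"
      by (auto simp: words_def)
  qed (simp_all add: finite_matrices)
  ultimately have *: "perm_char n m w * perm_char n m' w = (\<Sum>Q\<in>matrices m m'. perm_char n Q w)"
    if "w \<in> perms n" for w
    unfolding perm_char_def of_nat_sum [symmetric] of_nat_mult [symmetric]
    using that by (simp add: card_cartesian_product)
  have "(\<Sum>w\<in>perms n. perm_char n m w * perm_char n m' w) =
      (\<Sum>Q\<in>matrices m m'. \<Sum>w\<in>perms n. perm_char n Q w)"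
    by (subst sum.swap) (simp add: *)
  also have "\<dots> = (\<Sum>Q\<in>matrices m m'. fact n)"
    using assms by (intro sum.cong refl sum_perm_char) (auto simp: matrices_def)
  finally show ?thesis by (simp add: inner_prod_def)
qed

section \<open>Cycle types\<close>

lemma perms_permutation: "w \<in> perms n \<Longrightarrow> permutation w"
  by (auto simp: perms_def permutation_permutes)

lemma self_in_orbit: "w \<in> perms n \<Longrightarrow> x \<in> orbit w x"
  by (rule permutation_self_in_orbit [OF perms_permutation])

lemma orbit_eq:
  assumes "w \<in> perms n" "y \<in> orbit w x"
  shows "orbit w y = orbit w x"
  using orbit_cyclic_eq3 [OF cyclic_on_orbit' [OF perms_permutation [OF assms(1)]] assms(2)] .

lemma finite_perms_orbit: "w \<in> perms n \<Longrightarrow> finite (orbit w x)"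
  by (rule finite_orbit [OF self_in_orbit])

lemma orbit_class:
  assumes "w \<in> perms n" "A \<in> orbit w ` {1..n}"
  shows "{x \<in> {1..n}. orbit w x = A} = A"
proof -
  obtain y where y: "y \<in> {1..n}" "A = orbit w y" using assms(2) by blast
  have "A \<subseteq> {1..n}" using permutes_orbit_subset [OF permsD [OF assms(1)] y(1)] y(2) by simp
  then show ?thesis using self_in_orbit [OF assms(1)] orbit_eq [OF assms(1)] y(2) by blast
qed

section \<open>Coefficients of products of power sums\<close>

lemma image_mset_mset_set_sum: "finite A \<Longrightarrow> image_mset f (mset_set A) = (\<Sum>x\<in>A. {#f x#})"
  by (induction A rule: finite_induct) auto

lemma sum_const_mset: "finite A \<Longrightarrow> (\<Sum>x\<in>A. {#y#}) = replicate_mset (card A) y"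
  by (induction A rule: finite_induct) auto

text \<open>Each factor contributes the variable \<open>g s\<close> to a term of the expanded
  product. Positivity of \<open>k s\<close> is what lets the power determine its variable.\<close>

lemma mcoeff_prod_power_sum:
  assumes "finite S" "\<And>s. s \<in> S \<Longrightarrow> k s > 0"
  shows "mcoeff (\<Prod>s\<in>S. power_sum (k s)) m =
    of_nat (card {g \<in> extensional S. (\<Sum>s\<in>S. replicate_mset (k s) (g s)) = m})"
  using assms
proof (induction S arbitrary: m rule: finite_induct)
  case empty
  have "{g \<in> extensional {}. {#} = m} = (if m = {#} then {\<lambda>_. undefined :: nat} else {})" by auto
  then show ?case by (simp add: one_mfps_def)
next
  case (insert s S)
  let ?G = "\<lambda>S m. {g \<in> extensional S. (\<Sum>s\<in>S. replicate_mset (k s) (g s)) = (m :: nat multiset)}"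
  let ?P = "{p \<in> splits m. \<exists>i. fst p = replicate_mset (k s) i}"
  have ks: "k s > 0" using insert.prems by simp
  have inj: "replicate_mset (k s) i = replicate_mset (k s) j \<longleftrightarrow> i = j" for i j :: nat
    using ks by (auto simp: replicate_mset_eq_iff)
  have sum_eq: "(\<Sum>s\<in>S. replicate_mset (k s) (g s)) = (\<Sum>s\<in>S. replicate_mset (k s) (g' s))"
    if "\<And>t. t \<in> S \<Longrightarrow> g t = g' t" for g g' :: "_ \<Rightarrow> nat"
    using that by (intro sum.cong) auto
  have finP: "finite ?P" by (rule finite_subset [of _ "splits m"]) auto
  have finG: "finite (?G S b)" for b
  proof (rule finite_subset)
    show "?G S b \<subseteq> (\<Pi>\<^sub>E s\<in>S. set_mset b)"
    proof
      fix g assume g: "g \<in> ?G S b"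
      have "g t \<in># b" if t: "t \<in> S" for t
      proof -
        have "replicate_mset (k t) (g t) \<subseteq># (\<Sum>s\<in>S. replicate_mset (k s) (g s))"
          unfolding sum.remove [OF insert.hyps(1) t] by (rule mset_subset_eq_add_left)
        then have "replicate_mset (k t) (g t) \<subseteq># b" using g by simp
        moreover have "g t \<in># replicate_mset (k t) (g t)" using insert.prems t by simp
        ultimately show ?thesis by (rule mset_subset_eqD)
      qed
      then show "g \<in> (\<Pi>\<^sub>E s\<in>S. set_mset b)" using g by (auto simp: PiE_def)
    qed
  qed (use insert.hyps in \<open>simp add: finite_PiE\<close>)
  let ?f = "\<lambda>g. ((replicate_mset (k s) (g s), \<Sum>s\<in>S. replicate_mset (k s) (g s)), restrict g S)"
  let ?f' = "\<lambda>(p :: nat multiset \<times> nat multiset, g). g(s := SOME i. fst p = replicate_mset (k s) i)"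
  have f': "?f' ((replicate_mset (k s) i, b), g) = g(s := i)" for i :: nat and b :: "nat multiset" and g
    by (simp add: inj)
  have "mcoeff (\<Prod>s\<in>insert s S. power_sum (k s)) m =
      (\<Sum>p\<in>splits m. mcoeff (power_sum (k s)) (fst p) * mcoeff (\<Prod>s\<in>S. power_sum (k s)) (snd p))"
    using insert.hyps by (simp add: times_mfps_def case_prod_unfold)
  also have "\<dots> = (\<Sum>p\<in>splits m. if \<exists>i. fst p = replicate_mset (k s) i then of_nat (card (?G S (snd p))) else 0)"
    using insert.IH insert.prems by (intro sum.cong) (auto simp: power_sum_def)
  also have "\<dots> = (\<Sum>p\<in>?P. of_nat (card (?G S (snd p))))"
    by (simp add: sum.inter_filter)
  also have "\<dots> = of_nat (card (SIGMA p:?P. ?G S (snd p)))"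
    by (simp only: card_SigmaI [OF finP ballI [OF finG]] of_nat_sum)
  also have "card (SIGMA p:?P. ?G S (snd p)) = card (?G (insert s S) m)"
  proof (rule card_eq_by_inverse [where f = ?f and g = ?f', symmetric])
    fix g assume g: "g \<in> ?G (insert s S) m"
    have "(\<Sum>t\<in>S. replicate_mset (k t) (restrict g S t)) = (\<Sum>t\<in>S. replicate_mset (k t) (g t))"
      by (rule sum_eq) simp
    then have "?f g \<in> (SIGMA p:?P. ?G S (snd p))" using g insert.hyps by (simp add: splits_def) blast
    moreover have "?f' (?f g) = g"
    proof
      fix t show "?f' (?f g) t = g t" using g unfolding f' by (auto simp: extensional_def)
    qed
    ultimately show "?f g \<in> (SIGMA p:?P. ?G S (snd p)) \<and> ?f' (?f g) = g" ..
  next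
    fix pg assume a: "pg \<in> (SIGMA p:?P. ?G S (snd p))"
    then obtain i b g where pg: "pg = ((replicate_mset (k s) i, b), g)" "g \<in> ?G S b" by auto
    have "(\<Sum>t\<in>S. replicate_mset (k t) ((g(s := i)) t)) = (\<Sum>t\<in>S. replicate_mset (k t) (g t))"
      using insert.hyps by (intro sum_eq) auto
    moreover have "restrict (g(s := i)) S = g"
      using pg(2) insert.hyps by (auto simp: fun_eq_iff extensional_def)
    ultimately show "?f' pg \<in> ?G (insert s S) m \<and> ?f (?f' pg) = pg"
      unfolding pg(1) f' using pg a insert.hyps by (auto simp: splits_def extensional_def)
  qed
  finally show ?case .
qed

text \<open>A word fixed by \<open>w\<close> is a choice of one letter for each cycle, and so is a
  term of the product of the power sums. This carries statements about class functions over to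
  symmetric functions.\<close>

lemma mcoeff_power_sum_cycle_type:
  assumes w: "w \<in> perms n"
  shows "mcoeff (power_sum_sym (cycle_type n w)) m = perm_char n m w"
proof -
  let ?O = "orbit w ` {1..n}"
  let ?G = "{g \<in> extensional ?O. (\<Sum>A\<in>?O. replicate_mset (card A) (g A)) = m}"
  let ?W = "{c \<in> words n m. invariant n w c}"
  have "power_sum_sym (cycle_type n w) =
      prod_mset (mset (map power_sum (rev (sorted_list_of_multiset (image_mset card (mset_set ?O))))))"
    unfolding power_sum_sym_def cycle_type_def by (simp only: prod_mset_prod_list)
  also have "\<dots> = (\<Prod>A\<in>?O. power_sum (card A))"
    by (simp add: prod_unfold_prod_mset multiset.map_comp o_def)
  finally have 1: "power_sum_sym (cycle_type n w) = (\<Prod>A\<in>?O. power_sum (card A))" .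
  have pos: "card A > 0" if "A \<in> ?O" for A
    using that finite_perms_orbit [OF w] by (auto simp: card_gt_0_iff orbit_nonempty)
  have content: "image_mset (\<lambda>x. g (orbit w x)) (mset_set {1..n}) = (\<Sum>A\<in>?O. replicate_mset (card A) (g A))"
    for g :: "nat set \<Rightarrow> nat"
  proof -
    have "image_mset (\<lambda>x. g (orbit w x)) (mset_set {1..n}) = (\<Sum>x\<in>{1..n}. {#g (orbit w x)#})"
      by (rule image_mset_mset_set_sum) simp
    also have "\<dots> = (\<Sum>A\<in>?O. \<Sum>x\<in>{x \<in> {1..n}. orbit w x = A}. {#g (orbit w x)#})"
      by (rule sum.group [symmetric]) auto
    also have "\<dots> = (\<Sum>A\<in>?O. \<Sum>x\<in>{x \<in> {1..n}. orbit w x = A}. {#g A#})"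
      by (intro sum.cong) auto
    also have "\<dots> = (\<Sum>A\<in>?O. \<Sum>x\<in>A. {#g A#})"
      by (intro sum.cong refl orbit_class [OF w])
    also have "\<dots> = (\<Sum>A\<in>?O. replicate_mset (card A) (g A))"
      using finite_perms_orbit [OF w] by (intro sum.cong refl sum_const_mset) auto
    finally show ?thesis .
  qed
  have const: "c y = c x" if c: "invariant n w c" and x: "x \<in> {1..n}" and y: "y \<in> orbit w x" for c :: "nat \<Rightarrow> nat" and x y
    using y
  proof induction
    case base
    then show ?case using c x by (simp add: invariant_def)
  next
    case (step y)
    then have "y \<in> {1..n}" using permutes_orbit_subset [OF permsD [OF w] x] by blast
    then show ?case using c step by (simp add: invariant_def)
  qed
  let ?f = "\<lambda>g. restrict (\<lambda>x. g (orbit w x)) {1..n}"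
  let ?f' = "\<lambda>c. restrict (\<lambda>A. c (SOME x. x \<in> A)) ?O"
  have some: "(SOME y. y \<in> orbit w x) \<in> orbit w x" for x
    by (rule someI_ex) (use self_in_orbit [OF w] in blast)
  have cancel: "?f (?f' c) = c" if c: "c \<in> ?W" for c
  proof
    fix x show "?f (?f' c) x = c x"
    proof (cases "x \<in> {1..n}")
      case True
      then have "?f (?f' c) x = c (SOME y. y \<in> orbit w x)" by simp
      then show ?thesis using const [of c x] c True some by simp
    next
      case False
      then show ?thesis using c by (auto simp: words_def extensional_def)
    qed
  qed
  have "card ?G = card ?W"
  proof (rule card_eq_by_inverse [where f = ?f and g = ?f'])
    fix g assume g: "g \<in> ?G"
    then have "image_mset (\<lambda>x. g (orbit w x)) (mset_set {1..n}) = m" unfolding content by simp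
    then have "?f g \<in> words n m" by (rule restrict_in_words)
    moreover have "invariant n w (?f g)"
      unfolding invariant_restrict [OF w] unfolding invariant_def
      using permutation_orbit_step [OF perms_permutation [OF w]] by simp
    moreover have "?f' (?f g) = g"
    proof
      fix A show "?f' (?f g) A = g A"
      proof (cases "A \<in> ?O")
        case True
        then obtain x where x: "x \<in> {1..n}" "A = orbit w x" by blast
        let ?y = "SOME y. y \<in> A"
        have y: "?y \<in> orbit w x" using some x(2) by simp
        then have "?y \<in> {1..n}" using permutes_orbit_subset [OF permsD [OF w] x(1)] by blast
        then have "?f' (?f g) A = g (orbit w ?y)" using True by simp
        then show ?thesis using orbit_eq [OF w y] x(2) by simp
      next
        case False
        then show ?thesis using g by (auto simp: extensional_def)
      qed
    qed
    ultimately show "?f g \<in> ?W \<and> ?f' (?f g) = g" by simp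
  next
    fix c assume c: "c \<in> ?W"
    have "(\<Sum>A\<in>?O. replicate_mset (card A) (?f' c A)) = image_mset (?f (?f' c)) (mset_set {1..n})"
      unfolding content [symmetric] by (rule image_mset_cong) simp
    also have "\<dots> = m" using cancel [OF c] c by (simp only: words_def mem_Collect_eq)
    finally show "?f' c \<in> ?G \<and> ?f (?f' c) = c" using restrict_extensional cancel [OF c] by blast
  qed
  moreover have "mcoeff (power_sum_sym (cycle_type n w)) m = of_nat (card ?G)"
    unfolding 1 by (rule mcoeff_prod_power_sum) (use pos in auto)
  ultimately show ?thesis by (simp add: perm_char_def)
qed

section \<open>Cycle types and conjugacy\<close>

lemma image_mset_eq_imp_bij_betw:
  assumes "finite A" "finite B" "image_mset f (mset_set A) = image_mset g (mset_set B)"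
  shows "\<exists>h. bij_betw h A B \<and> (\<forall>a\<in>A. g (h a) = f a)"
  using assms
proof (induction A arbitrary: B rule: finite_induct)
  case empty
  then have "B = {}" by (simp add: mset_set_empty_iff)
  then show ?case by (simp add: bij_betw_def)
next
  case (insert a A)
  have "f a \<in># image_mset g (mset_set B)"
    using insert.prems(2) insert.hyps by (metis image_mset_add_mset mset_set.insert union_single_eq_member)
  then obtain b where b: "b \<in> B" "g b = f a" using insert.prems(1) by auto
  have "mset_set B = add_mset b (mset_set (B - {b}))"
    using b(1) insert.prems(1) by (simp add: mset_set.remove)
  then have "image_mset f (mset_set A) = image_mset g (mset_set (B - {b}))"
    using insert.prems(2) insert.hyps b(2) by simp
  then obtain h where h: "bij_betw h A (B - {b})" "\<forall>a\<in>A. g (h a) = f a"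
    using insert.IH [of "B - {b}"] insert.prems(1) by auto
  have "bij_betw (h(a := b)) A (B - {b})"
    using h(1) insert.hyps(2) by (subst bij_betw_cong [of A _ h]) auto
  then have "bij_betw (h(a := b)) (insert a A) (insert b (B - {b}))"
    using insert.hyps(2) by (auto simp: bij_betw_def)
  then have "bij_betw (h(a := b)) (insert a A) B" using b(1) by (simp add: insert_absorb)
  moreover have "g ((h(a := b)) x) = f x" if "x \<in> insert a A" for x
    using h(2) b(2) that by auto
  ultimately show ?case by blast
qed

lemma funpow_orbit_eq_iff:
  assumes w: "w \<in> perms n"
  shows "(w ^^ i) x = (w ^^ j) x \<longleftrightarrow> i mod card (orbit w x) = j mod card (orbit w x)"
proof -
  let ?p = "funpow_dist1 w x x"
  have x: "x \<in> orbit w x" by (rule self_in_orbit [OF w])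
  have inj: "inj_on (\<lambda>n. (w ^^ n) x) {0..<?p}" by (rule inj_on_funpow_dist1 [OF x])
  have "card (orbit w x) = ?p"
    using card_image [OF inj] orbit_conv_funpow_dist1 [OF x] by simp
  moreover have "(w ^^ k) x = (w ^^ (k mod ?p)) x" for k
    using funpow_mod_eq [OF funpow_dist1_prop [OF x], of k] by simp
  moreover have "(w ^^ (i mod ?p)) x = (w ^^ (j mod ?p)) x \<longleftrightarrow> i mod ?p = j mod ?p"
    using inj_on_eq_iff [OF inj, of "i mod ?p" "j mod ?p"] by simp
  ultimately show ?thesis by metis
qed

text \<open>Cycles of equal length are matched by \<open>h\<close> and given base points by
  \<open>r\<close>; the conjugating permutation maps the \<open>k\<close>-th point after a base
  point of \<open>u\<close> to the \<open>k\<close>-th point after the matching base point of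
  \<open>v\<close>. This bounds the number of conjugacy classes by the number of partitions.\<close>

lemma cycle_type_eq_imp_conj:
  assumes u: "u \<in> perms n" and v: "v \<in> perms n" and eq: "cycle_type n u = cycle_type n v"
  shows "\<exists>s\<in>perms n. conj_perm s u = v"
proof -
  let ?U = "orbit u ` {1..n}" and ?V = "orbit v ` {1..n}"
  have "image_mset card (mset_set ?U) = image_mset card (mset_set ?V)"
    using arg_cong [OF eq, of "\<lambda>xs. mset (rev xs)"] by (simp add: cycle_type_def)
  then obtain h where h: "bij_betw h ?U ?V" "\<And>A. A \<in> ?U \<Longrightarrow> card (h A) = card A"
    using image_mset_eq_imp_bij_betw [of ?U ?V card card] by auto
  define r where "r A = (SOME x. x \<in> A)" for A :: "nat set"
  have rin: "r (orbit w x) \<in> orbit w x" if "w \<in> perms n" for w x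
    unfolding r_def by (rule someI_ex) (use self_in_orbit [OF that] in blast)
  have rorb: "orbit w (r A) = A" "r A \<in> A" if "w \<in> perms n" "A \<in> orbit w ` {1..n}" for w A
    using that orbit_eq [OF that(1)] rin [OF that(1)] by auto
  have sub: "A \<subseteq> {1..n}" if "w \<in> perms n" "A \<in> orbit w ` {1..n}" for w A
    using orbit_class [OF that] by blast
  have reach: "\<exists>k. (w ^^ k) (r (orbit w x)) = x" if "w \<in> perms n" "x \<in> {1..n}" for w x
  proof -
    have "x \<in> orbit w (r (orbit w x))"
      using self_in_orbit [OF that(1), of x] rorb(1) [OF that(1), of "orbit w x"] that(2) by simp
    then obtain k where "x = (w ^^ k) (r (orbit w x))"
      using orbit_altdef [of w "r (orbit w x)"] by auto
    then show ?thesis by (intro exI [of _ k]) simp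
  qed
  define s where "s x = (if x \<in> {1..n}
    then (v ^^ (SOME k. (u ^^ k) (r (orbit u x)) = x)) (r (h (orbit u x))) else x)" for x
  have hV: "h A \<in> ?V" if "A \<in> ?U" for A using h(1) that by (auto simp: bij_betw_def)
  \<comment> \<open>The exponent chosen in the definition of \<open>s\<close> is determined only
    modulo the length of the cycle, which \<open>h\<close> preserves.\<close>
  have s_eq: "s ((u ^^ k) (r A)) = (v ^^ k) (r (h A))" if A: "A \<in> ?U" for k A
  proof -
    let ?x = "(u ^^ k) (r A)"
    have xA: "?x \<in> A" using rorb [OF u A] funpow_in_orbit [of "r A" u "r A" k] by simp
    then have x: "?x \<in> {1..n}" using sub [OF u A] by blast
    have oA: "orbit u ?x = A" using orbit_eq [OF u, of ?x "r A"] xA rorb [OF u A] by simp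
    let ?l = "SOME l. (u ^^ l) (r A) = ?x"
    have "(u ^^ ?l) (r A) = ?x" by (rule someI [of _ k]) simp
    then have "?l mod card A = k mod card A"
      using funpow_orbit_eq_iff [OF u] rorb [OF u A] by simp
    then have "(v ^^ ?l) (r (h A)) = (v ^^ k) (r (h A))"
      using funpow_orbit_eq_iff [OF v] rorb [OF v hV [OF A]] h(2) [OF A] by simp
    then show ?thesis using x oA by (simp add: s_def)
  qed
  have su: "s (u x) = v (s x)" if x: "x \<in> {1..n}" for x
  proof -
    obtain k where k: "(u ^^ k) (r (orbit u x)) = x" using reach [OF u x] by blast
    have A: "orbit u x \<in> ?U" using x by blast
    have "s (u x) = (v ^^ Suc k) (r (h (orbit u x)))"
      using s_eq [OF A, of "Suc k"] k by simp
    also have "\<dots> = v (s x)" using s_eq [OF A, of k] k by simp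
    finally show ?thesis .
  qed
  have "s ` {1..n} = {1..n}"
  proof (intro equalityI subsetI)
    fix y assume "y \<in> s ` {1..n}"
    then obtain x where x: "x \<in> {1..n}" "y = s x" by blast
    obtain k where k: "(u ^^ k) (r (orbit u x)) = x" using reach [OF u x(1)] by blast
    have A: "orbit u x \<in> ?U" using x by blast
    have "y = (v ^^ k) (r (h (orbit u x)))" using s_eq [OF A, of k] k x(2) by simp
    then have "y \<in> h (orbit u x)"
      using rorb [OF v hV [OF A]] funpow_in_orbit [of "r (h (orbit u x))" v "r (h (orbit u x))" k] by simp
    then show "y \<in> {1..n}" using sub [OF v hV [OF A]] by blast
  next
    fix y assume y: "y \<in> {1..n}"
    obtain k where k: "(v ^^ k) (r (orbit v y)) = y" using reach [OF v y] by blast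
    have "orbit v y \<in> h ` ?U" using h(1) y unfolding bij_betw_def by blast
    then obtain A where A: "A \<in> ?U" "h A = orbit v y" by blast
    have "s ((u ^^ k) (r A)) = y" using s_eq [OF A(1), of k] A(2) k by simp
    moreover have "(u ^^ k) (r A) \<in> {1..n}"
      using rorb [OF u A(1)] funpow_in_orbit [of "r A" u "r A" k] sub [OF u A(1)] by auto
    ultimately show "y \<in> s ` {1..n}" by blast
  qed
  then have "bij_betw s {1..n} {1..n}"
    using eq_card_imp_inj_on [of "{1..n}" s] by (auto simp: bij_betw_def)
  then have s: "s \<in> perms n"
    unfolding perms_def by (simp add: bij_imp_permutes s_def del: atLeastAtMost_iff)
  have "s \<circ> u = v \<circ> s"
  proof
    fix x show "(s \<circ> u) x = (v \<circ> s) x"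
    proof (cases "x \<in> {1..n}")
      case False
      then show ?thesis
        using permutes_not_in [OF permsD [OF u]] permutes_not_in [OF permsD [OF v]]
          permutes_not_in [OF permsD [OF s]] by simp
    qed (simp add: su)
  qed
  then have "conj_perm s u = v" using s by (simp add: conj_perm_def comp_assoc)
  then show ?thesis using s by blast
qed

section \<open>Partitions as shapes\<close>

definition rows :: "nat list \<Rightarrow> nat \<Rightarrow> nat" where
  "rows la i = (if i < length la then la ! i else 0)"

lemma young_diagram_rows: "young_diagram la = diagram (rows la)"
  by (auto simp: young_diagram_def diagram_def rows_def split: if_splits)

lemma bij_betw_rows: "bij_betw rows (partitions n) (shapes n)"
  unfolding bij_betw_def
proof
  show "inj_on rows (partitions n)"
  proof (rule inj_onI)
    fix la lb assume la: "la \<in> partitions n" and lb: "lb \<in> partitions n" and eq: "rows la = rows lb"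
    \<comment> \<open>As no part is 0, the length of the list can be recovered from the padded
      function.\<close>
    have len: "length l = card {i. rows l i \<noteq> 0}" if "l \<in> partitions n" for l
    proof -
      have "rows l i \<noteq> 0" if "i < length l" for i
      proof -
        have "0 \<notin> set l" using \<open>l \<in> partitions n\<close> by (simp add: partitions_def)
        then have "l ! i \<noteq> 0" using nth_mem [OF that] by metis
        then show ?thesis using that by (simp add: rows_def)
      qed
      then have "{i. rows l i \<noteq> 0} = {..<length l}" by (auto simp: rows_def split: if_splits)
      then show ?thesis by simp
    qed
    have "length la = length lb"
      unfolding len [OF la] len [OF lb] eq ..
    moreover have "la ! i = lb ! i" if "i < length la" for i
      using fun_cong [OF eq, of i] that calculation by (simp add: rows_def)
    ultimately show "la = lb" by (rule nth_equalityI)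
  qed
  show "rows ` partitions n = shapes n"
  proof (intro equalityI subsetI)
    fix f assume "f \<in> rows ` partitions n"
    then obtain la where la: "la \<in> partitions n" "f = rows la" by blast
    show "f \<in> shapes n"
    proof (rule shapesI [where N = "length la"])
      show "antimono f"
        unfolding antimono_iff_le_Suc la(2) rows_def using la(1)
        by (auto simp: partitions_def sorted_wrt_iff_nth_less)
      show "(\<Sum>i<length la. f i) = n"
        using la by (simp add: rows_def partitions_def sum_list_sum_nth atLeast0LessThan)
    qed (simp add: la rows_def)
  next
    fix f assume f: "f \<in> shapes n"
    define k where "k = card {i. f i \<noteq> 0}"
    have z: "f n = 0" using shapesD(2) [OF f] by simp
    have pos: "f i \<noteq> 0 \<longleftrightarrow> i < k" for i
      unfolding k_def
    proof (rule initial_segment [where n = n])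
      show "f i \<noteq> 0" if "f j \<noteq> 0" "i < j" for i j
        using that antimonoD [OF shapesD(1) [OF f], of i j] by simp
    qed (simp add: z)
    then have k0: "f i = 0" if "k \<le> i" for i using that not_less by blast
    have "k \<le> n" using pos z not_less by blast
    define la where "la = map f [0..<k]"
    have "rows la = f" using k0 by (auto simp: rows_def la_def fun_eq_iff)
    moreover have "la \<in> partitions n"
    proof -
      have "(\<Sum>i<n. f i) = (\<Sum>i<k. f i)" by (rule sum_support_nat) (use k0 \<open>k \<le> n\<close> in auto)
      then have "sum_list la = n"
        using shapesD(3) [OF f order.refl] by (simp add: la_def sum_list_sum_nth atLeast0LessThan)
      moreover have "sorted_wrt (\<ge>) la"
        using antimonoD [OF shapesD(1) [OF f]] by (auto simp: sorted_wrt_iff_nth_less la_def)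
      moreover have "f i \<noteq> 0" if "i < k" for i using pos that by blast
      then have "0 \<notin> set la" by (force simp: la_def)
      ultimately show ?thesis by (simp add: partitions_def)
    qed
    ultimately show "f \<in> rows ` partitions n" by blast
  qed
qed

section \<open>Irreducible characters\<close>

text \<open>
  Young's rule, the decomposition of \<open>perm_char n (row_content f)\<close> with multiplicities
  given by Kostka numbers, is turned into a recursive definition of the characters.
\<close>

function chi :: "nat \<Rightarrow> (nat \<Rightarrow> nat) \<Rightarrow> (nat \<Rightarrow> nat) \<Rightarrow> rat" where
  "chi n f w = perm_char n (row_content f) w -
     (\<Sum>g | g \<in> shapes n \<and> f \<in> shapes n \<and> dominated f g \<and> g \<noteq> f.
       of_nat (kostka g (row_content f)) * chi n g w)"
  by pat_completeness auto

text \<open>The measure for the recursion of \<open>chi\<close>: going up in dominance loses at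
  least \<open>f\<close> itself. This needs \<open>f\<close> to be a shape, which is why the
  recursion carries that condition in its range of summation.\<close>

lemma card_dominating_less:
  assumes "f \<in> shapes n" "dominated f g" "g \<noteq> f"
  shows "card {h \<in> shapes n. dominated g h} < card {h \<in> shapes n. dominated f h}"
proof (rule psubset_card_mono)
  have "f \<in> {h \<in> shapes n. dominated f h}" "f \<notin> {h \<in> shapes n. dominated g h}"
    using assms dominated_antisym by (auto simp: dominated_refl)
  then show "{h \<in> shapes n. dominated g h} \<subset> {h \<in> shapes n. dominated f h}"
    using assms(2) dominated_trans by blast
qed (simp add: finite_shapes)

termination
  by (relation "Wellfounded.measure (\<lambda>(n, f, w). card {h \<in> shapes n. dominated f h})")
    (auto intro: card_dominating_less)

declare chi.simps [simp del]

lemma shapes_induct_up [consumes 1, case_names step]: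
  assumes "f \<in> shapes n"
    and step: "\<And>f. f \<in> shapes n \<Longrightarrow> (\<And>g. g \<in> shapes n \<Longrightarrow> dominated f g \<Longrightarrow> g \<noteq> f \<Longrightarrow> P g) \<Longrightarrow> P f"
  shows "P f"
  using assms(1)
proof (induction "card {h \<in> shapes n. dominated f h}" arbitrary: f rule: less_induct)
  case less
  show ?case
  proof (rule step)
    fix g assume "g \<in> shapes n" "dominated f g" "g \<noteq> f"
    then show "P g" using less.hyps card_dominating_less less.prems by simp
  qed (rule less.prems)
qed

lemma shapes_induct_down [consumes 1, case_names step]:
  assumes "f \<in> shapes n"
    and step: "\<And>f. f \<in> shapes n \<Longrightarrow> (\<And>g. g \<in> shapes n \<Longrightarrow> dominated g f \<Longrightarrow> g \<noteq> f \<Longrightarrow> P g) \<Longrightarrow> P f"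
  shows "P f"
  using assms(1)
proof (induction "card {h \<in> shapes n. dominated h f}" arbitrary: f rule: less_induct)
  case less
  have "card {h \<in> shapes n. dominated h g} < card {h \<in> shapes n. dominated h f}"
    if g: "dominated g f" "g \<noteq> f" for g
  proof (rule psubset_card_mono)
    have "f \<in> {h \<in> shapes n. dominated h f}" "f \<notin> {h \<in> shapes n. dominated h g}"
      using less.prems g dominated_antisym by (auto simp: dominated_refl)
    then show "{h \<in> shapes n. dominated h g} \<subset> {h \<in> shapes n. dominated h f}"
      using g(1) dominated_trans by blast
  qed (simp add: finite_shapes)
  then show ?case using less.hyps by (intro step [OF less.prems]) simp
qed

text \<open>The Kostka matrix is unitriangular for dominance. This recombines the tail that is
  subtracted in the recursion of \<open>chi\<close> with its leading term into a sum over all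
  shapes.\<close>

lemma sum_shapes_split:
  fixes F :: "(nat \<Rightarrow> nat) \<Rightarrow> rat"
  assumes f: "f \<in> shapes n"
  shows "(\<Sum>g\<in>shapes n. of_nat (kostka g (row_content f)) * F g) =
    F f + (\<Sum>g | g \<in> shapes n \<and> dominated f g \<and> g \<noteq> f. of_nat (kostka g (row_content f)) * F g)"
proof -
  have "(\<Sum>g\<in>shapes n. of_nat (kostka g (row_content f)) * F g) =
      of_nat (kostka f (row_content f)) * F f + (\<Sum>g\<in>shapes n - {f}. of_nat (kostka g (row_content f)) * F g)"
    using f by (simp add: sum.remove [OF finite_shapes])
  also have "(\<Sum>g\<in>shapes n - {f}. of_nat (kostka g (row_content f)) * F g) =
      (\<Sum>g | g \<in> shapes n \<and> dominated f g \<and> g \<noteq> f. of_nat (kostka g (row_content f)) * F g)"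
    using kostka_dominated [OF f] by (intro sum.mono_neutral_right) (auto simp: finite_shapes)
  finally show ?thesis by (simp add: kostka_row_content [OF f])
qed

lemma chi_eq:
  assumes f: "f \<in> shapes n"
  shows "chi n f = (\<lambda>w. perm_char n (row_content f) w -
    (\<Sum>g | g \<in> shapes n \<and> dominated f g \<and> g \<noteq> f. of_nat (kostka g (row_content f)) * chi n g w))"
  using f by (intro ext, subst chi.simps) simp

lemma class_fun_chi: "f \<in> shapes n \<Longrightarrow> class_fun n (chi n f)"
proof (induction f rule: shapes_induct_up)
  case (step f)
  then show ?case
    by (subst chi_eq [OF step.hyps])
      (intro class_fun_diff class_fun_perm_char class_fun_sum class_fun_scale, auto)
qed

lemma chi_inv:
  assumes "f \<in> shapes n" and w: "w \<in> perms n"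
  shows "chi n f (inv w) = chi n f w"
  using assms(1)
proof (induction f rule: shapes_induct_up)
  case (step f)
  then show ?case using w by (simp add: chi_eq [OF step.hyps] perm_char_inv)
qed

text \<open>Matrix counts split by \<open>sum_kostka_kostka\<close> in the same way as
  \<open>perm_char n (row_content f)\<close> splits by Young's rule, so subtracting the shapes above
  \<open>f\<close> leaves the term of \<open>f\<close>. Since \<open>m\<close> is arbitrary, this
  identifies the Schur function of \<open>f\<close> as the Frobenius image of
  \<open>chi n f\<close>.\<close>

lemma inner_prod_chi_perm_char_size:
  assumes "f \<in> shapes n" and m: "size m = n"
  shows "inner_prod n (chi n f) (perm_char n m) = of_nat (kostka f m)"
  using assms(1)
proof (induction f rule: shapes_induct_up)
  case (step f)
  note f = step.hyps
  let ?U = "{g. g \<in> shapes n \<and> dominated f g \<and> g \<noteq> f}"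
  have "inner_prod n (chi n f) (perm_char n m) = inner_prod n (perm_char n m) (chi n f)"
    by (rule inner_prod_commute)
  also have "\<dots> = inner_prod n (perm_char n m) (perm_char n (row_content f)) -
      (\<Sum>g\<in>?U. of_nat (kostka g (row_content f)) * inner_prod n (perm_char n m) (chi n g))"
    by (subst chi_eq [OF f]) (simp only: inner_prod_diff_right inner_prod_sum_right)
  also have "\<dots> = of_nat (card (matrices (row_content f) m)) -
      (\<Sum>g\<in>?U. of_nat (kostka g (row_content f)) * of_nat (kostka g m))"
    using inner_prod_perm_char [OF size_row_content [OF f], of m] step.IH
    by (auto simp: inner_prod_commute [of n "perm_char n m"] intro!: sum.cong)
  also have "of_nat (card (matrices (row_content f) m)) =
      (\<Sum>g\<in>shapes n. of_nat (kostka g (row_content f)) * of_nat (kostka g m))"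
    using sum_kostka_kostka [OF size_row_content [OF f] m]
    unfolding of_nat_mult [symmetric] of_nat_sum [symmetric] by simp
  finally show ?case by (simp add: sum_shapes_split [OF f])
qed

lemma inner_prod_chi_chi:
  assumes f: "f \<in> shapes n" and "g \<in> shapes n"
  shows "inner_prod n (chi n f) (chi n g) = of_bool (f = g)"
  using assms(2)
proof (induction g rule: shapes_induct_up)
  case (step g)
  let ?U = "{h. h \<in> shapes n \<and> dominated g h \<and> h \<noteq> g}"
  have "inner_prod n (chi n f) (chi n g) = inner_prod n (chi n f) (perm_char n (row_content g)) -
      (\<Sum>h\<in>?U. of_nat (kostka h (row_content g)) * inner_prod n (chi n f) (chi n h))"
    by (subst chi_eq [OF step.hyps]) (simp only: inner_prod_diff_right inner_prod_sum_right)
  also have "\<dots> = of_nat (kostka f (row_content g)) -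
      (\<Sum>h\<in>?U. of_nat (kostka h (row_content g)) * of_bool (f = h))"
    using inner_prod_chi_perm_char_size [OF f size_row_content [OF step.hyps]] step.IH
    by (auto intro!: sum.cong)
  also have "of_nat (kostka f (row_content g)) =
      (\<Sum>h\<in>shapes n. of_nat (kostka h (row_content g)) * (of_bool (f = h) :: rat))"
    using f by (simp add: finite_shapes)
  finally show ?case by (simp add: sum_shapes_split [OF step.hyps])
qed

section \<open>Completeness\<close>

text \<open>As a function of \<open>v\<close>, this is the indicator of the conjugacy class of
  \<open>w\<close> times the order of the centralizer of \<open>w\<close>. It is the reproducing
  kernel of the space of class functions, see \<open>inner_prod_intertwiners\<close>.\<close>

definition intertwiners :: "nat \<Rightarrow> (nat \<Rightarrow> nat) \<Rightarrow> (nat \<Rightarrow> nat) \<Rightarrow> rat" where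
  "intertwiners n w v = of_nat (card {s \<in> perms n. s \<circ> v = w \<circ> s})"

lemma intertwiners_eq_sum:
  assumes w: "w \<in> perms n"
  shows "intertwiners n w v = (\<Sum>s\<in>perms n. of_bool (v = conj_perm (inv s) w))"
proof -
  have "{s \<in> perms n. s \<circ> v = w \<circ> s} = {s \<in> perms n. v = conj_perm (inv s) w}"
  proof (intro Collect_cong conj_cong refl)
    fix s assume s: "s \<in> perms n"
    have "s \<circ> v = w \<circ> s \<longleftrightarrow> inv s \<circ> (s \<circ> v) = inv s \<circ> (w \<circ> s)"
      using s by (metis perms_inv_comp(7))
    then show "s \<circ> v = w \<circ> s \<longleftrightarrow> v = conj_perm (inv s) w"
      using s by (simp add: conj_perm_def comp_assoc)
  qed
  then show ?thesis by (simp add: intertwiners_def finite_perms Int_def)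
qed

lemma inner_prod_intertwiners:
  assumes w: "w \<in> perms n" and F: "class_fun n F"
  shows "inner_prod n (intertwiners n w) F = F w"
proof -
  have "(\<Sum>v\<in>perms n. intertwiners n w v * F v) =
      (\<Sum>s\<in>perms n. \<Sum>v\<in>perms n. of_bool (v = conj_perm (inv s) w) * F v)"
    unfolding intertwiners_eq_sum [OF w] sum_distrib_right by (rule sum.swap)
  also have "\<dots> = (\<Sum>s\<in>perms n. F w)"
  proof (rule sum.cong [OF refl])
    fix s assume s: "s \<in> perms n"
    have "(\<Sum>v\<in>perms n. of_bool (v = conj_perm (inv s) w) * F v) =
        (\<Sum>v\<in>perms n. if v = conj_perm (inv s) w then F v else 0)"
      by (intro sum.cong) auto
    also have "\<dots> = F (conj_perm (inv s) w)"
      using s w by (simp add: finite_perms conj_perm_in perms_inv)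
    also have "\<dots> = F w" using F s w by (simp add: class_funD perms_inv)
    finally show "(\<Sum>v\<in>perms n. of_bool (v = conj_perm (inv s) w) * F v) = F w" .
  qed
  also have "\<dots> = fact n * F w" by (simp add: perms_def card_permutations)
  finally show ?thesis by (simp add: inner_prod_def)
qed

lemma class_fun_intertwiners:
  assumes w: "w \<in> perms n"
  shows "class_fun n (intertwiners n w)"
  unfolding class_fun_def
proof (intro ballI)
  fix t v assume t: "t \<in> perms n" and v: "v \<in> perms n"
  have "s \<circ> conj_perm t v = w \<circ> s \<longleftrightarrow> (s \<circ> t) \<circ> v = w \<circ> (s \<circ> t)" for s
    using comp_cancel_right [OF t, of "s \<circ> t \<circ> v" "w \<circ> s"] by (simp add: conj_perm_def comp_assoc)
  then show "intertwiners n w (conj_perm t v) = intertwiners n w v"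
    using card_perms_right [OF t, of "\<lambda>s. s \<circ> v = w \<circ> s"] by (simp add: intertwiners_def)
qed

text \<open>By Burnside's lemma, the left-hand side is \<open>n!\<close> times the number of conjugacy classes.\<close>

lemma sum_intertwiners_le: "(\<Sum>w\<in>perms n. intertwiners n w w) \<le> fact n * of_nat (card (shapes n))"
proof -
  have le: "(\<Sum>w | w \<in> perms n \<and> cycle_type n w = la. intertwiners n w w) \<le> fact n" for la
  proof (cases "{w. w \<in> perms n \<and> cycle_type n w = la} = {}")
    case True
    then show ?thesis by (simp only: sum.empty fact_ge_zero)
  next
    case False
    then obtain w0 where w0: "w0 \<in> perms n" "cycle_type n w0 = la" by blast
    let ?C = "{w. w \<in> perms n \<and> cycle_type n w = la}"
    \<comment> \<open>The centralizer of \<open>w\<close> is a translate of the set of permutations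
      conjugating \<open>w0\<close> to \<open>w\<close>; for different \<open>w\<close> these sets
      are disjoint, so the sum is at most the order of the group.\<close>
    have "card {s \<in> perms n. s \<circ> w = w \<circ> s} = card {s \<in> perms n. conj_perm s w0 = w}" if w: "w \<in> ?C" for w
    proof -
      obtain t where t: "t \<in> perms n" "conj_perm t w0 = w"
        using cycle_type_eq_imp_conj [of w0 n w] w w0 by auto
      have "{s \<in> perms n. s \<circ> w = w \<circ> s} = {s \<in> perms n. conj_perm (s \<circ> t) w0 = w}"
        using conj_perm_comp [OF _ t(1)] conj_perm_eq_iff(1) t(2) by auto
      then show ?thesis using card_perms_right [OF t(1)] by simp
    qed
    then have "(\<Sum>w\<in>?C. card {s \<in> perms n. s \<circ> w = w \<circ> s}) = (\<Sum>w\<in>?C. card {s \<in> perms n. conj_perm s w0 = w})"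
      by (rule sum.cong [OF refl])
    also have "\<dots> = card (\<Union>w\<in>?C. {s \<in> perms n. conj_perm s w0 = w})"
      by (rule card_UN_disjoint [symmetric]) (auto simp: finite_perms)
    also have "\<dots> \<le> card (perms n)" by (intro card_mono) (auto simp: finite_perms)
    also have "\<dots> = fact n" by (simp add: perms_def card_permutations)
    finally have "(\<Sum>w\<in>?C. card {s \<in> perms n. s \<circ> w = w \<circ> s}) \<le> fact n" .
    then have "(of_nat (\<Sum>w\<in>?C. card {s \<in> perms n. s \<circ> w = w \<circ> s}) :: rat) \<le> of_nat (fact n)"
      by (simp only: of_nat_le_iff)
    then show ?thesis by (simp add: intertwiners_def)
  qed
  have "(\<Sum>w\<in>perms n. intertwiners n w w) =
      (\<Sum>la\<in>partitions n. \<Sum>w | w \<in> perms n \<and> cycle_type n w = la. intertwiners n w w)"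
    by (rule sum.group [symmetric]) (auto simp: finite_perms finite_partitions cycle_type_in_partitions)
  also have "\<dots> \<le> (\<Sum>la\<in>partitions n. fact n)" by (rule sum_mono) (rule le)
  also have "\<dots> = fact n * of_nat (card (shapes n))"
    using bij_betw_same_card [OF bij_betw_rows [of n]] by simp
  finally show ?thesis .
qed

text \<open>
  For fixed \<open>w\<close>, the squared norm of the difference of both sides, as a function of \<open>v\<close>, is
  its value at \<open>v = w\<close>; by the previous lemma these values sum up to at most 0.
\<close>

lemma sum_chi_chi:
  assumes w: "w \<in> perms n" and v: "v \<in> perms n"
  shows "(\<Sum>f\<in>shapes n. chi n f w * chi n f v) = intertwiners n w v"
proof -
  define q where "q w = (\<lambda>v. \<Sum>f\<in>shapes n. chi n f w * chi n f v)" for w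
  define D where "D w = (\<lambda>v. intertwiners n w v - q w v)" for w
  have clq: "class_fun n (q w)" if "w \<in> perms n" for w
    unfolding q_def using that by (intro class_fun_sum class_fun_scale class_fun_chi)
  have clD: "class_fun n (D w)" if "w \<in> perms n" for w
    unfolding D_def using that by (intro class_fun_diff class_fun_intertwiners clq)
  have qF: "inner_prod n F (q w) = (\<Sum>f\<in>shapes n. chi n f w * inner_prod n F (chi n f))" for F w
    unfolding q_def by (rule inner_prod_sum_right)
  have qchi: "inner_prod n (q w) (chi n f) = chi n f w" if "f \<in> shapes n" for f w
    unfolding inner_prod_commute [of n "q w"] qF using that
    by (simp add: inner_prod_chi_chi finite_shapes)
  have norm: "inner_prod n (D w) (D w) = D w w" if w: "w \<in> perms n" for w
  proof -
    have "inner_prod n (intertwiners n w) (D w) = D w w"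
      by (rule inner_prod_intertwiners [OF w clD [OF w]])
    \<comment> \<open>\<open>q w\<close> is the orthogonal projection of the kernel onto the span of
      the characters, so the difference is orthogonal to it.\<close>
    moreover have "inner_prod n (D w) (q w) = 0"
    proof -
      have "inner_prod n (D w) (q w) = inner_prod n (q w) (D w)" by (rule inner_prod_commute)
      also have "\<dots> = inner_prod n (q w) (intertwiners n w) - inner_prod n (q w) (q w)"
        unfolding D_def by (rule inner_prod_diff_right)
      also have "inner_prod n (q w) (intertwiners n w) = q w w"
        unfolding inner_prod_commute [of n "q w"] by (rule inner_prod_intertwiners [OF w clq [OF w]])
      also have "inner_prod n (q w) (q w) = q w w"
        by (simp add: qF qchi) (simp add: q_def)
      finally show ?thesis by simp
    qed
    moreover have "inner_prod n (D w) (D w) = inner_prod n (D w) (intertwiners n w) - inner_prod n (D w) (q w)"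
      by (subst (2) D_def) (rule inner_prod_diff_right)
    ultimately show ?thesis by (simp add: inner_prod_commute)
  qed
  have nonneg: "D w w \<ge> 0" if "w \<in> perms n" for w
    unfolding norm [OF that, symmetric] inner_prod_def by (intro divide_nonneg_nonneg sum_nonneg) auto
  have "(\<Sum>w\<in>perms n. q w w) = fact n * (\<Sum>f\<in>shapes n. inner_prod n (chi n f) (chi n f))"
    unfolding q_def by (subst sum.swap) (simp add: inner_prod_def flip: sum_divide_distrib)
  also have "\<dots> = fact n * of_nat (card (shapes n))"
    by (simp add: inner_prod_chi_chi)
  finally have "(\<Sum>w\<in>perms n. D w w) \<le> 0"
    using sum_intertwiners_le [of n] by (simp add: D_def sum_subtractf)
  then have "(\<Sum>w\<in>perms n. D w w) = 0" using nonneg by (intro antisym sum_nonneg)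
  then have "D w w = 0" using w nonneg by (subst (asm) sum_nonneg_eq_0_iff) (auto simp: finite_perms)
  then have "(\<Sum>v\<in>perms n. D w v * D w v) = 0" using norm [OF w] by (simp add: inner_prod_def)
  then have "D w v = 0" using v by (subst (asm) sum_nonneg_eq_0_iff) (auto simp: finite_perms)
  then show ?thesis by (simp add: D_def q_def)
qed

lemma class_fun_expand:
  assumes F: "class_fun n F" and w: "w \<in> perms n"
  shows "F w = (\<Sum>f\<in>shapes n. inner_prod n (chi n f) F * chi n f w)"
proof -
  have "F w = inner_prod n (intertwiners n w) F" by (simp add: inner_prod_intertwiners F w)
  also have "\<dots> = inner_prod n (\<lambda>v. \<Sum>f\<in>shapes n. chi n f w * chi n f v) F"
    using w by (intro inner_prod_cong) (simp_all add: sum_chi_chi)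
  also have "\<dots> = (\<Sum>f\<in>shapes n. chi n f w * inner_prod n F (chi n f))"
    unfolding inner_prod_commute [of n _ F] by (rule inner_prod_sum_right)
  finally show ?thesis by (simp add: inner_prod_commute mult.commute)
qed

section \<open>Convolution of characters\<close>

text \<open>The character induced from the sign character of a Young subgroup.\<close>

definition signed_char :: "nat \<Rightarrow> nat multiset \<Rightarrow> (nat \<Rightarrow> nat) \<Rightarrow> rat" where
  "signed_char n m w = of_int (sign w) * perm_char n m w"

lemma sign_perms_comp: "u \<in> perms n \<Longrightarrow> v \<in> perms n \<Longrightarrow> sign (u \<circ> v) = sign u * sign v"
  by (simp add: sign_compose perms_permutation)

lemma sign_perms_inv: "u \<in> perms n \<Longrightarrow> sign (inv u) = sign u"
  by (simp add: sign_inverse perms_permutation)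

lemma class_fun_signed_char: "class_fun n (signed_char n m)"
  unfolding class_fun_def signed_char_def
proof (intro ballI)
  fix s w assume s: "s \<in> perms n" and w: "w \<in> perms n"
  have "sign (conj_perm s w) = sign w"
    unfolding conj_perm_def sign_perms_comp [OF perms_comp [OF s w] perms_inv [OF s]]
      sign_perms_comp [OF s w] sign_perms_inv [OF s] by (simp add: sign_def)
  then show "of_int (sign (conj_perm s w)) * perm_char n m (conj_perm s w) = of_int (sign w) * perm_char n m w"
    using class_funD [OF class_fun_perm_char s w, of m] by simp
qed

lemma signed_char_inv: "w \<in> perms n \<Longrightarrow> signed_char n m (inv w) = signed_char n m w"
  by (simp add: signed_char_def perm_char_inv sign_perms_inv)

lemma inner_prod_eq_conv:
  assumes "\<And>w. w \<in> perms n \<Longrightarrow> g (inv w) = g w"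
  shows "inner_prod n f g = conv n f g id / fact n"
  using assms by (simp add: inner_prod_def conv_def)

text \<open>The number of factorizations of \<open>w\<close> into a permutation fixing the word
  \<open>c\<close> and one fixing \<open>d\<close>, weighted with the sign of the second factor,
  which is \<open>inv u \<circ> w\<close>.\<close>

definition pair_sum :: "nat \<Rightarrow> (nat \<Rightarrow> nat) \<Rightarrow> (nat \<Rightarrow> nat) \<Rightarrow> (nat \<Rightarrow> nat) \<Rightarrow> rat" where
  "pair_sum n w c d = (\<Sum>u\<in>perms n. of_bool (invariant n u c) *
     (of_int (sign (inv u \<circ> w)) * of_bool (invariant n (inv u \<circ> w) d)))"

lemma conv_perm_char_signed_char:
  "conv n (perm_char n m) (signed_char n m') w = (\<Sum>c\<in>words n m. \<Sum>d\<in>words n m'. pair_sum n w c d)"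
proof -
  have pc: "perm_char n m u = (\<Sum>c\<in>words n m. of_bool (invariant n u c))" for m :: "nat multiset" and u
    by (simp add: perm_char_def Int_def)
  have "conv n (perm_char n m) (signed_char n m') w =
      (\<Sum>u\<in>perms n. \<Sum>c\<in>words n m. \<Sum>d\<in>words n m'. of_bool (invariant n u c) *
        (of_int (sign (inv u \<circ> w)) * of_bool (invariant n (inv u \<circ> w) d)))"
    unfolding conv_def signed_char_def pc sum_distrib_left sum_distrib_right
    by (intro sum.cong refl sum.swap)
  also have "\<dots> = (\<Sum>c\<in>words n m. \<Sum>u\<in>perms n. \<Sum>d\<in>words n m'. of_bool (invariant n u c) *
        (of_int (sign (inv u \<circ> w)) * of_bool (invariant n (inv u \<circ> w) d)))"
    by (rule sum.swap)
  also have "\<dots> = (\<Sum>c\<in>words n m. \<Sum>d\<in>words n m'. pair_sum n w c d)"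
    unfolding pair_sum_def by (intro sum.cong refl sum.swap)
  finally show ?thesis .
qed

text \<open>
  If two positions carry the same letter in both words, then multiplying by their
  transposition is a sign-reversing involution on the factorizations of \<open>w\<close>.
\<close>

lemma pair_sum_zero:
  assumes w: "w \<in> perms n" and ij: "i \<in> {1..n}" "j \<in> {1..n}" "i \<noteq> j" "c i = c j" "d i = d j"
  shows "pair_sum n w c d = 0"
proof -
  let ?t = "transpose i j"
  let ?F = "\<lambda>u. of_bool (invariant n u c) *
     (of_int (sign (inv u \<circ> w)) * of_bool (invariant n (inv u \<circ> w) d)) :: rat"
  have t: "?t \<in> perms n" unfolding perms_def using permutes_swap_id [OF ij(1,2)] by simp
  have tt: "?t \<circ> (?t \<circ> x) = x" for x :: "nat \<Rightarrow> nat" by (simp add: fun_eq_iff)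
  have it: "inv ?t = ?t" by (rule inv_transpose_eq)
  have inv: "invariant n ?t e" if "e i = e j" for e :: "nat \<Rightarrow> nat"
    using that by (auto simp: invariant_def transpose_def)
  have R: "invariant n (u \<circ> ?t) e \<longleftrightarrow> invariant n u e" if u: "u \<in> perms n" and e: "e i = e j" for u and e :: "nat \<Rightarrow> nat"
  proof
    assume "invariant n (u \<circ> ?t) e"
    then have "invariant n ((u \<circ> ?t) \<circ> ?t) e" using invariant_comp [OF t _ inv [of e, OF e]] by blast
    then show "invariant n u e" by (simp add: comp_assoc)
  qed (use invariant_comp [OF t _ inv [of e, OF e]] in blast)
  have L: "invariant n (?t \<circ> u) e \<longleftrightarrow> invariant n u e" if u: "u \<in> perms n" and e: "e i = e j" for u and e :: "nat \<Rightarrow> nat"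
  proof
    assume "invariant n (?t \<circ> u) e"
    then have "invariant n (?t \<circ> (?t \<circ> u)) e"
      using invariant_comp [OF perms_comp [OF t u] inv [of e, OF e]] by blast
    then show "invariant n u e" by (simp only: tt)
  qed (use invariant_comp [OF u inv [of e, OF e]] in blast)
  have "pair_sum n w c d = (\<Sum>u\<in>perms n. ?F (u \<circ> ?t))"
    unfolding pair_sum_def by (rule sum_perms_right [OF t, symmetric])
  also have "\<dots> = (\<Sum>u\<in>perms n. - ?F u)"
  proof (rule sum.cong [OF refl])
    fix u assume u: "u \<in> perms n"
    have e: "inv (u \<circ> ?t) \<circ> w = ?t \<circ> (inv u \<circ> w)"
      using perms_inv_distrib [OF u t] by (simp add: it comp_assoc)
    have x: "inv u \<circ> w \<in> perms n" using u w by (simp add: perms_comp perms_inv)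
    show "?F (u \<circ> ?t) = - ?F u"
      unfolding e R [OF u ij(4)] L [OF x ij(5)] sign_perms_comp [OF t x]
      using ij(3) by (simp add: sign_swap_id)
  qed
  also have "\<dots> = - pair_sum n w c d" by (simp add: pair_sum_def sum_negf)
  finally show ?thesis by simp
qed

lemma pair_sum_zero_not_inj:
  assumes "w \<in> perms n" "\<not> inj_on (\<lambda>x. (c x, d x)) {1..n}"
  shows "pair_sum n w c d = 0"
proof -
  obtain i j where "i \<in> {1..n}" "j \<in> {1..n}" "i \<noteq> j" "(c i, d i) = (c j, d j)"
    using assms(2) unfolding inj_on_def by blast
  then show ?thesis using pair_sum_zero [OF assms(1), of i j] by simp
qed

text \<open>Pairs of words that escape the involution are 0-1 matrices whose row sums are
  \<open>f\<close> and whose column sums are conjugate to \<open>g\<close>; such matrices force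
  \<open>f\<close> to be dominated by \<open>g\<close>.\<close>

lemma conv_perm_char_signed_char_zero:
  assumes f: "f \<in> shapes n" and g: "g \<in> shapes n" and nd: "\<not> dominated f g" and w: "w \<in> perms n"
  shows "conv n (perm_char n (row_content f)) (signed_char n (col_content g)) w = 0"
  unfolding conv_perm_char_signed_char
proof (intro sum.neutral ballI)
  fix c d assume c: "c \<in> words n (row_content f)" and d: "d \<in> words n (col_content g)"
  have "\<not> inj_on (\<lambda>x. (c x, d x)) {1..n}"
    using nd injective_pairs_dominated [OF f g, of "{1..n}" c d] c d by (auto simp: words_def)
  then show "pair_sum n w c d = 0" using pair_sum_zero_not_inj [OF w] by blast
qed

text \<open>At the identity no cancellation remains: for an injective pair only
  \<open>u = id\<close> fixes both words, with sign 1, and all other pairs contribute 0. A numbering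
  of the cells of the diagram provides one injective pair.\<close>

lemma conv_perm_char_signed_char_nonzero:
  assumes f: "f \<in> shapes n"
  shows "conv n (perm_char n (row_content f)) (signed_char n (col_content f)) id \<noteq> 0"
proof -
  note fin = finite_diagram [OF f]
  have one: "pair_sum n id c d = 1" if inj: "inj_on (\<lambda>x. (c x, d x)) {1..n}" for c d
  proof -
    have only_id: "u = id" if u: "u \<in> perms n" and c: "invariant n u c" and d: "invariant n u d" for u
    proof
      fix x show "u x = id x"
      proof (cases "x \<in> {1..n}")
        case True
        then have "u x \<in> {1..n}" using perms_mem [OF u] by blast
        then show ?thesis using inj_onD [OF inj, of "u x" x] True c d by (simp add: invariant_def)
      next
        case False
        then show ?thesis using permutes_not_in [OF permsD [OF u]] by simp
      qed
    qed
    have "pair_sum n id c d = (\<Sum>u\<in>perms n. if u = id then 1 else 0)"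
      unfolding pair_sum_def
    proof (rule sum.cong [OF refl])
      fix u assume u: "u \<in> perms n"
      show "of_bool (invariant n u c) * (of_int (sign (inv u \<circ> id)) *
          of_bool (invariant n (inv u \<circ> id) d)) = (if u = id then 1 else 0 :: rat)"
      proof (cases "u = id")
        case False
        then have "\<not> (invariant n u c \<and> invariant n u d)" using only_id [OF u] by blast
        then show ?thesis using False by (simp add: invariant_inv [OF u])
      qed (simp add: invariant_id sign_id)
    qed
    then show ?thesis by (simp add: finite_perms perms_id)
  qed
  have nonneg: "pair_sum n id c d \<ge> 0" for c d
  proof (cases "inj_on (\<lambda>x. (c x, d x)) {1..n}")
    case False
    then have "pair_sum n id c d = 0" using pair_sum_zero_not_inj [OF perms_id] by blast
    then show ?thesis by simp
  qed (simp add: one)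
  obtain e where e: "e \<in> words n (mset_set (diagram f))"
    using words_nonempty [of "mset_set (diagram f)" n] card_diagram [OF f] by auto
  define c where "c = restrict (fst \<circ> e) {1..n}"
  define d where "d = restrict (snd \<circ> e) {1..n}"
  have img: "image_mset e (mset_set {1..n}) = mset_set (diagram f)"
    using e by (simp add: words_def)
  have c: "c \<in> words n (row_content f)" and d: "d \<in> words n (col_content f)"
    unfolding c_def d_def row_content_def col_content_def by (rule restrict_words [OF e])+
  have "e ` {1..n} = diagram f"
    using arg_cong [OF img, of set_mset] fin by simp
  then have inj: "inj_on e {1..n}"
    using card_diagram [OF f] by (intro eq_card_imp_inj_on) auto
  have "inj_on (\<lambda>x. (c x, d x)) {1..n}"
  proof (rule inj_onI)
    fix x y assume xy: "x \<in> {1..n}" "y \<in> {1..n}" and "(c x, d x) = (c y, d y)"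
    then have "e x = e y" by (simp add: c_def d_def prod_eq_iff)
    then show "x = y" using inj_onD [OF inj] xy by blast
  qed
  then have "0 < pair_sum n id c d" by (simp add: one)
  also have "\<dots> \<le> (\<Sum>d\<in>words n (col_content f). pair_sum n id c d)"
    using d nonneg by (intro member_le_sum) auto
  also have "\<dots> \<le> (\<Sum>c\<in>words n (row_content f). \<Sum>d\<in>words n (col_content f). pair_sum n id c d)"
    using c nonneg by (intro member_le_sum) (auto intro: sum_nonneg)
  finally show ?thesis by (simp add: conv_perm_char_signed_char)
qed

text \<open>Besides its permutation character, \<open>chi n f\<close> involves only characters of
  shapes above \<open>f\<close>, and none of these is dominated by \<open>g\<close> either.\<close>

lemma conv_chi_signed_char_zero:
  assumes "f \<in> shapes n" and g: "g \<in> shapes n" and "\<not> dominated f g" and w: "w \<in> perms n"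
  shows "conv n (chi n f) (signed_char n (col_content g)) w = 0"
  using assms(1,3)
proof (induction f rule: shapes_induct_up)
  case (step f)
  have "conv n (chi n h) (signed_char n (col_content g)) w = 0"
    if "h \<in> shapes n" "dominated f h" "h \<noteq> f" for h
  proof (rule step.IH [OF that])
    show "\<not> dominated h g" using step.prems dominated_trans [OF that(2)] by auto
  qed
  then have "(\<Sum>h | h \<in> shapes n \<and> dominated f h \<and> h \<noteq> f. of_nat (kostka h (row_content f)) *
      conv n (chi n h) (signed_char n (col_content g)) w) = 0"
    by (intro sum.neutral) auto
  then show ?case
    unfolding chi_eq [OF step.hyps] conv_diff_left conv_sum_left
    using conv_perm_char_signed_char_zero [OF step.hyps g step.prems w] by simp
qed

lemma inner_prod_chi_signed_char_zero:
  assumes "f \<in> shapes n" "g \<in> shapes n" "\<not> dominated f g"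
  shows "inner_prod n (chi n f) (signed_char n (col_content g)) = 0"
  using conv_chi_signed_char_zero [OF assms perms_id]
  by (simp add: inner_prod_eq_conv signed_char_inv)

text \<open>Shapes strictly above \<open>f\<close> are not dominated by \<open>f\<close>, so the
  correction terms of \<open>chi n f\<close> vanish and the value for its permutation character
  remains.\<close>

lemma inner_prod_chi_signed_char_nonzero:
  assumes f: "f \<in> shapes n"
  shows "inner_prod n (chi n f) (signed_char n (col_content f)) \<noteq> 0"
proof -
  have "conv n (chi n h) (signed_char n (col_content f)) id = 0"
    if "h \<in> shapes n" "dominated f h" "h \<noteq> f" for h
  proof (rule conv_chi_signed_char_zero [OF that(1) f _ perms_id])
    show "\<not> dominated h f" using that(3) dominated_antisym [OF that(2)] by auto
  qed
  then have "(\<Sum>h | h \<in> shapes n \<and> dominated f h \<and> h \<noteq> f. of_nat (kostka h (row_content f)) *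
      conv n (chi n h) (signed_char n (col_content f)) id) = 0"
    by (intro sum.neutral) auto
  then have "conv n (chi n f) (signed_char n (col_content f)) id =
      conv n (perm_char n (row_content f)) (signed_char n (col_content f)) id"
    unfolding chi_eq [OF f] conv_diff_left conv_sum_left by simp
  then show ?thesis
    using conv_perm_char_signed_char_nonzero [OF f] by (simp add: inner_prod_eq_conv signed_char_inv)
qed

text \<open>The signed character of \<open>g\<close> expands into characters of shapes below
  \<open>g\<close>, with a nonzero coefficient at \<open>g\<close>. Convolution with
  \<open>chi n f\<close> annihilates the whole and, by induction, every term except that of
  \<open>g\<close>.\<close>

lemma conv_chi_chi_not_dominated:
  assumes f: "f \<in> shapes n" and "g \<in> shapes n" and "\<not> dominated f g" and w: "w \<in> perms n"
  shows "conv n (chi n f) (chi n g) w = 0"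
  using assms(2,3)
proof (induction g rule: shapes_induct_down)
  case (step g)
  let ?B = "signed_char n (col_content g)"
  let ?b = "\<lambda>h. inner_prod n (chi n h) ?B"
  have zero: "?b h * conv n (chi n f) (chi n h) w = 0" if "h \<in> shapes n - {g}" for h
  proof (cases "dominated h g")
    case True
    then have "\<not> dominated f h" using step.prems dominated_trans [of f h g] by auto
    then show ?thesis using step.IH [of h] that True by simp
  next
    case False
    then show ?thesis using inner_prod_chi_signed_char_zero [of h n g] that step.hyps by simp
  qed
  have "0 = conv n (chi n f) ?B w"
    using conv_chi_signed_char_zero [OF f step.hyps step.prems w] by simp
  also have "\<dots> = conv n (chi n f) (\<lambda>w. \<Sum>h\<in>shapes n. ?b h * chi n h w) w"
    using class_fun_expand [OF class_fun_signed_char] w by (intro conv_cong) auto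
  also have "\<dots> = (\<Sum>h\<in>shapes n. ?b h * conv n (chi n f) (chi n h) w)"
    by (rule conv_sum_right)
  also have "\<dots> = ?b g * conv n (chi n f) (chi n g) w + (\<Sum>h\<in>shapes n - {g}. ?b h * conv n (chi n f) (chi n h) w)"
    by (rule sum.remove [OF finite_shapes step.hyps])
  also have "\<dots> = ?b g * conv n (chi n f) (chi n g) w"
    using zero by (simp add: sum.neutral)
  finally show ?case using inner_prod_chi_signed_char_nonzero [OF step.hyps] by simp
qed

lemma conv_chi_chi_zero:
  assumes "f \<in> shapes n" "g \<in> shapes n" "f \<noteq> g" "w \<in> perms n"
  shows "conv n (chi n f) (chi n g) w = 0"
proof (cases "dominated f g")
  case True
  then have "\<not> dominated g f" using assms(3) dominated_antisym by blast
  then show ?thesis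
    using conv_chi_chi_not_dominated [of g n f w] conv_commute [OF class_fun_chi, of f n w "chi n g"] assms by simp
qed (use assms in \<open>simp add: conv_chi_chi_not_dominated\<close>)

lemma conv_chi_chi_id:
  assumes "f \<in> shapes n"
  shows "conv n (chi n f) (chi n f) id = fact n"
  using inner_prod_eq_conv [of n "chi n f" "chi n f"] inner_prod_chi_chi [OF assms assms]
  by (simp add: chi_inv [OF assms])

text \<open>The coefficient of \<open>chi n g\<close> in the square vanishes for \<open>g\<close>
  other than \<open>f\<close>, as bracketing \<open>chi n g\<close> with the first factor gives 0.
  Evaluation at the identity, where orthonormality gives \<open>fact n\<close>, yields the constant
  and shows that the degree is not 0.\<close>

lemma conv_chi_chi_self:
  assumes f: "f \<in> shapes n"
  shows "chi n f id \<noteq> 0"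
    "w \<in> perms n \<Longrightarrow> conv n (chi n f) (chi n f) w = fact n / chi n f id * chi n f w"
proof -
  let ?F = "conv n (chi n f) (chi n f)"
  let ?c = "\<lambda>g. inner_prod n (chi n g) ?F"
  have F: "?F w = (\<Sum>g\<in>shapes n. ?c g * chi n g w)" if "w \<in> perms n" for w
    using that f by (intro class_fun_expand class_fun_conv class_fun_chi)
  have "?c g = 0" if g: "g \<in> shapes n" "g \<noteq> f" for g
  proof -
    have "0 = conv n (conv n (chi n g) (chi n f)) (chi n f) id"
    proof -
      have "conv n (conv n (chi n g) (chi n f)) (chi n f) id = conv n (\<lambda>_. 0) (chi n f) id"
        using conv_chi_chi_zero [OF g(1) f g(2)] perms_id by (intro conv_cong) auto
      then show ?thesis by (simp add: conv_def)
    qed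
    also have "\<dots> = conv n (chi n g) ?F id" by (rule conv_assoc [OF perms_id])
    also have "\<dots> = conv n (chi n g) (\<lambda>w. \<Sum>h\<in>shapes n. ?c h * chi n h w) id"
      using F perms_id by (intro conv_cong) auto
    also have "\<dots> = (\<Sum>h\<in>shapes n. ?c h * conv n (chi n g) (chi n h) id)"
      by (rule conv_sum_right)
    also have "\<dots> = (\<Sum>h\<in>shapes n. if h = g then ?c g * fact n else 0)"
      using g conv_chi_chi_zero [OF g(1) _ _ perms_id] by (intro sum.cong) (auto simp: conv_chi_chi_id)
    also have "\<dots> = ?c g * fact n" using g by (simp add: finite_shapes)
    finally show ?thesis by simp
  qed
  then have *: "?F w = ?c f * chi n f w" if "w \<in> perms n" for w
    unfolding F [OF that] using f by (subst sum.remove [OF finite_shapes f]) (auto intro: sum.neutral)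
  from * [OF perms_id] have 1: "fact n = ?c f * chi n f id" by (simp add: conv_chi_chi_id f)
  then show nz: "chi n f id \<noteq> 0" by (metis fact_nonzero mult_zero_right)
  have "?c f = fact n / chi n f id" using 1 nz by (simp add: field_simps)
  then show "w \<in> perms n \<Longrightarrow> ?F w = fact n / chi n f id * chi n f w" using * by simp
qed

lemma conv_sum_chi:
  assumes w: "w \<in> perms n"
  shows "conv n (\<lambda>w. \<Sum>f\<in>shapes n. a f * chi n f w) (\<lambda>w. \<Sum>f\<in>shapes n. b f * chi n f w) w =
    (\<Sum>f\<in>shapes n. a f * b f * (fact n / chi n f id) * chi n f w)"
proof -
  have "conv n (\<lambda>w. \<Sum>f\<in>shapes n. a f * chi n f w) (\<lambda>w. \<Sum>f\<in>shapes n. b f * chi n f w) w =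
      (\<Sum>f\<in>shapes n. a f * (\<Sum>g\<in>shapes n. b g * conv n (chi n f) (chi n g) w))"
    by (simp only: conv_sum_left conv_sum_right)
  also have "\<dots> = (\<Sum>f\<in>shapes n. a f * b f * (fact n / chi n f id) * chi n f w)"
  proof (rule sum.cong [OF refl])
    fix f assume f: "f \<in> shapes n"
    have "(\<Sum>g\<in>shapes n. b g * conv n (chi n f) (chi n g) w) =
        (\<Sum>g\<in>shapes n. if g = f then b f * (fact n / chi n f id * chi n f w) else 0)"
      using f w conv_chi_chi_zero [OF f _ _ w] conv_chi_chi_self(2) [OF f w] by (intro sum.cong) auto
    then show "a f * (\<Sum>g\<in>shapes n. b g * conv n (chi n f) (chi n g) w) =
        a f * b f * (fact n / chi n f id) * chi n f w"
      using f by (simp add: finite_shapes mult_ac)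
  qed
  finally show ?thesis .
qed

lemma inner_prod_chi_sum:
  assumes f: "f \<in> shapes n"
  shows "inner_prod n (chi n f) (\<lambda>w. \<Sum>g\<in>shapes n. a g * chi n g w) = a f"
  using f by (simp add: inner_prod_sum_right inner_prod_chi_chi finite_shapes)

text \<open>The permutation character of \<open>n\<close> distinct letters is the regular character:
  it vanishes off the identity, so the inner product with it reads off the degree, here the number
  of standard tableaux.\<close>

lemma chi_id:
  assumes f: "f \<in> shapes n"
  shows "chi n f id = of_nat (kostka f (mset_set {1..n}))"
proof -
  let ?M = "mset_set {1..n}"
  have zero: "perm_char n ?M w = 0" if w: "w \<in> perms n" "w \<noteq> id" for w
  proof -
    have "\<not> invariant n w c" if c: "c \<in> words n ?M" for c
    proof
      assume i: "invariant n w c"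
      have "image_mset c (mset_set {1..n}) = mset_set {1..n}" using c by (simp add: words_def)
      then have "c ` {1..n} = {1..n}"
        by (metis finite_atLeastAtMost finite_set_mset_mset_set set_image_mset)
      then have "inj_on c {1..n}" by (intro eq_card_imp_inj_on) auto
      have "w x = x" for x
      proof (cases "x \<in> {1..n}")
        case True
        then have "w x \<in> {1..n}" "c (w x) = c x" using perms_mem [OF w(1)] i by (auto simp: invariant_def)
        then show ?thesis using \<open>inj_on c {1..n}\<close> True by (auto dest: inj_onD)
      next
        case False
        then show ?thesis using permutes_not_in [OF permsD [OF w(1)]] by simp
      qed
      then show False using w(2) by auto
    qed
    then have "{c \<in> words n ?M. invariant n w c} = {}" by blast
    then show ?thesis unfolding perm_char_def by (simp only: card.empty of_nat_0)
  qed
  have sum: "(\<Sum>w\<in>perms n. F w * perm_char n ?M w) = F id * perm_char n ?M id" for F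
    using zero by (subst sum.remove [OF finite_perms perms_id]) (auto intro: sum.neutral)
  have "perm_char n ?M id = fact n"
    using sum [of "\<lambda>_. 1"] sum_perm_char [of ?M n] by simp
  then have "inner_prod n (chi n f) (perm_char n ?M) = chi n f id"
    unfolding inner_prod_def sum by simp
  then show ?thesis using inner_prod_chi_perm_char_size [OF f, of ?M] by simp
qed

section \<open>Square roots and commutators\<close>

lemma class_fun_card_squares: "class_fun n (\<lambda>w. of_nat (card {u \<in> perms n. u \<circ> u = w}))"
  unfolding class_fun_def
proof (intro ballI)
  fix s w assume s: "s \<in> perms n" and w: "w \<in> perms n"
  have "conj_perm s u \<circ> conj_perm s u = conj_perm s w \<longleftrightarrow> u \<circ> u = w" for u
  proof -
    have "conj_perm s u \<circ> conj_perm s u = conj_perm s (u \<circ> u)"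
      using s by (simp add: conj_perm_def comp_assoc)
    then show ?thesis using conj_perm_eq_iff(2) [OF s] by simp
  qed
  then show "(of_nat (card {u \<in> perms n. u \<circ> u = conj_perm s w}) :: rat) = of_nat (card {u \<in> perms n. u \<circ> u = w})"
    using sum_perms_conj [OF s, of "\<lambda>u. of_bool (u \<circ> u = conj_perm s w) :: nat"]
    by (simp add: finite_perms Int_def)
qed

lemma sum_perm_image:
  fixes F :: "(nat \<Rightarrow> nat) \<Rightarrow> rat"
  assumes "finite A" "\<phi> ` A \<subseteq> perms n"
    and D: "\<And>w. w \<in> perms n \<Longrightarrow> of_nat (card {a \<in> A. \<phi> a = w}) = D w"
  shows "(\<Sum>a\<in>A. F (\<phi> a)) = (\<Sum>w\<in>perms n. D w * F w)"
proof -
  have "(\<Sum>a\<in>A. F (\<phi> a)) = (\<Sum>w\<in>perms n. \<Sum>a\<in>{a \<in> A. \<phi> a = w}. F (\<phi> a))"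
    by (rule sum.group [symmetric]) (use assms finite_perms in auto)
  also have "\<dots> = (\<Sum>w\<in>perms n. D w * F w)"
    by (rule sum.cong) (simp_all flip: D)
  finally show ?thesis .
qed

text \<open>
  This is the homeomorphism between the two usual presentations \<open>u\<^sup>2 v\<^sup>2\<close> and
  \<open>x s\<inverse> x s\<close> of the Klein bottle.
\<close>

lemma conv_card_squares:
  defines "C \<equiv> \<lambda>n w. of_nat (card {u \<in> perms n. u \<circ> u = w}) :: rat"
  assumes w: "w \<in> perms n"
  shows "conv n (C n) (C n) w = (\<Sum>f\<in>shapes n. fact n / chi n f id * chi n f w)"
proof -
  have "conv n (C n) (C n) w = (\<Sum>u\<in>perms n. C n (inv (u \<circ> u) \<circ> w))"
    unfolding conv_def
    by (rule sum_perm_image [symmetric]) (auto simp: finite_perms perms_comp C_def)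
  also have "\<dots> = (\<Sum>u\<in>perms n. \<Sum>v\<in>perms n. of_bool ((u \<circ> u) \<circ> (v \<circ> v) = w))"
  proof (rule sum.cong [OF refl])
    fix u assume u: "u \<in> perms n"
    show "C n (inv (u \<circ> u) \<circ> w) = (\<Sum>v\<in>perms n. of_bool ((u \<circ> u) \<circ> (v \<circ> v) = w))"
      unfolding comp_cancel_left [OF perms_comp [OF u u]] by (simp add: C_def finite_perms Int_def)
  qed
  also have "\<dots> = (\<Sum>v\<in>perms n. \<Sum>u\<in>perms n. of_bool ((u \<circ> u) \<circ> (v \<circ> v) = w))"
    by (rule sum.swap)
  \<comment> \<open>With \<open>v = s\<close> and \<open>u = x \<circ> inv s\<close> the equation
    says that \<open>s\<close> conjugates \<open>inv x \<circ> w\<close> to \<open>x\<close>, which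
    for fixed \<open>x\<close> is counted by \<open>intertwiners\<close>.\<close>
  also have "\<dots> = (\<Sum>s\<in>perms n. \<Sum>x\<in>perms n. of_bool (s \<circ> (inv x \<circ> w) = x \<circ> s))"
  proof (rule sum.cong [OF refl])
    fix s assume s: "s \<in> perms n"
    have "((x \<circ> inv s) \<circ> (x \<circ> inv s)) \<circ> (s \<circ> s) = w \<longleftrightarrow> s \<circ> (inv x \<circ> w) = x \<circ> s" if x: "x \<in> perms n" for x
    proof -
      have "((x \<circ> inv s) \<circ> (x \<circ> inv s)) \<circ> (s \<circ> s) = w \<longleftrightarrow> x \<circ> (inv s \<circ> (x \<circ> s)) = w"
        using s by (simp add: comp_assoc)
      also have "\<dots> \<longleftrightarrow> inv s \<circ> (x \<circ> s) = inv x \<circ> w" by (rule comp_cancel_left [OF x])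
      also have "\<dots> \<longleftrightarrow> s \<circ> (inv x \<circ> w) = x \<circ> s"
        using comp_cancel_left [OF s, of "inv x \<circ> w" "x \<circ> s"] by metis
      finally show ?thesis .
    qed
    then show "(\<Sum>u\<in>perms n. of_bool ((u \<circ> u) \<circ> (s \<circ> s) = w)) =
        (\<Sum>x\<in>perms n. of_bool (s \<circ> (inv x \<circ> w) = x \<circ> s) :: rat)"
      by (subst sum_perms_right [OF perms_inv [OF s], symmetric]) (rule sum.cong, auto)
  qed
  also have "\<dots> = (\<Sum>x\<in>perms n. intertwiners n x (inv x \<circ> w))"
    by (subst sum.swap) (simp add: intertwiners_def finite_perms Int_def)
  also have "\<dots> = (\<Sum>x\<in>perms n. \<Sum>f\<in>shapes n. chi n f x * chi n f (inv x \<circ> w))"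
    using w by (intro sum.cong refl sum_chi_chi [symmetric]) (auto simp: perms_comp perms_inv)
  also have "\<dots> = (\<Sum>f\<in>shapes n. conv n (chi n f) (chi n f) w)"
    unfolding conv_def by (rule sum.swap)
  also have "\<dots> = (\<Sum>f\<in>shapes n. fact n / chi n f id * chi n f w)"
    using w by (intro sum.cong refl conv_chi_chi_self)
  finally show ?thesis .
qed

text \<open>
  The multiplicities of the characters in the square root count are \<open>\<plusminus>1\<close>, and the value
  at the identity excludes the sign -1.
\<close>

lemma card_squares:
  assumes w: "w \<in> perms n"
  shows "of_nat (card {u \<in> perms n. u \<circ> u = w}) = (\<Sum>f\<in>shapes n. chi n f w)"
proof -
  let ?C = "\<lambda>w. of_nat (card {u \<in> perms n. u \<circ> u = w}) :: rat"
  define a where "a f = inner_prod n (chi n f) ?C" for f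
  have C: "?C w = (\<Sum>f\<in>shapes n. a f * chi n f w)" if "w \<in> perms n" for w
    unfolding a_def by (rule class_fun_expand [OF class_fun_card_squares that])
  \<comment> \<open>The convolution square of the root count has the coefficients
    \<open>a f * a f * (fact n / chi n f id)\<close> by its expansion and
    \<open>fact n / chi n f id\<close> by \<open>conv_card_squares\<close>.\<close>
  have pm: "a f * a f = 1" if f: "f \<in> shapes n" for f
  proof -
    have "(\<Sum>f\<in>shapes n. a f * a f * (fact n / chi n f id) * chi n f v) =
        (\<Sum>f\<in>shapes n. fact n / chi n f id * chi n f v)" if v: "v \<in> perms n" for v
      unfolding conv_sum_chi [OF v, symmetric] conv_card_squares [OF v, symmetric]
      using C v by (intro conv_cong) auto
    then have "inner_prod n (chi n f) (\<lambda>v. \<Sum>f\<in>shapes n. a f * a f * (fact n / chi n f id) * chi n f v) =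
        inner_prod n (chi n f) (\<lambda>v. \<Sum>f\<in>shapes n. fact n / chi n f id * chi n f v)"
      by (intro inner_prod_cong) auto
    then have "a f * a f * (fact n / chi n f id) = fact n / chi n f id"
      unfolding inner_prod_chi_sum [OF f] .
    then show ?thesis using conv_chi_chi_self(1) [OF f] by simp
  qed
  have le: "a f \<le> 1" if "f \<in> shapes n" for f
  proof (rule ccontr)
    assume "\<not> a f \<le> 1"
    then have "1 * 1 < a f * a f" by (intro mult_strict_mono) auto
    then show False using pm [OF that] by simp
  qed
  have "{u \<in> perms n. u \<circ> u = id} = involutions {1..n}" by (auto simp: involutions_def perms_def)
  then have "?C id = of_nat (\<Sum>f\<in>shapes n. kostka f (mset_set {1..n}))"
    using sum_kostka_standard [of "{1..n}"] by simp
  then have "(\<Sum>f\<in>shapes n. (1 - a f) * chi n f id) = 0"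
    using C [OF perms_id] by (simp add: chi_id left_diff_distrib sum_subtractf)
  moreover have pos: "chi n f id > 0" if "f \<in> shapes n" for f
    using conv_chi_chi_self(1) [OF that] chi_id [OF that] by (simp add: of_nat_0_less_iff)
  ultimately have "(1 - a f) * chi n f id = 0" if "f \<in> shapes n" for f
  proof -
    have "0 \<le> (1 - a g) * chi n g id" if "g \<in> shapes n" for g
      using le [OF that] pos [OF that] by simp
    then show ?thesis
      using \<open>(\<Sum>f\<in>shapes n. (1 - a f) * chi n f id) = 0\<close> that
      by (simp add: sum_nonneg_eq_0_iff finite_shapes)
  qed
  then have "a f = 1" if "f \<in> shapes n" for f using that pos by fastforce
  then show ?thesis using C [OF w] by simp
qed

text \<open>The equation says that \<open>v\<close> conjugates \<open>inv u\<close> to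
  \<open>inv u \<circ> w\<close>; for fixed \<open>u\<close> this is again a count of intertwiners,
  and summing over \<open>u\<close> produces a convolution.\<close>

lemma card_commutators:
  assumes w: "w \<in> perms n"
  shows "of_nat (card {(u, v) \<in> perms n \<times> perms n. commutator u v = w}) =
    (\<Sum>f\<in>shapes n. fact n / chi n f id * chi n f w)"
proof -
  have *: "commutator u v = w \<longleftrightarrow> v \<circ> inv u = (inv u \<circ> w) \<circ> v" if u: "u \<in> perms n" and v: "v \<in> perms n" for u v
  proof -
    have "commutator u v = w \<longleftrightarrow> v \<circ> (inv u \<circ> inv v) = inv u \<circ> w"
      using comp_cancel_left [OF u] by (simp add: commutator_def comp_assoc)
    also have "\<dots> \<longleftrightarrow> (v \<circ> (inv u \<circ> inv v)) \<circ> v = (inv u \<circ> w) \<circ> v"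
    proof
      assume "(v \<circ> (inv u \<circ> inv v)) \<circ> v = (inv u \<circ> w) \<circ> v"
      then have "((v \<circ> (inv u \<circ> inv v)) \<circ> v) \<circ> inv v = ((inv u \<circ> w) \<circ> v) \<circ> inv v" by simp
      then show "v \<circ> (inv u \<circ> inv v) = inv u \<circ> w" using v by (simp add: comp_assoc)
    qed simp
    also have "(v \<circ> (inv u \<circ> inv v)) \<circ> v = v \<circ> inv u" using v by (simp add: comp_assoc)
    finally show ?thesis .
  qed
  have "{(u, v) \<in> perms n \<times> perms n. commutator u v = w} =
      (SIGMA u:perms n. {v \<in> perms n. v \<circ> inv u = (inv u \<circ> w) \<circ> v})"
    using * by auto
  then have "(of_nat (card {(u, v) \<in> perms n \<times> perms n. commutator u v = w}) :: rat) =
      (\<Sum>u\<in>perms n. intertwiners n (inv u \<circ> w) (inv u))"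
    by (simp add: intertwiners_def finite_perms)
  also have "\<dots> = (\<Sum>u\<in>perms n. \<Sum>f\<in>shapes n. chi n f u * chi n f (inv u \<circ> w))"
    using w by (intro sum.cong refl) (simp add: sum_chi_chi [symmetric] perms_comp perms_inv chi_inv mult.commute)
  also have "\<dots> = (\<Sum>f\<in>shapes n. conv n (chi n f) (chi n f) w)"
    unfolding conv_def by (rule sum.swap)
  also have "\<dots> = (\<Sum>f\<in>shapes n. fact n / chi n f id * chi n f w)"
    using w by (intro sum.cong refl conv_chi_chi_self)
  finally show ?thesis .
qed

section \<open>The hook length formula\<close>

text \<open>The factor by which the product of the differences of the nodes changes when
  \<open>x i\<close> is lowered by 1 (\<open>vandermonde_shift\<close>).\<close>

definition node_weight :: "('a \<Rightarrow> 'b :: field) \<Rightarrow> 'a set \<Rightarrow> 'a \<Rightarrow> 'b" where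
  "node_weight x S i = (\<Prod>j\<in>S - {i}. (x i - 1 - x j) / (x i - x j))"

lemma node_weight_insert:
  assumes "finite S" "t \<notin> S"
  shows "i \<in> S \<Longrightarrow> node_weight x (insert t S) i = node_weight x S i * ((x i - 1 - x t) / (x i - x t))"
    "node_weight x (insert t S) t = (\<Prod>j\<in>S. (x t - 1 - x j) / (x t - x j))"
proof -
  show "node_weight x (insert t S) i = node_weight x S i * ((x i - 1 - x t) / (x i - x t))" if i: "i \<in> S"
  proof -
    have "insert t S - {i} = insert t (S - {i})" using i assms(2) by auto
    then show ?thesis using assms by (simp add: node_weight_def mult.commute)
  qed
  have "insert t S - {t} = S" using assms(2) by auto
  then show "node_weight x (insert t S) t = (\<Prod>j\<in>S. (x t - 1 - x j) / (x t - x j))"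
    by (simp add: node_weight_def)
qed

text \<open>The partial fraction expansion that makes the sums over the nodes telescope.\<close>

lemma node_weight_partial_fractions:
  fixes x :: "'a \<Rightarrow> 'b :: field"
  assumes "finite S" "inj_on x S" "z \<notin> x ` S"
  shows "(\<Prod>j\<in>S. (z - 1 - x j) / (z - x j)) = 1 - (\<Sum>i\<in>S. node_weight x S i / (z - x i))"
  using assms
proof (induction S arbitrary: z rule: finite_induct)
  case (insert t S)
  let ?A = "node_weight x S"
  have t: "x t \<notin> x ` S" and inj: "inj_on x S" using insert.prems(1) insert.hyps by auto
  have zt: "z - x t \<noteq> 0" using insert.prems(2) by auto
  have IHz: "(\<Prod>j\<in>S. (z - 1 - x j) / (z - x j)) = 1 - (\<Sum>i\<in>S. ?A i / (z - x i))"
    using insert.IH [OF inj] insert.prems(2) by auto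
  have IHt: "(\<Prod>j\<in>S. (x t - 1 - x j) / (x t - x j)) = 1 - (\<Sum>i\<in>S. ?A i / (x t - x i))"
    using insert.IH [OF inj t] .
  have key: "?A i / (z - x i) * (1 / (z - x t)) =
      ?A i / (x t - x i) * (1 / (z - x t)) - ?A i * (1 / (x t - x i)) / (z - x i)" if "i \<in> S" for i
  proof -
    have "z - x i \<noteq> 0" "x t - x i \<noteq> 0" using that insert.prems(2) t by auto
    then show ?thesis using zt by (simp add: divide_simps) (simp add: algebra_simps)
  qed
  have w: "node_weight x (insert t S) i / (z - x i) =
      ?A i / (z - x i) + ?A i * (1 / (x t - x i)) / (z - x i)" if "i \<in> S" for i
  proof -
    have "x t \<noteq> x i" using that t by (metis imageI)
    then have "z - x i \<noteq> 0" "x t - x i \<noteq> 0" "x i - x t \<noteq> 0" using that insert.prems(2) by auto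
    then show ?thesis
      unfolding node_weight_insert(1) [OF insert.hyps that] by (simp add: divide_simps) (simp add: algebra_simps)
  qed
  have "(\<Sum>i\<in>S. node_weight x (insert t S) i / (z - x i)) =
      (\<Sum>i\<in>S. ?A i / (z - x i)) + (\<Sum>i\<in>S. ?A i * (1 / (x t - x i)) / (z - x i))"
    by (simp add: w sum.distrib)
  also have "(\<Sum>i\<in>S. ?A i * (1 / (x t - x i)) / (z - x i)) =
      (\<Sum>i\<in>S. ?A i / (x t - x i)) * (1 / (z - x t)) - (\<Sum>i\<in>S. ?A i / (z - x i)) * (1 / (z - x t))"
    unfolding sum_distrib_right sum_subtractf [symmetric] using key by (intro sum.cong) (auto simp: algebra_simps)
  finally have S: "(\<Sum>i\<in>S. node_weight x (insert t S) i / (z - x i)) =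
      (\<Sum>i\<in>S. ?A i / (z - x i)) + ((\<Sum>i\<in>S. ?A i / (x t - x i)) * (1 / (z - x t)) -
        (\<Sum>i\<in>S. ?A i / (z - x i)) * (1 / (z - x t)))" .
  have "(z - 1 - x t) / (z - x t) = 1 - 1 / (z - x t)" using zt by (simp add: divide_simps)
  then show ?case
    using insert.hyps S by (simp add: IHz IHt node_weight_insert(2)) (simp add: algebra_simps diff_divide_distrib)
qed simp

text \<open>A new node \<open>t\<close> changes each old weight \<open>A i\<close> by
  \<open>A i / (x t - x i)\<close>, and by the partial fraction expansion at \<open>x t\<close> its
  own weight is 1 minus the sum of these changes. The total therefore grows by 1 and the first
  moment by \<open>x t - card S\<close>, which is the origin of the sum over
  \<open>k\<close>.\<close>

lemma sum_node_weight:
  fixes x :: "'a \<Rightarrow> 'b :: field"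
  assumes "finite S" "inj_on x S"
  shows "(\<Sum>i\<in>S. node_weight x S i) = of_nat (card S)"
    "(\<Sum>i\<in>S. x i * node_weight x S i) = (\<Sum>i\<in>S. x i) - (\<Sum>k<card S. of_nat k)"
proof -
  have "(\<Sum>i\<in>S. node_weight x S i) = of_nat (card S) \<and>
      (\<Sum>i\<in>S. x i * node_weight x S i) = (\<Sum>i\<in>S. x i) - (\<Sum>k<card S. of_nat k)"
    using assms
  proof (induction S rule: finite_induct)
    case (insert t S)
    let ?A = "node_weight x S"
    have t: "x t \<notin> x ` S" and inj: "inj_on x S" using insert.prems(1) insert.hyps by auto
    have P: "node_weight x (insert t S) t = 1 - (\<Sum>i\<in>S. ?A i / (x t - x i))"
      unfolding node_weight_insert(2) [OF insert.hyps]
      using node_weight_partial_fractions [OF insert.hyps(1) inj t] .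
    have w: "node_weight x (insert t S) i = ?A i + ?A i / (x t - x i)" if "i \<in> S" for i
    proof -
      have "x t \<noteq> x i" using that t by (metis imageI)
      then have "x t - x i \<noteq> 0" "x i - x t \<noteq> 0" by auto
      then show ?thesis
        unfolding node_weight_insert(1) [OF insert.hyps that] by (simp add: divide_simps) (simp add: algebra_simps)
    qed
    have w': "x i * node_weight x (insert t S) i = x i * ?A i + (x t * (?A i / (x t - x i)) - ?A i)" if "i \<in> S" for i
    proof -
      have "x t - x i \<noteq> 0" using that t by auto
      then show ?thesis unfolding w [OF that] by (simp add: divide_simps) (simp add: algebra_simps)
    qed
    have Sx: "(\<Sum>i\<in>S. x i * node_weight x (insert t S) i) =
        (\<Sum>i\<in>S. x i * ?A i) + (x t * (\<Sum>i\<in>S. ?A i / (x t - x i)) - (\<Sum>i\<in>S. ?A i))"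
      by (simp add: w' sum.distrib sum_subtractf sum_distrib_left)
    have S1: "(\<Sum>i\<in>S. node_weight x (insert t S) i) =
        (\<Sum>i\<in>S. ?A i) + (\<Sum>i\<in>S. ?A i / (x t - x i))"
      by (simp add: w sum.distrib)
    show ?case
      unfolding sum.insert [OF insert.hyps] card_insert_disjoint [OF insert.hyps] Sx S1 P
      using insert.IH [OF inj] by (simp add: algebra_simps)
  qed simp
  then show "(\<Sum>i\<in>S. node_weight x S i) = of_nat (card S)"
    "(\<Sum>i\<in>S. x i * node_weight x S i) = (\<Sum>i\<in>S. x i) - (\<Sum>k<card S. of_nat k)" by auto
qed

section \<open>Vandermonde products and removal of a cell\<close>

definition vandermonde :: "nat \<Rightarrow> (nat \<Rightarrow> rat) \<Rightarrow> rat" where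
  "vandermonde N x = (\<Prod>(i, j)\<in>{(i, j). i < j \<and> j < N}. x i - x j)"

lemma finite_index_pairs: "finite {(i, j). i < j \<and> j < (N :: nat)}"
  by (rule finite_subset [of _ "{..<N} \<times> {..<N}"]) auto

lemma vandermonde_split:
  assumes i: "i < N"
  shows "vandermonde N x = (\<Prod>(a, b)\<in>{(a, b). a < b \<and> b < N \<and> a \<noteq> i \<and> b \<noteq> i}. x a - x b) *
    (\<Prod>j\<in>{..<N} - {i}. (if i < j then 1 else -1) * (x i - x j))"
proof -
  let ?P = "{(a, b). a < b \<and> b < N}"
  let ?Q = "{(a, b). a < b \<and> b < N \<and> a \<noteq> i \<and> b \<noteq> i}"
  have "vandermonde N x = (\<Prod>(a, b)\<in>?P - ?Q. x a - x b) * (\<Prod>(a, b)\<in>?Q. x a - x b)"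
    unfolding vandermonde_def by (rule prod.subset_diff) (auto simp: finite_index_pairs)
  also have "(\<Prod>(a, b)\<in>?P - ?Q. x a - x b) = (\<Prod>j\<in>{..<N} - {i}. (if i < j then 1 else -1) * (x i - x j))"
    by (rule prod.reindex_bij_witness [where i = "\<lambda>j. (min i j, max i j)" and j = "\<lambda>(a, b). if a = i then b else a"])
      (use i in \<open>auto simp: min_def max_def\<close>)
  finally show ?thesis by (simp add: mult.commute)
qed

lemma vandermonde_shift:
  assumes "inj_on x {..<N}" and i: "i < N"
  shows "vandermonde N (x(i := x i - 1)) = node_weight x {..<N} i * vandermonde N x"
proof -
  let ?s = "\<lambda>j. if i < j then 1 else - 1 :: rat"
  let ?Q = "{(a, b). a < b \<and> b < N \<and> a \<noteq> i \<and> b \<noteq> i}"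
  have e1: "(\<Prod>(a, b)\<in>?Q. (x(i := x i - 1)) a - (x(i := x i - 1)) b) = (\<Prod>(a, b)\<in>?Q. x a - x b)"
    by (rule prod.cong) auto
  have e2: "(\<Prod>j\<in>{..<N} - {i}. ?s j * ((x(i := x i - 1)) i - (x(i := x i - 1)) j)) =
      (\<Prod>j\<in>{..<N} - {i}. ((x i - 1 - x j) / (x i - x j)) * (?s j * (x i - x j)))"
  proof (rule prod.cong [OF refl])
    fix j assume j: "j \<in> {..<N} - {i}"
    then have "x i - x j \<noteq> 0" using assms by (auto simp: inj_on_def)
    then show "?s j * ((x(i := x i - 1)) i - (x(i := x i - 1)) j) =
        ((x i - 1 - x j) / (x i - x j)) * (?s j * (x i - x j))"
      using j by simp
  qed
  have e3: "(\<Prod>j\<in>{..<N} - {i}. ((x i - 1 - x j) / (x i - x j)) * (?s j * (x i - x j))) =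
      (\<Prod>j\<in>{..<N} - {i}. (x i - 1 - x j) / (x i - x j)) * (\<Prod>j\<in>{..<N} - {i}. ?s j * (x i - x j))"
    by (rule prod.distrib)
  show ?thesis
    unfolding vandermonde_split [OF i] node_weight_def e1 e2 e3 by (simp only: mult.left_commute)
qed

lemma vandermonde_eq_0:
  assumes "i < j" "j < N" "x i = x j"
  shows "vandermonde N x = 0"
  unfolding vandermonde_def
  by (rule prod_zero [OF finite_index_pairs]) (use assms in \<open>auto intro: exI [of _ i] exI [of _ j]\<close>)

text \<open>The first-column hook lengths of a shape with at most \<open>N\<close> rows, padded to length \<open>N\<close>.\<close>

definition beta :: "nat \<Rightarrow> (nat \<Rightarrow> nat) \<Rightarrow> nat \<Rightarrow> nat" where
  "beta N f i = f i + (N - Suc i)"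

lemma beta_strict:
  assumes f: "f \<in> shapes n" and "i < j" "j < N"
  shows "beta N f j < beta N f i"
  using antimonoD [OF shapesD(1) [OF f], of i j] assms by (simp add: beta_def)

lemma sum_beta:
  assumes f: "f \<in> shapes n" and "n \<le> N"
  shows "(\<Sum>i<N. beta N f i) = n + (\<Sum>k<N. k)"
  using shapesD(3) [OF f assms(2)] sum.nat_diff_reindex [of "\<lambda>k. k" N]
  unfolding beta_def sum.distrib by simp

lemma hstrip_one_cell:
  assumes f: "f \<in> shapes (Suc n)" and N: "Suc n \<le> N"
  shows "{g. g \<in> shapes n \<and> hstrip g f} = (\<lambda>i. f(i := f i - 1)) ` {i. i < N \<and> f (Suc i) < f i}"
proof (intro equalityI subsetI)
  fix g assume g: "g \<in> {g. g \<in> shapes n \<and> hstrip g f}"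
  then have le: "g i \<le> f i" "f (Suc i) \<le> g i" for i by (auto simp: hstrip_def)
  have "(\<Sum>i<N. f i - g i) = (\<Sum>i<N. f i) - (\<Sum>i<N. g i)"
    using le by (intro sum_subtractf_nat) auto
  also have "\<dots> = Suc 0"
    using shapesD(3) [OF f N] shapesD(3) [of g n N] g N by simp
  finally obtain i where i: "i < N" "f i - g i = Suc 0" "\<And>j. j < N \<Longrightarrow> i \<noteq> j \<Longrightarrow> f j - g j = 0"
    by (auto simp: sum_eq_Suc0_iff)
  have "g = f(i := f i - 1)"
  proof
    fix j show "g j = (f(i := f i - 1)) j"
    proof (cases "j < N \<and> j \<noteq> i")
      case True
      then show ?thesis using i(3) [of j] le(1) [of j] by simp
    next
      case False
      then show ?thesis
        using i(1,2) shapesD(2) [OF f, of j] N le(1) [of j] by (cases "j = i") auto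
    qed
  qed
  moreover have "f (Suc i) < f i" using i(2) le(2) [of i] by linarith
  ultimately show "g \<in> (\<lambda>i. f(i := f i - 1)) ` {i. i < N \<and> f (Suc i) < f i}" using i(1) by blast
next
  fix g assume "g \<in> (\<lambda>i. f(i := f i - 1)) ` {i. i < N \<and> f (Suc i) < f i}"
  then obtain i where i: "i < N" "f (Suc i) < f i" and g: "g = f(i := f i - 1)" by blast
  have anti: "f (Suc j) \<le> f j" for j using shapesD(1) [OF f] by (simp add: antimono_iff_le_Suc)
  have hs: "hstrip g f" using i anti by (auto simp: hstrip_def g)
  moreover have "g \<in> shapes n"
  proof (rule shapesI [where N = N])
    show "antimono g" using hs by (rule hstrip_antimono)
    show "g j = 0" if "N \<le> j" for j using shapesD(2) [OF f, of j] that N i(1) by (simp add: g)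
    have "(\<Sum>j<N. g j) + 1 = (\<Sum>j<N. f j)"
      using i by (simp add: sum.remove [of "{..<N}" i] g)
    then show "(\<Sum>j<N. g j) = n" using shapesD(3) [OF f N] by simp
  qed
  ultimately show "g \<in> {g. g \<in> shapes n \<and> hstrip g f}" by simp
qed

lemma kostka_standard_Suc:
  assumes f: "f \<in> shapes (Suc n)" and N: "Suc n \<le> N"
  shows "kostka f (mset_set {1..Suc n}) =
    (\<Sum>i | i < N \<and> f (Suc i) < f i. kostka (f(i := f i - 1)) (mset_set {1..n}))"
proof -
  have "mset_set {1..Suc n} = mset_set {1..n} + replicate_mset 1 (Suc n)"
    by (simp add: atLeastAtMostSuc_conv)
  then have "kostka f (mset_set {1..Suc n}) =
      (\<Sum>g | g \<in> shapes (size (mset_set {1..n})) \<and> hstrip g f. kostka g (mset_set {1..n}))"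
    using kostka_rec [of f "mset_set {1..n}" 1 "Suc n"] f by simp
  also have "{g. g \<in> shapes (size (mset_set {1..n})) \<and> hstrip g f} =
      (\<lambda>i. f(i := f i - 1)) ` {i. i < N \<and> f (Suc i) < f i}"
    using hstrip_one_cell [OF f N] by simp
  also have "(\<Sum>g\<in>(\<lambda>i. f(i := f i - 1)) ` {i. i < N \<and> f (Suc i) < f i}. kostka g (mset_set {1..n})) =
      (\<Sum>i | i < N \<and> f (Suc i) < f i. kostka (f(i := f i - 1)) (mset_set {1..n}))"
  proof (subst sum.reindex)
    show "inj_on (\<lambda>i. f(i := f i - 1)) {i. i < N \<and> f (Suc i) < f i}"
    proof (rule inj_onI)
      fix i j assume i: "i \<in> {i. i < N \<and> f (Suc i) < f i}" and eq: "f(i := f i - 1) = f(j := f j - 1)"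
      show "i = j"
        using fun_cong [OF eq, of i] i by (auto split: if_splits)
    qed
  qed simp
  finally show ?thesis .
qed

section \<open>Hook lengths and the degree formula\<close>

definition column_length :: "(nat \<Rightarrow> nat) \<Rightarrow> nat \<Rightarrow> nat" where
  "column_length f j = card {i. j < f i}"

lemma less_column_length:
  assumes f: "f \<in> shapes n"
  shows "i < column_length f j \<longleftrightarrow> j < f i"
  unfolding column_length_def
proof (rule initial_segment [where n = n, symmetric])
  show "j < f i" if "j < f i'" "i < i'" for i i'
    using that antimonoD [OF shapesD(1) [OF f], of i i'] by simp
  show "\<not> j < f n" using shapesD(2) [OF f] by simp
qed

text \<open>The first summand counts the cell itself and its arm, the second its leg.\<close>

lemma hook_length_rows:
  assumes la: "rows la \<in> shapes n" and ij: "j < rows la i"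
  shows "hook_length la (i, j) = (rows la i - j) + (column_length (rows la) j - Suc i)"
proof -
  let ?f = "rows la"
  have "{(i', j') \<in> young_diagram la. (i' = i \<and> j \<le> j') \<or> (j' = j \<and> i \<le> i')} =
      {i} \<times> {j..<?f i} \<union> {Suc i..<column_length ?f j} \<times> {j}"
    using ij less_column_length [OF la] by (auto simp: young_diagram_rows diagram_def Suc_le_eq order_le_less)
  moreover have "card ({i} \<times> {j..<?f i} \<union> {Suc i..<column_length ?f j} \<times> {j}) =
      card ({i} \<times> {j..<?f i}) + card ({Suc i..<column_length ?f j} \<times> {j})"
    by (rule card_Un_disjoint) auto
  ultimately show ?thesis by (simp add: hook_length_def)
qed

text \<open>
  The hook lengths in row \<open>i\<close> and the differences \<open>beta i - beta k\<close> with \<open>k > i\<close> together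
  enumerate the numbers from 1 to \<open>beta i\<close>.
\<close>

lemma prod_hook_length_row:
  assumes f: "rows la \<in> shapes n" and N: "n \<le> N" and i: "i < N"
  shows "(\<Prod>j<rows la i. hook_length la (i, j)) *
    (\<Prod>k\<in>{i<..<N}. beta N (rows la) i - beta N (rows la) k) = fact (beta N (rows la) i)"
proof -
  let ?f = "rows la"
  let ?c = "column_length ?f"
  let ?b = "beta N ?f"
  define h where "h j = (?f i - j) + (?c j - Suc i)" for j
  define d where "d k = ?b i - ?b k" for k
  note lc = less_column_length [OF f]
  have cN: "?c j \<le> N" for j
    using lc [of N j] shapesD(2) [OF f N] by simp
  have anti: "?c j' \<le> ?c j" if "j \<le> j'" for j j'
  proof (rule ccontr)
    assume "\<not> ?thesis"
    then have "j' < ?f (?c j)" using lc [of "?c j" j'] by simp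
    moreover have "\<not> j < ?f (?c j)" using lc [of "?c j" j] by simp
    ultimately show False using that by simp
  qed
  have anti_f: "?f k \<le> ?f i" if "i \<le> k" for k using antimonoD [OF shapesD(1) [OF f] that] .
  have injh: "inj_on h {..<?f i}"
  proof (rule linorder_inj_onI)
    fix j j' assume "j < j'" "j \<in> {..<?f i}" "j' \<in> {..<?f i}"
    then show "h j \<noteq> h j'" using anti [of j j'] by (simp add: h_def)
  qed auto
  have injd: "inj_on d {i<..<N}"
  proof (rule linorder_inj_onI)
    fix k k' assume "k < k'" "k \<in> {i<..<N}" "k' \<in> {i<..<N}"
    then show "d k \<noteq> d k'"
      using beta_strict [OF f, of i k N] beta_strict [OF f, of k k' N] by (simp add: d_def)
  qed auto
  \<comment> \<open>A common value would mean \<open>?c j - j - 1 = k - ?f k\<close> over the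
    integers; the left-hand side is larger if the cell \<open>(k, j)\<close> belongs to the diagram
    and smaller if it does not.\<close>
  have disj: "h ` {..<?f i} \<inter> d ` {i<..<N} = {}"
  proof (rule ccontr)
    assume "h ` {..<?f i} \<inter> d ` {i<..<N} \<noteq> {}"
    then obtain j k where j: "j < ?f i" and k: "i < k" "k < N" and eq: "h j = d k" by auto
    have "i < ?c j" using lc j by simp
    then show False
      using eq j k lc [of k j] anti_f [of k] by (cases "j < ?f k") (auto simp: h_def d_def beta_def)
  qed
  have sub: "h ` {..<?f i} \<union> d ` {i<..<N} \<subseteq> {1..?b i}"
  proof (intro Un_least image_subsetI)
    fix j assume "j \<in> {..<?f i}"
    then show "h j \<in> {1..?b i}" using cN [of j] by (auto simp: h_def beta_def)
  next
    fix k assume "k \<in> {i<..<N}"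
    then show "d k \<in> {1..?b i}" using beta_strict [OF f, of i k N] by (auto simp: d_def)
  qed
  have "card (h ` {..<?f i} \<union> d ` {i<..<N}) = ?f i + (N - Suc i)"
    using disj by (subst card_Un_disjoint) (auto simp: card_image injh injd)
  then have un: "h ` {..<?f i} \<union> d ` {i<..<N} = {1..?b i}"
    using sub by (intro card_subset_eq) (auto simp: beta_def)
  have "(\<Prod>j<?f i. hook_length la (i, j)) = (\<Prod>j<?f i. h j)"
    using hook_length_rows [OF f] by (intro prod.cong) (auto simp: h_def)
  also have "\<dots> = \<Prod>(h ` {..<?f i})" by (simp add: prod.reindex [OF injh])
  finally have 1: "(\<Prod>j<?f i. hook_length la (i, j)) = \<Prod>(h ` {..<?f i})" .
  have 2: "(\<Prod>k\<in>{i<..<N}. ?b i - ?b k) = \<Prod>(d ` {i<..<N})"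
    unfolding prod.reindex [OF injd] by (simp add: d_def)
  have "\<Prod>(h ` {..<?f i}) * \<Prod>(d ` {i<..<N}) = \<Prod>(h ` {..<?f i} \<union> d ` {i<..<N})"
    using disj by (intro prod.union_disjoint [symmetric]) auto
  also have "\<dots> = fact (?b i)" unfolding un by (simp add: fact_prod)
  finally show ?thesis unfolding 1 2 .
qed

lemma vandermonde_beta:
  assumes f: "f \<in> shapes n"
  shows "vandermonde N (\<lambda>i. of_nat (beta N f i)) =
    of_nat (\<Prod>i<N. \<Prod>k\<in>{i<..<N}. beta N f i - beta N f k)"
proof -
  have "vandermonde N (\<lambda>i. of_nat (beta N f i)) =
      (\<Prod>(i, j)\<in>(SIGMA i:{..<N}. {i<..<N}). of_nat (beta N f i) - of_nat (beta N f j))"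
    unfolding vandermonde_def by (rule prod.cong) auto
  also have "\<dots> = (\<Prod>i<N. \<Prod>j\<in>{i<..<N}. of_nat (beta N f i) - of_nat (beta N f j))"
    by (rule prod.Sigma [symmetric]) auto
  also have "\<dots> = of_nat (\<Prod>i<N. \<Prod>k\<in>{i<..<N}. beta N f i - beta N f k)"
    unfolding of_nat_prod using beta_strict [OF f] by (intro prod.cong refl) (simp add: of_nat_diff less_imp_le)
  finally show ?thesis .
qed

text \<open>Frobenius' formula for the degree. Removing a cell from row \<open>i\<close> lowers the
  node \<open>beta N f i\<close> by 1, so the induction reduces the claim to the first moment of the
  node weights: the sum of the nodes minus \<open>0 + ... + (N - 1)\<close>, which is the number of
  cells. \<open>N\<close> stays fixed, as all shapes must be padded alike.\<close>

lemma kostka_standard: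
  assumes "f \<in> shapes n" "n \<le> N"
  shows "of_nat (kostka f (mset_set {1..n})) * (\<Prod>i<N. fact (beta N f i)) =
    fact n * vandermonde N (\<lambda>i. of_nat (beta N f i))"
  using assms
proof (induction n arbitrary: f)
  case 0
  then have f: "f = (\<lambda>_. 0)" by (simp add: shapes_0)
  \<comment> \<open>The empty partition has no hooks, so the row identity says that the differences
    of the nodes \<open>N - 1, ..., 0\<close> multiply up to factorials.\<close>
  have "rows [] = (\<lambda>_. 0)" by (simp add: rows_def fun_eq_iff)
  then have "(\<Prod>k\<in>{i<..<N}. beta N f i - beta N f k) = fact (beta N f i)" if "i < N" for i
    using prod_hook_length_row [of "[]" 0 N i] that 0 f by simp
  then show ?case using vandermonde_beta [OF 0(1), of N] by (simp add: f)
next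
  case (Suc n)
  note f = Suc.prems(1)
  define x :: "nat \<Rightarrow> rat" where "x i = of_nat (beta N f i)" for i
  define W :: rat where "W = (\<Prod>i<N. fact (beta N f i))"
  let ?I = "{i. i < N \<and> f (Suc i) < f i}"
  have inj: "inj_on x {..<N}"
  proof (rule inj_onI)
    fix i j assume ij: "i \<in> {..<N}" "j \<in> {..<N}" and eq: "x i = x j"
    show "i = j"
      using beta_strict [OF f, of i j N] beta_strict [OF f, of j i N] ij eq
      by (cases i j rule: linorder_cases) (auto simp: x_def)
  qed
  have summand: "of_nat (kostka (f(i := f i - 1)) (mset_set {1..n})) * W =
      fact n * (x i * vandermonde N (x(i := x i - 1)))" if i: "i \<in> ?I" for i
  proof -
    let ?g = "f(i := f i - 1)"
    have fi: "f i \<ge> 1" "i < N" using i by auto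
    have "?g \<in> shapes n" using hstrip_one_cell [OF f Suc.prems(2)] i by blast
    then have IH: "of_nat (kostka ?g (mset_set {1..n})) * (\<Prod>j<N. fact (beta N ?g j)) =
        fact n * vandermonde N (\<lambda>j. of_nat (beta N ?g j))"
      using Suc.IH Suc.prems(2) by simp
    have b: "beta N ?g = (beta N f)(i := beta N f i - 1)" using fi by (auto simp: beta_def fun_eq_iff)
    have bi: "beta N f i \<ge> 1" using fi by (simp add: beta_def)
    have xb: "(\<lambda>j. of_nat (beta N ?g j)) = x(i := x i - 1)"
      unfolding b using bi by (auto simp: x_def fun_eq_iff of_nat_diff)
    have "W = fact (beta N f i) * (\<Prod>j\<in>{..<N} - {i}. fact (beta N f j))"
      unfolding W_def using fi by (intro prod.remove) auto
    also have "fact (beta N f i) = x i * (fact (beta N f i - 1) :: rat)"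
      using bi by (simp add: x_def fact_reduce)
    also have "x i * fact (beta N f i - 1) * (\<Prod>j\<in>{..<N} - {i}. fact (beta N f j)) =
        x i * (fact (beta N ?g i) * (\<Prod>j\<in>{..<N} - {i}. fact (beta N ?g j)))"
      unfolding b by simp
    also have "fact (beta N ?g i) * (\<Prod>j\<in>{..<N} - {i}. fact (beta N ?g j)) =
        (\<Prod>j<N. fact (beta N ?g j) :: rat)"
      using fi by (intro prod.remove [symmetric]) auto
    finally have "W = x i * (\<Prod>j<N. fact (beta N ?g j))" .
    then show ?thesis using IH unfolding xb by simp
  qed
  \<comment> \<open>Rows without a removable cell may be added to the sum: lowering the node makes
    it collide with the next one, or, in the last row, the node itself is 0.\<close>
  have zero: "x i * vandermonde N (x(i := x i - 1)) = 0" if i: "i \<in> {..<N} - ?I" for i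
  proof -
    have eq: "f (Suc i) = f i"
      using i antimonoD [OF shapesD(1) [OF f], of i "Suc i"] by auto
    show ?thesis
    proof (cases "Suc i < N")
      case True
      have "beta N f i = beta N f (Suc i) + 1" using True eq by (simp add: beta_def)
      then have "(x(i := x i - 1)) i = (x(i := x i - 1)) (Suc i)" by (simp add: x_def)
      then show ?thesis using vandermonde_eq_0 [of i "Suc i" N] True by simp
    next
      case False
      then have "f i = 0" "Suc i = N" using i eq shapesD(2) [OF f, of "Suc i"] Suc.prems(2) by auto
      then show ?thesis by (simp add: x_def beta_def)
    qed
  qed
  have "of_nat (kostka f (mset_set {1..Suc n})) * W = (\<Sum>i\<in>?I. fact n * (x i * vandermonde N (x(i := x i - 1))))"
    unfolding kostka_standard_Suc [OF f Suc.prems(2)] of_nat_sum sum_distrib_right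
    using summand by (intro sum.cong) auto
  also have "\<dots> = fact n * (\<Sum>i\<in>?I. x i * vandermonde N (x(i := x i - 1)))"
    by (simp only: sum_distrib_left)
  also have "(\<Sum>i\<in>?I. x i * vandermonde N (x(i := x i - 1))) = (\<Sum>i<N. x i * vandermonde N (x(i := x i - 1)))"
    using zero by (intro sum.mono_neutral_left) auto
  also have "\<dots> = (\<Sum>i<N. x i * node_weight x {..<N} i) * vandermonde N x"
    unfolding sum_distrib_right using inj by (intro sum.cong) (simp_all add: vandermonde_shift)
  also have "(\<Sum>i<N. x i * node_weight x {..<N} i) = (\<Sum>i<N. x i) - (\<Sum>k<N. of_nat k)"
    using sum_node_weight(2) [OF _ inj] by simp
  also have "(\<Sum>i<N. x i) = of_nat (Suc n) + (\<Sum>k<N. of_nat k)"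
    unfolding x_def of_nat_sum [symmetric] sum_beta [OF f Suc.prems(2)] by simp
  finally show ?case by (simp add: W_def x_def)
qed

text \<open>Multiplied over all rows, \<open>prod_hook_length_row\<close> shows that the hook
  product times the Vandermonde product is the product of factorials in Frobenius' formula; the
  Vandermonde product is nonzero and cancels.\<close>

theorem hook_length_formula:
  assumes la: "la \<in> partitions n"
  shows "kostka (rows la) (mset_set {1..n}) * hook_product la = fact n"
proof -
  let ?f = "rows la"
  let ?b = "beta n ?f"
  have f: "?f \<in> shapes n" using bij_betw_rows la by (auto simp: bij_betw_def)
  let ?V = "\<Prod>i<n. \<Prod>k\<in>{i<..<n}. ?b i - ?b k"
  have "hook_product la = (\<Prod>(i, j)\<in>(SIGMA i:{..<n}. {..<?f i}). hook_length la (i, j))"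
    by (simp add: hook_product_def young_diagram_rows diagram_eq_Sigma [OF f order.refl])
  also have "\<dots> = (\<Prod>i<n. \<Prod>j<?f i. hook_length la (i, j))"
    by (rule prod.Sigma [symmetric]) auto
  finally have "hook_product la * ?V = (\<Prod>i<n. fact (?b i))"
    using prod_hook_length_row [OF f order.refl] by (simp flip: prod.distrib)
  then have H: "of_nat (hook_product la) * of_nat ?V = (\<Prod>i<n. fact (?b i) :: rat)"
    unfolding of_nat_mult [symmetric] by (simp only: of_nat_prod of_nat_fact)
  note V = vandermonde_beta [OF f, of n]
  have "?V \<noteq> 0" using beta_strict [OF f] by (fastforce simp: prod_zero_iff)
  moreover have "of_nat (kostka ?f (mset_set {1..n})) * (of_nat (hook_product la) * of_nat ?V) = fact n * (of_nat ?V :: rat)"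
    using kostka_standard [OF f order.refl] unfolding H V .
  ultimately have "of_nat (kostka ?f (mset_set {1..n}) * hook_product la) = (of_nat (fact n) :: rat)"
    by simp
  then show ?thesis by (simp only: of_nat_eq_iff)
qed

section \<open>Products of squares and of commutators\<close>

lemma perm_prod_Cons: "perm_prod (x # xs) = x \<circ> perm_prod xs"
  by (simp add: perm_prod_def)

lemma sum_tuples_Suc:
  "(\<Sum>xs\<in>tuples (Suc k) A. F xs) = (\<Sum>a\<in>A. \<Sum>xs\<in>tuples k A. F (a # xs))"
proof -
  have "(\<Sum>xs\<in>tuples (Suc k) A. F xs) = (\<Sum>(a, xs)\<in>A \<times> tuples k A. F (a # xs))"
    by (rule sum.reindex_bij_witness [where i = "\<lambda>(a, xs). a # xs" and j = "\<lambda>xs. (hd xs, tl xs)"])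
      (auto simp: tuples_def length_Suc_conv)
  then show ?thesis by (simp add: sum.cartesian_product)
qed

lemma sum_conv:
  "(\<Sum>w\<in>perms n. conv n f g w * F w) = (\<Sum>u\<in>perms n. \<Sum>v\<in>perms n. f u * g v * F (u \<circ> v))"
proof -
  have "(\<Sum>w\<in>perms n. conv n f g w * F w) = (\<Sum>u\<in>perms n. \<Sum>w\<in>perms n. f u * g (inv u \<circ> w) * F w)"
    unfolding conv_def sum_distrib_right by (rule sum.swap)
  also have "\<dots> = (\<Sum>u\<in>perms n. \<Sum>v\<in>perms n. f u * g v * F (u \<circ> v))"
  proof (rule sum.cong [OF refl])
    fix u assume u: "u \<in> perms n"
    show "(\<Sum>w\<in>perms n. f u * g (inv u \<circ> w) * F w) = (\<Sum>v\<in>perms n. f u * g v * F (u \<circ> v))"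
      using sum_perms_left [OF u, of "\<lambda>w. f u * g (inv u \<circ> w) * F w"] u by simp
  qed
  finally show ?thesis .
qed

text \<open>The number of ways to write \<open>w\<close> as a product of values of
  \<open>\<phi>\<close> is an iterated convolution. Each of the \<open>Suc k\<close> factors
  contributes \<open>d f\<close>, and each of the \<open>k\<close> convolutions contributes
  \<open>fact n / chi n f id\<close>.\<close>

lemma sum_tuples_chi:
  fixes F :: "(nat \<Rightarrow> nat) \<Rightarrow> rat"
  assumes A: "finite A" "\<phi> ` A \<subseteq> perms n"
    and D: "\<And>w. w \<in> perms n \<Longrightarrow> of_nat (card {a \<in> A. \<phi> a = w}) = (\<Sum>f\<in>shapes n. d f * chi n f w)"
  shows "(\<Sum>xs\<in>tuples (Suc k) A. F (perm_prod (map \<phi> xs))) =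
    (\<Sum>w\<in>perms n. (\<Sum>f\<in>shapes n. d f ^ Suc k * (fact n / chi n f id) ^ k * chi n f w) * F w)"
proof (induction k arbitrary: F)
  case 0
  have "tuples 0 A = {[]}" by (auto simp: tuples_def)
  then have "(\<Sum>xs\<in>tuples (Suc 0) A. F (perm_prod (map \<phi> xs))) = (\<Sum>a\<in>A. F (\<phi> a))"
    by (simp add: sum_tuples_Suc perm_prod_def)
  also have "\<dots> = (\<Sum>w\<in>perms n. (\<Sum>f\<in>shapes n. d f * chi n f w) * F w)"
    by (rule sum_perm_image [OF A D])
  finally show ?case by simp
next
  case (Suc k)
  let ?D = "\<lambda>w. \<Sum>f\<in>shapes n. d f * chi n f w"
  let ?E = "\<lambda>w. \<Sum>f\<in>shapes n. d f ^ Suc k * (fact n / chi n f id) ^ k * chi n f w"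
  have "(\<Sum>xs\<in>tuples (Suc (Suc k)) A. F (perm_prod (map \<phi> xs))) =
      (\<Sum>a\<in>A. \<Sum>w\<in>perms n. ?E w * F (\<phi> a \<circ> w))"
    unfolding sum_tuples_Suc [of _ "Suc k"] list.map perm_prod_Cons
    using Suc.IH by (intro sum.cong refl)
  also have "\<dots> = (\<Sum>u\<in>perms n. ?D u * (\<Sum>w\<in>perms n. ?E w * F (u \<circ> w)))"
    by (rule sum_perm_image [OF A D])
  also have "\<dots> = (\<Sum>w\<in>perms n. conv n ?D ?E w * F w)"
    unfolding sum_conv
  proof (intro sum.cong refl)
    fix u
    show "?D u * (\<Sum>w\<in>perms n. ?E w * F (u \<circ> w)) = (\<Sum>v\<in>perms n. ?D u * ?E v * F (u \<circ> v))"
      by (subst sum_distrib_left) (simp only: mult.assoc)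
  qed
  also have "\<dots> = (\<Sum>w\<in>perms n. (\<Sum>f\<in>shapes n. d f ^ Suc (Suc k) * (fact n / chi n f id) ^ Suc k * chi n f w) * F w)"
    by (rule sum.cong [OF refl], subst conv_sum_chi) (simp_all add: mult_ac)
  finally show ?case .
qed

section \<open>Comparison of coefficients\<close>

lemma mcoeff_sum: "mcoeff (\<Sum>i\<in>I. F i) m = (\<Sum>i\<in>I. mcoeff (F i) m)"
  by (induction I rule: infinite_finite_induct) (simp_all add: zero_mfps_def plus_mfps_def)

lemma mcoeff_mscale: "mcoeff (mscale c f) m = c * mcoeff f m"
  by (simp add: mscale_def)

lemma mcoeff_schur: "mcoeff (schur la) m = of_nat (kostka (rows la) m)"
proof -
  have "{T \<in> ssyt la. tableau_monomial la T = m} = tableaux (rows la) m"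
    by (auto simp: ssyt_def tableaux_def tableau_monomial_def young_diagram_rows)
  then show ?thesis by (simp add: schur_def kostka_def)
qed

text \<open>Coefficients are compared at monomials of every degree; in degrees other than
  \<open>n\<close> there are neither words nor tableaux.\<close>

lemma inner_prod_chi_perm_char:
  assumes f: "f \<in> shapes n"
  shows "inner_prod n (chi n f) (perm_char n m) = of_nat (kostka f m)"
proof (cases "size m = n")
  case False
  have "words n m = {}" using False by (auto simp: words_def)
  moreover have "tableaux f m = {}" using False tableaux_size [OF f] by blast
  ultimately show ?thesis by (simp add: inner_prod_def perm_char_def kostka_def)
qed (rule inner_prod_chi_perm_char_size [OF f])

text \<open>The hypothesis says that the values \<open>p x\<close> are distributed over the group as
  the class function with coefficients \<open>a\<close>. The coefficient at \<open>m\<close> is the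
  inner product of this function with the permutation character of \<open>m\<close>, to which each
  \<open>chi n f\<close> contributes a Kostka number, the coefficient of its Schur function.\<close>

lemma power_sum_expansion:
  assumes p: "p ` X \<subseteq> perms n"
    and sum: "\<And>F :: (nat \<Rightarrow> nat) \<Rightarrow> rat.
      (\<Sum>x\<in>X. F (p x)) = (\<Sum>w\<in>perms n. (\<Sum>f\<in>shapes n. a f * chi n f w) * F w)"
  shows "mscale (1 / fact n) (\<Sum>x\<in>X. power_sum_sym (cycle_type n (p x))) =
    (\<Sum>la\<in>partitions n. mscale (a (rows la)) (schur la))" (is "?l = ?r")
proof (rule mfps_eqI)
  fix m
  have "mcoeff ?l m = (\<Sum>x\<in>X. perm_char n m (p x)) / fact n"
    using p by (simp add: mcoeff_mscale mcoeff_sum) (auto simp: mcoeff_power_sum_cycle_type intro!: sum.cong)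
  also have "\<dots> = inner_prod n (perm_char n m) (\<lambda>w. \<Sum>f\<in>shapes n. a f * chi n f w)"
    unfolding sum inner_prod_def by (simp add: mult.commute)
  also have "\<dots> = (\<Sum>f\<in>shapes n. a f * of_nat (kostka f m))"
    unfolding inner_prod_sum_right
    by (intro sum.cong refl) (simp add: inner_prod_commute [of n "perm_char n m"] inner_prod_chi_perm_char)
  also have "\<dots> = (\<Sum>la\<in>partitions n. a (rows la) * of_nat (kostka (rows la) m))"
    by (rule sum.reindex_bij_betw [OF bij_betw_rows, symmetric])
  also have "\<dots> = mcoeff ?r m" by (simp add: mcoeff_mscale mcoeff_sum mcoeff_schur)
  finally show "mcoeff ?l m = mcoeff ?r m" .
qed

lemma hook_product_eq:
  assumes la: "la \<in> partitions n"
  shows "fact n / chi n (rows la) id = of_nat (hook_product la)"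
proof -
  have f: "rows la \<in> shapes n" using bij_betw_rows la by (auto simp: bij_betw_def)
  have "(fact n :: rat) = chi n (rows la) id * of_nat (hook_product la)"
    using arg_cong [OF hook_length_formula [OF la], of "of_nat :: nat \<Rightarrow> rat"] by (simp add: chi_id [OF f])
  then show ?thesis using conv_chi_chi_self(1) [OF f] by (simp add: field_simps)
qed

lemma perm_prod_in:
  assumes "\<phi> ` A \<subseteq> perms n"
  shows "(\<lambda>xs. perm_prod (map \<phi> xs)) ` tuples k A \<subseteq> perms n"
proof (rule image_subsetI)
  fix xs assume "xs \<in> tuples k A"
  then have "set xs \<subseteq> A" by (simp add: tuples_def)
  then show "perm_prod (map \<phi> xs) \<in> perms n"
  proof (induction xs)
    case Nil
    have "perm_prod (map \<phi> []) = id" by (simp add: perm_prod_def fun_eq_iff)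
    then show ?case by (simp only: perms_id)
  next
    case (Cons x xs)
    then have "\<phi> x \<in> perms n" using assms by auto
    moreover have "perm_prod (map \<phi> xs) \<in> perms n" using Cons by simp
    ultimately show ?case unfolding list.map perm_prod_Cons by (rule perms_comp)
  qed
qed

theorem corollary4:
  fixes n k g :: nat
  assumes "n \<ge> 1" and "k \<ge> 1" and "g \<ge> 1"
  shows
    "mscale (1 / fact n)
       (\<Sum>us\<in>tuples k (perms n).
          power_sum_sym (cycle_type n (perm_prod (map (\<lambda>u. u ^^ 2) us))))
     = (\<Sum>la\<in>partitions n. mscale (of_nat (hook_product la ^ (k - 1))) (schur la))
     \<and>
     mscale (1 / fact n)
       (\<Sum>uvs\<in>tuples g (perms n \<times> perms n).
          power_sum_sym (cycle_type n (perm_prod (map (\<lambda>(u, v). commutator u v) uvs))))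
     = (\<Sum>la\<in>partitions n. mscale (of_nat (hook_product la ^ (2 * g - 1))) (schur la))"
proof -
  let ?H = "\<lambda>f. fact n / chi n f id"
  obtain k' where k: "k = Suc k'" using assms(2) by (cases k) auto
  obtain g' where g: "g = Suc g'" using assms(3) by (cases g) auto
  let ?sq = "\<lambda>u :: nat \<Rightarrow> nat. u ^^ 2"
  let ?com = "\<lambda>(u, v). commutator u v"
  have sq: "?sq = (\<lambda>u. u \<circ> u)" by (simp add: numeral_2_eq_2 fun_eq_iff)
  have sq_in: "?sq ` perms n \<subseteq> perms n" unfolding sq by (auto intro: perms_comp)
  have com_in: "?com ` (perms n \<times> perms n) \<subseteq> perms n"
    by (auto simp: commutator_def intro!: perms_comp perms_inv)
  have 1: "(\<Sum>us\<in>tuples k (perms n). F (perm_prod (map ?sq us))) =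
      (\<Sum>w\<in>perms n. (\<Sum>f\<in>shapes n. ?H f ^ k' * chi n f w) * F w)" for F :: "(nat \<Rightarrow> nat) \<Rightarrow> rat"
    using sum_tuples_chi [OF finite_perms sq_in, of "\<lambda>_. 1" F k'] by (simp add: k sq card_squares)
  \<comment> \<open>Each of the \<open>g\<close> commutators brings a factor \<open>?H f\<close>
    through \<open>card_commutators\<close>, and each of the \<open>g'\<close> convolutions another
    one; for squares only the convolutions do.\<close>
  have 2: "(\<Sum>uvs\<in>tuples g (perms n \<times> perms n). F (perm_prod (map ?com uvs))) =
      (\<Sum>w\<in>perms n. (\<Sum>f\<in>shapes n. ?H f ^ Suc g' * ?H f ^ g' * chi n f w) * F w)"
    for F :: "(nat \<Rightarrow> nat) \<Rightarrow> rat"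
    unfolding g
  proof (rule sum_tuples_chi [OF _ com_in])
    show "finite (perms n \<times> perms n)" by (simp add: finite_perms)
    fix w assume w: "w \<in> perms n"
    have "{a \<in> perms n \<times> perms n. ?com a = w} = {(u, v) \<in> perms n \<times> perms n. commutator u v = w}"
      by auto
    then show "of_nat (card {a \<in> perms n \<times> perms n. ?com a = w}) = (\<Sum>f\<in>shapes n. ?H f * chi n f w)"
      using card_commutators [OF w] by simp
  qed
  have e: "k - 1 = k'" "2 * g - 1 = Suc g' + g'" by (simp_all add: k g)
  have "?H (rows la) ^ k' = of_nat (hook_product la ^ (k - 1))"
    "?H (rows la) ^ Suc g' * ?H (rows la) ^ g' = of_nat (hook_product la ^ (2 * g - 1))"
    if "la \<in> partitions n" for la
    unfolding e hook_product_eq [OF that] by (simp_all add: power_add)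
  then show ?thesis
    unfolding power_sum_expansion [OF perm_prod_in [OF sq_in] 1] power_sum_expansion [OF perm_prod_in [OF com_in] 2]
    by (intro conjI sum.cong refl) (simp_all only:)
qed

end
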